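(* Let $\mathbf{X}\subset\mathbb{R}$ be a Poisson cluster process with immigrant intensity $\nu>0$, number of points per cluster $S$ and cluster radius $L$. Assume that the function $\theta\mapsto \mathrm{E}[\mathrm{e}^{\theta S}]$ is essentially smooth, that $0\in\mathcal{D}_S^{\circ}$, and that $\mathrm{E}[L\mathrm{e}^{\theta S}]<\infty$ for all $\theta\in\mathcal{D}_S^{\circ}$. Then the family $\{N_{\mathbf{X}}(0,t]/t\}_{t>0}$ satisfies a large deviation principle on $\mathbb{R}$ (as $t\to\infty$) with speed $t$ and good rate function $$\Lambda^*(x)=\sup_{\theta\in\mathbb{R}}(\theta x-\Lambda(\theta)),\qquad \Lambda(\theta)=\nu(\mathrm{E}[\mathrm{e}^{\theta S}]-1).$$
   Context: Poisson cluster process. (a) The immigrants form a homogeneous Poisson process $I$ on $\mathbb{R}$ with points $X_i$ and intensity $\nu>0$. (b) Each immigrant $X_i$ generates a cluster $C_i=C_{X_i}$, a finite point process on $\mathbb{R}$ containing $X_i$. (c) Given the immigrants, the centered clusters $C_i-X_i=\{Y-X_i: Y\in C_i\}$ are independent, identically distributed, and independent of $I$. (d) $\mathbf{X}$ is the union of all clusters. $C_0$ denotes the cluster generated by an immigrant at $0$ (i.e. a point process with the common law of the centered clusters); $S$ is the number of points in $C_0$, with standing assumption $\mathrm{E}[S]<\infty$; $L=\sup_{Y\in C_0}|Y|$ is the radius of $C_0$. $N_{\mathbf{Y}}(0,t]$ is the number of points of a point process $\mathbf{Y}$ in $(0,t]$. $\mathcal{D}_S=\{\theta\in\mathbb{R}:\mathrm{E}[\mathrm{e}^{\theta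 S}]<\infty\}$, with interior $\mathcal{D}_S^{\circ}$; $\Lambda(\theta)=+\infty$ when $\mathrm{E}[\mathrm{e}^{\theta S}]=\infty$. A convex function $\varphi:\mathbb{R}\to(-\infty,\infty]$ is essentially smooth if the interior of $\{\varphi<\infty\}$ is nonempty, $\varphi$ is differentiable on that interior, and $|\varphi'(\theta_n)|\to\infty$ whenever $\theta_n$ is a sequence in the interior converging to a boundary point of it. Large deviation principle (LDP): a family $\{V_\alpha\}_{\alpha\in(0,\infty)}$ of random variables with values in a topological space $M$ satisfies the LDP with rate function $J$ and speed $v$ if $J:M\to[0,\infty]$ is lower semi-continuous, $v:[0,\infty)\to[0,\infty)$ is measurable and increases to infinity, and for every Borel set $B\subset M$, $$-\inf_{x\in B^\circ}J(x)\le\liminf_{\alpha\to\infty}\frac{1}{v(\alpha)}\log P(V_\alpha\in B)\le\limsup_{\alpha\to\infty}\frac{1}{v(\alpha)}\log P(V_\alpha\in B)\le-\inf_{x\in\overline{B}}J(x).$$ The rate function is good if its level sets $\{x:J(x)\le a\}$, $a\ge 0$, are compact. *)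

theory Defs
  imports "HOL-Probability.Probability"
begin

section \<open>Point processes on the real line\<close>

text \<open>
  A (simple) point process is a random locally finite subset of the line; the \<sigma>-algebra on
  configurations is the one generated by the counts in bounded Borel sets.
\<close>

definition configurations :: "real set set" where
  "configurations = {A. \<forall>B. bounded B \<longrightarrow> finite (A \<inter> B)}"

definition config_space :: "real set measure" where
  "config_space = sigma configurations
     {{A \<in> configurations. card (A \<inter> B) = n} | B n. B \<in> sets borel \<and> bounded B}"

definition point_process :: "'a measure \<Rightarrow> ('a \<Rightarrow> real set) \<Rightarrow> bool" where
  "point_process M Y \<longleftrightarrow> Y \<in> measurable M config_space"

definition finite_point_process :: "'a measure \<Rightarrow> ('a \<Rightarrow> real set) \<Rightarrow> bool" where
  "finite_point_process M Y \<longleftrightarrow> point_process M Y \<and> (\<forall>\<omega>\<in>space M. finite (Y \<omega>))"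

text \<open>
  The library's \<open>poisson_pmf\<close> is only specified for a positive rate, hence the explicit weights,
  which also cover Lebesgue null sets.
\<close>

definition homogeneous_poisson_process :: "'a measure \<Rightarrow> real \<Rightarrow> ('a \<Rightarrow> real set) \<Rightarrow> bool" where
  "homogeneous_poisson_process M \<nu> Y \<longleftrightarrow>
     point_process M Y \<and>
     (\<forall>B n. B \<in> sets borel \<longrightarrow> bounded B \<longrightarrow>
        measure M {\<omega> \<in> space M. card (Y \<omega> \<inter> B) = n}
          = (\<nu> * measure lborel B) ^ n / fact n * exp (- (\<nu> * measure lborel B))) \<and>
     (\<forall>(B :: nat \<Rightarrow> real set) J. finite J \<longrightarrow> disjoint_family_on B J \<longrightarrow>
        (\<forall>j\<in>J. B j \<in> sets borel \<and> bounded (B j)) \<longrightarrow>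
        prob_space.indep_vars M (\<lambda>_. count_space UNIV) (\<lambda>j \<omega>. card (Y \<omega> \<inter> B j)) J)"


section \<open>Poisson cluster processes\<close>

definition centered_cluster ::
    "(nat \<Rightarrow> 'a \<Rightarrow> real) \<Rightarrow> (nat \<Rightarrow> 'a \<Rightarrow> real set) \<Rightarrow> nat \<Rightarrow> 'a \<Rightarrow> real set" where
  "centered_cluster X C i \<omega> = (\<lambda>y. y - X i \<omega>) ` C i \<omega>"

text \<open>
  The immigrants are enumerated by random variables \<open>X i\<close>, \<open>C i\<close> is the cluster of \<open>X i\<close>, and
  \<open>C0\<close> is a random set having the common law of the centered clusters.  The last independence
  assumption is stated for the enumeration \<open>(X i)\<^sub>i\<close> and not only for the set of immigrants, so
  that the assignment of clusters to immigrants is covered as well.  No assumption is made on the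
  joint law of \<open>C0\<close> with the other objects.
\<close>

locale poisson_cluster_process = prob_space M for M :: "'a measure" +
  fixes \<nu> :: real
    and X :: "nat \<Rightarrow> 'a \<Rightarrow> real"
    and C :: "nat \<Rightarrow> 'a \<Rightarrow> real set"
    and C0 :: "'a \<Rightarrow> real set"
  assumes intensity_pos: "0 < \<nu>"
    and immigrant_measurable: "\<And>i. X i \<in> borel_measurable M"
    and immigrants_distinct: "AE \<omega> in M. inj (\<lambda>i. X i \<omega>)"
    and immigrants_poisson: "homogeneous_poisson_process M \<nu> (\<lambda>\<omega>. range (\<lambda>i. X i \<omega>))"
    and cluster_finite: "\<And>i. finite_point_process M (C i)"
    and immigrant_in_cluster: "\<And>i \<omega>. \<omega> \<in> space M \<Longrightarrow> X i \<omega> \<in> C i \<omega>"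
    and centered_indep: "indep_vars (\<lambda>_. config_space) (centered_cluster X C) UNIV"
    and centered_indep_immigrants:
      "indep_set
         {(\<lambda>\<omega> i. X i \<omega>) -` A \<inter> space M | A. A \<in> sets (\<Pi>\<^sub>M i\<in>UNIV. borel)}
         {(\<lambda>\<omega> i. centered_cluster X C i \<omega>) -` A \<inter> space M | A.
            A \<in> sets (\<Pi>\<^sub>M i\<in>UNIV. config_space)}"
    and C0_finite: "finite_point_process M C0"
    and centered_distr: "\<And>i. distr M config_space (centered_cluster X C i) = distr M config_space C0"
    and mean_cluster_size_finite: "(\<integral>\<^sup>+\<omega>. ennreal (real (card (C0 \<omega>))) \<partial>M) < \<infinity>"

definition cluster_process :: "(nat \<Rightarrow> 'a \<Rightarrow> real set) \<Rightarrow> 'a \<Rightarrow> real set" where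
  "cluster_process C \<omega> = (\<Union>i. C i \<omega>)"

definition cluster_size :: "('a \<Rightarrow> real set) \<Rightarrow> 'a \<Rightarrow> nat" where
  "cluster_size C0 \<omega> = card (C0 \<omega>)"

definition cluster_radius :: "('a \<Rightarrow> real set) \<Rightarrow> 'a \<Rightarrow> real" where
  "cluster_radius C0 \<omega> = (SUP y\<in>C0 \<omega>. \<bar>y\<bar>)"

definition size_mgf :: "'a measure \<Rightarrow> ('a \<Rightarrow> real set) \<Rightarrow> real \<Rightarrow> ereal" where
  "size_mgf M C0 \<theta> =
     enn2ereal (\<integral>\<^sup>+\<omega>. ennreal (exp (\<theta> * real (cluster_size C0 \<omega>))) \<partial>M)"

definition size_domain :: "'a measure \<Rightarrow> ('a \<Rightarrow> real set) \<Rightarrow> real set" where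
  "size_domain M C0 = {\<theta>. size_mgf M C0 \<theta> < \<infinity>}"

definition cluster_Lambda :: "'a measure \<Rightarrow> real \<Rightarrow> ('a \<Rightarrow> real set) \<Rightarrow> real \<Rightarrow> ereal" where
  "cluster_Lambda M \<nu> C0 \<theta> = ereal \<nu> * (size_mgf M C0 \<theta> - 1)"

definition fenchel_legendre :: "(real \<Rightarrow> ereal) \<Rightarrow> real \<Rightarrow> ereal" where
  "fenchel_legendre \<phi> x = (SUP \<theta>. ereal (\<theta> * x) - \<phi> \<theta>)"


section \<open>Essential smoothness\<close>

definition essentially_smooth :: "(real \<Rightarrow> ereal) \<Rightarrow> bool" where
  "essentially_smooth \<phi> \<longleftrightarrow>
     (\<forall>x. \<phi> x \<noteq> -\<infinity>) \<and>
     (\<forall>x y u v. 0 \<le> u \<longrightarrow> 0 \<le> v \<longrightarrow> u + v = 1 \<longrightarrow>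
        \<phi> (u * x + v * y) \<le> ereal u * \<phi> x + ereal v * \<phi> y) \<and>
     (let D = interior {\<theta>. \<phi> \<theta> < \<infinity>}; f = (\<lambda>\<theta>. real_of_ereal (\<phi> \<theta>)) in
        D \<noteq> {} \<and>
        (\<forall>\<theta>\<in>D. f differentiable (at \<theta>)) \<and>
        (\<forall>s b. (\<forall>n. s n \<in> D) \<longrightarrow> b \<in> frontier D \<longrightarrow> s \<longlonglongrightarrow> b \<longrightarrow>
           filterlim (\<lambda>n. \<bar>deriv f (s n)\<bar>) at_top sequentially))"


section \<open>Large deviation principles\<close>

definition ereal_log :: "real \<Rightarrow> ereal" where
  "ereal_log p = (if p = 0 then -\<infinity> else ereal (ln p))"

definition rate_function :: "('b :: topological_space \<Rightarrow> ereal) \<Rightarrow> bool" where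
  "rate_function J \<longleftrightarrow> (\<forall>x. 0 \<le> J x) \<and> (\<forall>a :: ereal. closed {x. J x \<le> a})"

definition good_rate_function :: "('b :: topological_space \<Rightarrow> ereal) \<Rightarrow> bool" where
  "good_rate_function J \<longleftrightarrow> rate_function J \<and> (\<forall>a::real. 0 \<le> a \<longrightarrow> compact {x. J x \<le> ereal a})"

definition ldp_speed :: "(real \<Rightarrow> real) \<Rightarrow> bool" where
  "ldp_speed v \<longleftrightarrow>
     v \<in> borel_measurable (restrict_space borel {0..}) \<and> (\<forall>\<alpha>\<ge>0. 0 \<le> v \<alpha>) \<and>
     mono_on {0..} v \<and> filterlim v at_top at_top"

text \<open>The family is indexed by \<open>\<alpha> > 0\<close>; its values at other indices are irrelevant.\<close>

definition large_deviation_principle ::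
    "'a measure \<Rightarrow> (real \<Rightarrow> 'a \<Rightarrow> 'b :: topological_space) \<Rightarrow> ('b \<Rightarrow> ereal) \<Rightarrow> (real \<Rightarrow> real) \<Rightarrow> bool"
  where
  "large_deviation_principle M V J v \<longleftrightarrow>
     prob_space M \<and> (\<forall>\<alpha>>0. V \<alpha> \<in> borel_measurable M) \<and> rate_function J \<and> ldp_speed v \<and>
     (\<forall>B\<in>sets borel.
        (let r = (\<lambda>\<alpha>. ereal (1 / v \<alpha>) * ereal_log (measure M {\<omega> \<in> space M. V \<alpha> \<omega> \<in> B})) in
           - (INF x\<in>interior B. J x) \<le> Liminf at_top r \<and>
           Liminf at_top r \<le> Limsup at_top r \<and>
           Limsup at_top r \<le> - (INF x\<in>closure B. J x)))"

end

theory Submission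
  imports Defs
begin

text \<open>
  Integrating out the independent clusters and using the probability generating functional of the
  Poisson process of immigrants gives \<open>E[exp (\<theta> N(0, t])] = exp (\<nu> \<integral> (E[exp (\<theta> N\<^sub>x)] - 1) dx)\<close>, where
  \<open>N\<^sub>x\<close> counts the points in \<open>(0, t]\<close> of a cluster with immigrant at \<open>x\<close>.  Such a cluster is entirely
  inside or entirely outside \<open>(0, t]\<close> unless \<open>x\<close> is within distance \<open>L\<close> of an end point, so the moment
  condition on \<open>L\<close> shows that \<open>log E[exp (\<theta> N(0, t])] = t \<Lambda>(\<theta>) + O(1)\<close> in the interior of the
  domain.  The large deviation principle follows as in the Gaertner-Ellis theorem: Chernoff bounds
  for half lines give the upper bound, exponential tilting the lower bound, and essential smoothness
  makes every \<open>x > 0\<close> a value of the derivative of \<open>\<Lambda>\<close>.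
\<close>

section \<open>Counting points of random configurations\<close>

text \<open>Three obstacles shape the proof. N(0, t] is the cardinality of a union, and
  \<open>card\<close> of an infinite set is 0, so it equals the sum of the cluster counts only
  almost surely: distinct clusters must be shown disjoint, and finiteness is read off from an
  exponential moment at one positive parameter, then used for every \<theta>, negative ones
  included. The configuration \<sigma>-algebra knows only counts in fixed bounded sets, whereas a
  cluster is seen through a window displaced by its random immigrant; grid approximations restore
  measurability. Products over all immigrants are reached only as limits of finite products,
  increasing for \<theta> \<ge> 0 and decreasing for \<theta> \<le> 0, so the generating functional
  is computed twice.

  For the rate function, S \<ge> 0 makes the domain a lower half-line, and S \<ge> 1 makes slopes
  unbounded even if the domain is the whole line. The point x = 0 is approached through small slopes
  at negative \<theta>, and x < 0 has infinite rate.\<close>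

lemma space_config_space [simp]: "space config_space = configurations"
  unfolding config_space_def by (rule space_measure_of) auto

lemma measurable_card_Int_config:
  assumes "B \<in> sets borel" "bounded B"
  shows "(\<lambda>z. card (z \<inter> B)) \<in> config_space \<rightarrow>\<^sub>M count_space UNIV"
proof (subst measurable_count_space_eq2_countable, safe)
  fix n
  have "(\<lambda>z. card (z \<inter> B)) -` {n} \<inter> space config_space = {A \<in> configurations. card (A \<inter> B) = n}"
    by auto
  also have "\<dots> \<in> sets config_space"
    unfolding config_space_def using assms by (subst sets_measure_of) auto
  finally show "(\<lambda>z. card (z \<inter> B)) -` {n} \<inter> space config_space \<in> sets config_space" .
qed auto

lemma finite_Int_configuration:
  "z \<in> configurations \<Longrightarrow> bounded B \<Longrightarrow> finite (z \<inter> B)"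
  by (auto simp: configurations_def)

text \<open>Counting in left-open, right-closed windows is continuous from the right: a small move
  to the right neither admits a point at \<open>u\<close> nor loses one at \<open>u + l\<close>.
  Local finiteness leaves finitely many other points to clear, all in a window enlarged by
  1.\<close>

lemma eventually_Int_Ioc_eq:
  fixes u l :: real and v :: "nat \<Rightarrow> real"
  assumes z: "z \<in> configurations" and v: "v \<longlonglongrightarrow> u" and ge: "\<And>n. u \<le> v n"
  shows "eventually (\<lambda>n. z \<inter> {v n<..v n + l} = z \<inter> {u<..u + l}) sequentially"
proof -
  let ?F = "z \<inter> {u<..u + l + 1}"
  have fin: "finite ?F" using z by (rule finite_Int_configuration) auto
  have "eventually (\<lambda>n. y \<in> {v n<..v n + l} \<longleftrightarrow> y \<in> {u<..u + l}) sequentially" for y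
  proof (cases "u < y")
    case True
    have "eventually (\<lambda>n. v n < y) sequentially" using order_tendstoD(2)[OF v True] .
    moreover have "eventually (\<lambda>n. y \<le> v n + l \<longleftrightarrow> y \<le> u + l) sequentially"
    proof (cases "y \<le> u + l")
      case True
      then have "y \<le> v n + l" for n using ge[of n] by linarith
      with True show ?thesis by simp
    next
      case False
      then have "u < y - l" by simp
      from order_tendstoD(2)[OF v this] show ?thesis
        by eventually_elim (use False in auto)
    qed
    ultimately show ?thesis by eventually_elim (use True in auto)
  next
    case False
    then have "\<not> v n < y" for n using ge[of n] by linarith
    with False show ?thesis by auto
  qed
  then have "eventually (\<lambda>n. \<forall>y\<in>?F. y \<in> {v n<..v n + l} \<longleftrightarrow> y \<in> {u<..u + l}) sequentially"
    using fin by (intro eventually_ball_finite ballI)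
  moreover have "eventually (\<lambda>n. v n < u + 1) sequentially"
    using order_tendstoD(2)[OF v, of "u + 1"] by simp
  ultimately show ?thesis
  proof eventually_elim
    case (elim n)
    have "{v n<..v n + l} \<subseteq> {u<..u + l + 1}" using ge[of n] elim(2) by auto
    moreover have "{u<..u + l} \<subseteq> {u<..u + l + 1}" by auto
    ultimately show ?case using elim(1) by blast
  qed
qed

text \<open>The left end \<open>a - x\<close> is rounded up to a grid of mesh
  \<open>1 / Suc n\<close>. For each of the countably many grid values the count depends measurably
  on \<open>z\<close> alone, and right-continuity gives the limit as the mesh shrinks.\<close>

lemma measurable_card_shift:
  fixes a b :: real
  shows "(\<lambda>(x, z). real (card (z \<inter> {a - x<..b - x}))) \<in> borel_measurable (borel \<Otimes>\<^sub>M config_space)"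
proof -
  define v where "v n x = of_int \<lceil>real (Suc n) * (a - x)\<rceil> / real (Suc n)" for n x
  have v_ge: "a - x \<le> v n x" for n x
    unfolding v_def by (subst pos_le_divide_eq) (simp_all only: mult.commute le_of_int_ceiling of_nat_0_less_iff zero_less_Suc)
  have v_le: "v n x \<le> a - x + 1 / real (Suc n)" for n x
  proof -
    have "of_int \<lceil>real (Suc n) * (a - x)\<rceil> \<le> real (Suc n) * (a - x) + 1"
      by (rule of_int_ceiling_le_add_one)
    then have "v n x \<le> (real (Suc n) * (a - x) + 1) / real (Suc n)"
      unfolding v_def by (intro divide_right_mono) auto
    also have "\<dots> = a - x + 1 / real (Suc n)" by (simp add: add_divide_distrib)
    finally show ?thesis .
  qed
  have v_lim: "(\<lambda>n. v n x) \<longlonglongrightarrow> a - x" for x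
  proof (rule tendsto_sandwich[OF _ _ tendsto_const])
    show "eventually (\<lambda>n. a - x \<le> v n x) sequentially" using v_ge by simp
    show "eventually (\<lambda>n. v n x \<le> a - x + 1 / real (Suc n)) sequentially"
      using v_le by (intro always_eventually allI)
    show "(\<lambda>n. a - x + 1 / real (Suc n)) \<longlonglongrightarrow> a - x"
      using tendsto_add[OF tendsto_const LIMSEQ_inverse_real_of_nat, of "a - x"]
      by (simp add: inverse_eq_divide)
  qed
  let ?N = "borel \<Otimes>\<^sub>M config_space"
  define f where "f k n p = real (card (snd p \<inter> {of_int k / real (Suc n)<..of_int k / real (Suc n) + (b - a)}))"
    for k :: int and n :: nat and p :: "real \<times> real set"
  have f [measurable]: "f k n \<in> borel_measurable ?N" for k n
  proof -
    have "(\<lambda>z. real (card (z \<inter> {of_int k / real (Suc n)<..of_int k / real (Suc n) + (b - a)})))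
        \<in> borel_measurable config_space"
      by (rule measurable_compose[OF measurable_card_Int_config]) auto
    then show ?thesis unfolding f_def[abs_def] by (rule measurable_compose[OF measurable_snd])
  qed
  have meas: "(\<lambda>p. f \<lceil>real (Suc n) * (a - fst p)\<rceil> n p) \<in> borel_measurable ?N" for n
    by (rule measurable_compose_countable[where f="\<lambda>k p. f k n p"]) measurable
  have "(\<lambda>p. real (card (snd p \<inter> {a - fst p<..b - fst p}))) \<in> borel_measurable ?N"
  proof (rule borel_measurable_LIMSEQ_metric[OF meas])
    fix p :: "real \<times> real set" assume "p \<in> space ?N"
    then have "snd p \<in> configurations" by (auto simp: space_pair_measure)
    from eventually_Int_Ioc_eq[OF this v_lim[of "fst p"] v_ge, of "b - a"]
    have "eventually (\<lambda>n. f \<lceil>real (Suc n) * (a - fst p)\<rceil> n p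
        = real (card (snd p \<inter> {a - fst p<..b - fst p}))) sequentially"
      by eventually_elim (simp add: f_def v_def)
    then show "(\<lambda>n. f \<lceil>real (Suc n) * (a - fst p)\<rceil> n p)
        \<longlonglongrightarrow> real (card (snd p \<inter> {a - fst p<..b - fst p}))"
      by (rule tendsto_eventually)
  qed
  then show ?thesis by (simp add: case_prod_unfold)
qed

lemma eventually_inj_on_ceiling_grid:
  fixes F :: "real set"
  assumes "finite F"
  shows "eventually (\<lambda>n. inj_on (\<lambda>y. \<lceil>real (Suc n) * y\<rceil>) F) sequentially"
proof -
  have pair: "eventually (\<lambda>n. \<lceil>real (Suc n) * x\<rceil> \<noteq> \<lceil>real (Suc n) * y\<rceil>) sequentially" if "x \<noteq> y" for x y :: real
  proof -
    from that have "0 < \<bar>x - y\<bar>" by simp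
    then obtain N where N: "1 / \<bar>x - y\<bar> < real N" using reals_Archimedean2 by blast
    show ?thesis
      using eventually_ge_at_top[of N]
    proof eventually_elim
      case (elim n)
      have "1 < real (Suc n) * \<bar>x - y\<bar>"
      proof -
        have "1 / \<bar>x - y\<bar> < real (Suc n)" using N elim by linarith
        then show ?thesis using \<open>0 < \<bar>x - y\<bar>\<close> by (simp add: field_simps)
      qed
      then have gt: "1 < \<bar>real (Suc n) * x - real (Suc n) * y\<bar>"
        by (metis abs_mult abs_of_nat right_diff_distrib)
      show ?case
      proof
        assume eq: "\<lceil>real (Suc n) * x\<rceil> = \<lceil>real (Suc n) * y\<rceil>"
        define c where "c = real_of_int \<lceil>real (Suc n) * x\<rceil>"
        have "real (Suc n) * x \<le> c" "c < real (Suc n) * x + 1"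
          unfolding c_def by linarith+
        moreover have "real (Suc n) * y \<le> c" "c < real (Suc n) * y + 1"
          unfolding c_def eq by linarith+
        ultimately show False using gt by linarith
      qed
    qed
  qed
  have "eventually (\<lambda>n. \<forall>x\<in>F. \<forall>y\<in>F. x \<noteq> y \<longrightarrow> \<lceil>real (Suc n) * x\<rceil> \<noteq> \<lceil>real (Suc n) * y\<rceil>) sequentially"
  proof (intro eventually_ball_finite[OF assms] ballI)
    fix x y show "eventually (\<lambda>n. x \<noteq> y \<longrightarrow> \<lceil>real (Suc n) * x\<rceil> \<noteq> \<lceil>real (Suc n) * y\<rceil>) sequentially"
      by (cases "x = y") (use pair in \<open>auto elim: eventually_mono\<close>)
  qed
  then show ?thesis by eventually_elim (auto simp: inj_on_def)
qed

text \<open>Occupied grid cells undercount the points and become exact once the mesh separates a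
  given finite subset. The supremum lives in \<open>ennreal\<close> because an infinite
  \<open>E\<close> yields \<open>top\<close>, which \<open>enn2real\<close> sends to 0, exactly the
  value of \<open>card\<close> on infinite sets.\<close>

lemma card_eq_SUP_ceiling_grid:
  fixes E :: "real set"
  assumes E: "E \<subseteq> {a<..b}"
  shows "real (card E) = enn2real (SUP n. ennreal (real (card ((\<lambda>y. \<lceil>real (Suc n) * y\<rceil>) ` E))))"
proof -
  define \<iota> where "\<iota> n y = \<lceil>real (Suc n) * y\<rceil>" for n and y :: real
  have fin: "finite (\<iota> n ` E)" for n
  proof (rule finite_subset)
    show "\<iota> n ` E \<subseteq> {\<lceil>real (Suc n) * a\<rceil>..\<lceil>real (Suc n) * b\<rceil>}"
      using E by (fastforce simp: \<iota>_def intro!: ceiling_mono mult_left_mono)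
  qed auto
  show ?thesis
  proof (cases "finite E")
    case True
    have "(SUP n. ennreal (real (card (\<iota> n ` E)))) = ennreal (real (card E))"
    proof (intro antisym SUP_least)
      show "ennreal (real (card (\<iota> n ` E))) \<le> ennreal (real (card E))" for n
        using card_image_le[OF True, of "\<iota> n"] by (intro ennreal_leI) auto
      from eventually_inj_on_ceiling_grid[OF True] obtain n where "inj_on (\<iota> n) E"
        unfolding \<iota>_def[abs_def] by (auto simp: eventually_sequentially)
      then have "card (\<iota> n ` E) = card E" by (rule card_image)
      then show "ennreal (real (card E)) \<le> (SUP n. ennreal (real (card (\<iota> n ` E))))"
        by (intro SUP_upper2[of n]) auto
    qed
    then show ?thesis unfolding \<iota>_def by simp
  next
    case False
    have "(SUP n. ennreal (real (card (\<iota> n ` E)))) = top"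
    proof (rule ennreal_SUP_eq_top)
      fix k :: nat
      obtain F where F: "F \<subseteq> E" "finite F" "card F = k"
        using infinite_arbitrarily_large[OF False] by metis
      from eventually_inj_on_ceiling_grid[OF F(2)] obtain n where "inj_on (\<iota> n) F"
        unfolding \<iota>_def[abs_def] by (auto simp: eventually_sequentially)
      then have "k = card (\<iota> n ` F)" using F by (simp add: card_image)
      also have "\<dots> \<le> card (\<iota> n ` E)" using F by (intro card_mono fin image_mono)
      finally show "\<exists>n\<in>UNIV. of_nat k \<le> ennreal (real (card (\<iota> n ` E)))"
        by (auto simp: ennreal_of_nat_eq_real_of_nat intro!: exI[of _ n] ennreal_leI)
    qed
    then show ?thesis using False unfolding \<iota>_def by (simp only: enn2real_top card.infinite not_False_eq_True of_nat_0)
  qed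
qed

text \<open>A cell is occupied by the union iff some \<open>A i\<close> hits it, so void events of
  single members determine the count. Overlaps and accumulation of points do no harm: the count is
  measurable before anything is known about disjointness or finiteness.\<close>

lemma borel_measurable_card_UN:
  fixes A :: "'i::countable \<Rightarrow> 'b \<Rightarrow> real set"
  assumes hit: "\<And>i a b. Measurable.pred N (\<lambda>\<omega>. A i \<omega> \<inter> {a<..b} = {})"
  shows "(\<lambda>\<omega>. real (card ((\<Union>i. A i \<omega>) \<inter> {a<..b}))) \<in> borel_measurable N"
proof -
  define E where "E \<omega> = (\<Union>i. A i \<omega>) \<inter> {a<..b}" for \<omega>
  define \<iota> where "\<iota> n y = \<lceil>real (Suc n) * y\<rceil>" for n and y :: real
  define J where "J n = {\<lceil>real (Suc n) * a\<rceil>..\<lceil>real (Suc n) * b\<rceil>}" for n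
  \<comment> \<open>Each grid cell is clipped to \<open>{a<..b}\<close>; the result is again
    left-open and right-closed, so \<open>hit\<close> applies to it.\<close>
  define lo where "lo n j = max a ((of_int j - 1) / real (Suc n))" for n and j :: int
  define hi where "hi n j = min b (of_int j / real (Suc n))" for n and j :: int
  have mem: "\<iota> n y = j \<longleftrightarrow> (of_int j - 1) / real (Suc n) < y \<and> y \<le> of_int j / real (Suc n)" for n y j
    unfolding \<iota>_def by (auto simp: ceiling_eq_iff field_simps)
  have iff: "j \<in> \<iota> n ` E \<omega> \<longleftrightarrow> \<not> (\<forall>i. A i \<omega> \<inter> {lo n j<..hi n j} = {})" for n j \<omega>
    unfolding E_def lo_def hi_def image_iff using mem[of n _ j] by fastforce
  have sub: "\<iota> n ` E \<omega> \<subseteq> J n" for n \<omega>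
    by (auto simp: \<iota>_def J_def E_def intro!: ceiling_mono mult_left_mono)
  have card: "real (card (\<iota> n ` E \<omega>)) = (\<Sum>j\<in>J n. if \<forall>i. A i \<omega> \<inter> {lo n j<..hi n j} = {} then 0 else 1)" for n \<omega>
  proof -
    have "\<iota> n ` E \<omega> = {j \<in> J n. \<not> (\<forall>i. A i \<omega> \<inter> {lo n j<..hi n j} = {})}"
      using sub iff by blast
    moreover have "finite (J n)" by (simp add: J_def)
    ultimately show ?thesis by (simp add: sum.If_cases Int_def)
  qed
  have [measurable]: "Measurable.pred N (\<lambda>\<omega>. A i \<omega> \<inter> {c<..d} = {})" for i c d by (rule hit)
  have "(\<lambda>\<omega>. enn2real (SUP n. ennreal (real (card (\<iota> n ` E \<omega>))))) \<in> borel_measurable N"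
    unfolding card by measurable
  moreover have "real (card (E \<omega>)) = enn2real (SUP n. ennreal (real (card (\<iota> n ` E \<omega>))))" for \<omega>
    unfolding \<iota>_def by (rule card_eq_SUP_ceiling_grid[of _ a b]) (auto simp: E_def)
  ultimately show ?thesis by (simp add: E_def)
qed

section \<open>The probability generating functional of a Poisson process\<close>

context prob_space
begin

lemma nn_integral_poisson_power:
  assumes N [measurable]: "N \<in> M \<rightarrow>\<^sub>M count_space UNIV"
    and prob_N: "\<And>n. prob {\<omega> \<in> space M. N \<omega> = n} = l ^ n / fact n * exp (- l)"
    and "0 \<le> l" "0 \<le> c"
  shows "(\<integral>\<^sup>+\<omega>. ennreal (c ^ N \<omega>) \<partial>M) = ennreal (exp (l * (c - 1)))"
proof -
  have "ennreal (c ^ N \<omega>) = (\<Sum>n. ennreal (c ^ n) * indicator {\<omega> \<in> space M. N \<omega> = n} \<omega>)"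
    if "\<omega> \<in> space M" for \<omega>
    using that by (subst suminf_finite[of "{N \<omega>}"]) (auto simp: indicator_def)
  then have "(\<integral>\<^sup>+\<omega>. ennreal (c ^ N \<omega>) \<partial>M)
      = (\<integral>\<^sup>+\<omega>. (\<Sum>n. ennreal (c ^ n) * indicator {\<omega> \<in> space M. N \<omega> = n} \<omega>) \<partial>M)"
    by (intro nn_integral_cong) auto
  also have "\<dots> = (\<Sum>n. \<integral>\<^sup>+\<omega>. ennreal (c ^ n) * indicator {\<omega> \<in> space M. N \<omega> = n} \<omega> \<partial>M)"
    by (rule nn_integral_suminf) measurable
  also have "\<dots> = (\<Sum>n. ennreal (c ^ n * (l ^ n / fact n * exp (- l))))"
  proof (intro suminf_cong)
    fix n
    have "(\<integral>\<^sup>+\<omega>. ennreal (c ^ n) * indicator {\<omega> \<in> space M. N \<omega> = n} \<omega> \<partial>M)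
        = ennreal (c ^ n) * ennreal (prob {\<omega> \<in> space M. N \<omega> = n})"
      by (subst nn_integral_cmult_indicator) (measurable, simp add: emeasure_eq_measure)
    then show "(\<integral>\<^sup>+\<omega>. ennreal (c ^ n) * indicator {\<omega> \<in> space M. N \<omega> = n} \<omega> \<partial>M)
        = ennreal (c ^ n * (l ^ n / fact n * exp (- l)))"
      using assms(4) by (simp only: prob_N ennreal_mult'[symmetric] zero_le_power)
  qed
  also have "\<dots> = ennreal (exp (l * (c - 1)))"
  proof (rule suminf_ennreal_eq)
    have "(\<lambda>n. exp (- l) * ((l * c) ^ n /\<^sub>R fact n)) sums (exp (- l) * exp (l * c))"
      by (intro sums_mult exp_converges)
    moreover have "(\<lambda>n. exp (- l) * ((l * c) ^ n /\<^sub>R fact n)) = (\<lambda>n. c ^ n * (l ^ n / fact n * exp (- l)))"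
      by (simp add: power_mult_distrib divide_inverse mult_ac)
    moreover have "exp (- l) * exp (l * c) = exp (l * (c - 1))"
      by (simp add: exp_add[symmetric] algebra_simps)
    ultimately show "(\<lambda>n. c ^ n * (l ^ n / fact n * exp (- l))) sums exp (l * (c - 1))" by simp
  qed (use assms in auto)
  finally show ?thesis .
qed

end

text \<open>Isolates the immigrants from the clusters. Counts refer to the set of points but
  products run over indices; almost sure injectivity of the enumeration translates between the
  two.\<close>

locale enumerated_poisson_process = prob_space M for M :: "'a measure" +
  fixes \<nu> :: real and X :: "nat \<Rightarrow> 'a \<Rightarrow> real"
  assumes rate_pos: "0 < \<nu>"
    and measurable_point [measurable]: "\<And>i. X i \<in> borel_measurable M"
    and distinct: "AE \<omega> in M. inj (\<lambda>i. X i \<omega>)"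
    and poisson: "homogeneous_poisson_process M \<nu> (\<lambda>\<omega>. range (\<lambda>i. X i \<omega>))"
begin

lemma prob_card_points:
  assumes "B \<in> sets borel" "bounded B"
  shows "prob {\<omega> \<in> space M. card (range (\<lambda>i. X i \<omega>) \<inter> B) = n}
      = (\<nu> * measure lborel B) ^ n / fact n * exp (- (\<nu> * measure lborel B))"
  using poisson[unfolded homogeneous_poisson_process_def, THEN conjunct2, THEN conjunct1,
      THEN spec[of _ B], THEN spec[of _ n]] assms by simp

lemma indep_card_points:
  fixes B :: "nat \<Rightarrow> real set"
  assumes "finite J" "disjoint_family_on B J" "\<And>j. j \<in> J \<Longrightarrow> B j \<in> sets borel" "\<And>j. j \<in> J \<Longrightarrow> bounded (B j)"
  shows "indep_vars (\<lambda>_. count_space UNIV) (\<lambda>j \<omega>. card (range (\<lambda>i. X i \<omega>) \<inter> B j)) J"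
  using poisson[unfolded homogeneous_poisson_process_def, THEN conjunct2, THEN conjunct2,
      THEN spec[of _ B], THEN spec[of _ J]] assms by simp

lemma finite_points:
  assumes "\<omega> \<in> space M" "bounded B"
  shows "finite (range (\<lambda>i. X i \<omega>) \<inter> B)"
proof -
  have "range (\<lambda>i. X i \<omega>) \<in> space config_space"
    using poisson assms(1) unfolding homogeneous_poisson_process_def point_process_def
    by (auto dest: measurable_space)
  then have "range (\<lambda>i. X i \<omega>) \<in> configurations"
    by (simp add: config_space_def space_measure_of_conv)
  then show ?thesis using assms(2) by (auto simp: configurations_def)
qed

lemma finite_indices:
  assumes "\<omega> \<in> space M" "inj (\<lambda>i. X i \<omega>)" "bounded B"
  shows "finite {i. X i \<omega> \<in> B}"
proof -
  have "inj_on (\<lambda>i. X i \<omega>) {i. X i \<omega> \<in> B}" using assms(2) by (auto simp: inj_on_def)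
  moreover have "(\<lambda>i. X i \<omega>) ` {i. X i \<omega> \<in> B} = range (\<lambda>i. X i \<omega>) \<inter> B" by auto
  ultimately show ?thesis using finite_points[OF assms(1,3)] by (metis finite_imageD)
qed

lemma card_points:
  assumes "inj (\<lambda>i. X i \<omega>)"
  shows "card (range (\<lambda>i. X i \<omega>) \<inter> B) = card {i. X i \<omega> \<in> B}"
proof -
  have "inj_on (\<lambda>i. X i \<omega>) {i. X i \<omega> \<in> B}" using assms(1) by (auto simp: inj_on_def)
  moreover have "(\<lambda>i. X i \<omega>) ` {i. X i \<omega> \<in> B} = range (\<lambda>i. X i \<omega>) \<inter> B" by auto
  ultimately show ?thesis by (metis card_image)
qed

text \<open>A family with a single member is trivially disjoint, and \<open>indep_vars\<close>
  includes measurability.\<close>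

lemma measurable_card_points:
  assumes "B \<in> sets borel" "bounded B"
  shows "(\<lambda>\<omega>. card (range (\<lambda>i. X i \<omega>) \<inter> B)) \<in> M \<rightarrow>\<^sub>M count_space UNIV"
proof -
  have "indep_vars (\<lambda>_. count_space UNIV) (\<lambda>j \<omega>. card (range (\<lambda>i. X i \<omega>) \<inter> (\<lambda>_. B) j)) {0::nat}"
    using assms by (intro indep_card_points) (auto simp: disjoint_family_on_def)
  then show ?thesis unfolding indep_vars_def by auto
qed

text \<open>The level sets of \<open>g\<close> inside \<open>B\<close> are disjoint, so their counts
  are independent Poisson variables, and the product over points becomes a finite product of powers
  with known means.\<close>

lemma nn_integral_prod_points_simple:
  fixes g :: "real \<Rightarrow> real"
  assumes g: "simple_function borel g" and nonneg: "\<And>x. 0 \<le> g x"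
    and B: "B \<in> sets borel" "bounded B" and one: "\<And>x. x \<notin> B \<Longrightarrow> g x = 1"
  shows "(\<integral>\<^sup>+\<omega>. ennreal (\<Prod>i\<in>{i. X i \<omega> \<in> B}. g (X i \<omega>)) \<partial>M)
      = ennreal (exp (\<nu> * (\<integral>x. g x - 1 \<partial>lborel)))"
proof -
  define V where "V = range g"
  have fV: "finite V" using simple_functionD(1)[OF g] by (simp add: V_def)
  define A where "A c = g -` {c} \<inter> B" for c
  have A_sets: "A c \<in> sets borel" for c
    using simple_functionD(2)[OF g, of "{c}"] B by (auto simp: A_def)
  have A_bounded: "bounded (A c)" for c
    unfolding A_def by (rule bounded_subset[OF B(2)]) auto
  define N where "N c \<omega> = card (range (\<lambda>i. X i \<omega>) \<inter> A c)" for c \<omega>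
  define l where "l c = \<nu> * measure lborel (A c)" for c
  have N_meas [measurable]: "N c \<in> M \<rightarrow>\<^sub>M count_space UNIV" for c
    unfolding N_def[abs_def] by (rule measurable_card_points[OF A_sets A_bounded])
  have N_prob: "prob {\<omega> \<in> space M. N c \<omega> = n} = l c ^ n / fact n * exp (- l c)" for c n
    unfolding N_def l_def by (rule prob_card_points[OF A_sets A_bounded])
  have l_nonneg: "0 \<le> l c" for c using rate_pos by (simp add: l_def)
  \<comment> \<open>The values of \<open>g\<close> are renamed by natural numbers, because
    independence of Poisson counts is available for families indexed by \<open>nat\<close>.\<close>
  obtain e :: "real \<Rightarrow> nat" where e: "inj_on e V"
    using fV finite_imp_inj_to_nat_seg by blast
  define e' where "e' = the_inv_into V e"
  have e': "e' (e c) = c" if "c \<in> V" for c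
    unfolding e'_def using e that by (rule the_inv_into_f_f)
  have indep: "indep_vars (\<lambda>_. count_space UNIV) (\<lambda>j \<omega>. N (e' j) \<omega>) (e ` V)"
  proof -
    have "disjoint_family_on (\<lambda>j. A (e' j)) (e ` V)"
      unfolding disjoint_family_on_def A_def using e' by auto
    moreover have "\<forall>j\<in>e ` V. A (e' j) \<in> sets borel \<and> bounded (A (e' j))"
      using A_sets A_bounded by auto
    ultimately show ?thesis
      using fV unfolding N_def by (intro indep_card_points) auto
  qed
  have V_nonneg: "0 \<le> c" if "c \<in> V" for c using that nonneg by (auto simp: V_def)
  have "AE \<omega> in M. ennreal (\<Prod>i\<in>{i. X i \<omega> \<in> B}. g (X i \<omega>)) = (\<Prod>j\<in>e ` V. ennreal (e' j ^ N (e' j) \<omega>))"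
    using distinct AE_space
  proof eventually_elim
    case (elim \<omega>)
    have fin: "finite {i. X i \<omega> \<in> B}" by (rule finite_indices[OF elim(2,1) B(2)])
    have "(\<Prod>i\<in>{i. X i \<omega> \<in> B}. g (X i \<omega>))
        = (\<Prod>c\<in>V. \<Prod>i\<in>{i. i \<in> {i. X i \<omega> \<in> B} \<and> g (X i \<omega>) = c}. g (X i \<omega>))"
      using fin fV by (intro prod.group[symmetric]) (auto simp: V_def)
    also have "\<dots> = (\<Prod>c\<in>V. c ^ N c \<omega>)"
    proof (intro prod.cong refl)
      fix c assume "c \<in> V"
      have "{i. i \<in> {i. X i \<omega> \<in> B} \<and> g (X i \<omega>) = c} = {i. X i \<omega> \<in> A c}" by (auto simp: A_def)
      then show "(\<Prod>i\<in>{i. i \<in> {i. X i \<omega> \<in> B} \<and> g (X i \<omega>) = c}. g (X i \<omega>)) = c ^ N c \<omega>"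
        using card_points[OF elim(1), of "A c"] by (auto simp: N_def A_def)
    qed
    also have "\<dots> = (\<Prod>j\<in>e ` V. e' j ^ N (e' j) \<omega>)"
      using e by (subst prod.reindex) (auto simp: e')
    finally show ?case
      using V_nonneg e' by (subst prod_ennreal) auto
  qed
  then have "(\<integral>\<^sup>+\<omega>. ennreal (\<Prod>i\<in>{i. X i \<omega> \<in> B}. g (X i \<omega>)) \<partial>M)
      = (\<integral>\<^sup>+\<omega>. (\<Prod>j\<in>e ` V. ennreal (e' j ^ N (e' j) \<omega>)) \<partial>M)"
    by (rule nn_integral_cong_AE)
  also have "\<dots> = (\<Prod>j\<in>e ` V. \<integral>\<^sup>+\<omega>. ennreal (e' j ^ N (e' j) \<omega>) \<partial>M)"
  proof (rule indep_vars_nn_integral)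
    show "indep_vars (\<lambda>_. borel) (\<lambda>j \<omega>. ennreal (e' j ^ N (e' j) \<omega>)) (e ` V)"
      by (rule indep_vars_compose2[OF indep, where Y="\<lambda>j n. ennreal (e' j ^ n)"]) auto
  qed (use fV in auto)
  also have "\<dots> = (\<Prod>c\<in>V. \<integral>\<^sup>+\<omega>. ennreal (c ^ N c \<omega>) \<partial>M)"
    using e by (subst prod.reindex) (auto simp: e')
  also have "\<dots> = (\<Prod>c\<in>V. ennreal (exp (l c * (c - 1))))"
    using V_nonneg by (intro prod.cong refl nn_integral_poisson_power N_prob l_nonneg) auto
  also have "\<dots> = ennreal (exp (\<Sum>c\<in>V. l c * (c - 1)))"
    using fV by (subst prod_ennreal) (auto simp: exp_sum)
  also have "(\<Sum>c\<in>V. l c * (c - 1)) = \<nu> * (\<integral>x. g x - 1 \<partial>lborel)"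
  proof -
    have A_fin: "emeasure lborel (A c) < \<infinity>" for c
      by (rule emeasure_bounded_finite[OF A_bounded])
    have "(\<integral>x. g x - 1 \<partial>lborel) = (\<integral>x. (\<Sum>c\<in>V. indicator (A c) x *\<^sub>R (c - 1)) \<partial>lborel)"
    proof (intro Bochner_Integration.integral_cong refl)
      fix x
      show "g x - 1 = (\<Sum>c\<in>V. indicator (A c) x *\<^sub>R (c - 1))"
      proof (cases "x \<in> B")
        case True
        then have "(\<Sum>c\<in>V. indicator (A c) x *\<^sub>R (c - 1)) = (\<Sum>c\<in>V. if c = g x then c - 1 else 0)"
          by (intro sum.cong) (auto simp: A_def indicator_def)
        then show ?thesis using fV by (simp add: V_def)
      qed (simp add: one A_def)
    qed
    also have "\<dots> = (\<Sum>c\<in>V. \<integral>x. indicator (A c) x *\<^sub>R (c - 1) \<partial>lborel)"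
      using A_fin A_sets by (intro Bochner_Integration.integral_sum integrable_indicator) auto
    also have "\<dots> = (\<Sum>c\<in>V. measure lborel (A c) * (c - 1))"
    proof (intro sum.cong refl)
      fix c
      show "(\<integral>x. indicator (A c) x *\<^sub>R (c - 1) \<partial>lborel) = measure lborel (A c) * (c - 1)"
        using A_fin[of c] A_sets[of c] by (subst integral_scaleR_left) (auto intro!: integrable_real_indicator)
    qed
    finally show ?thesis by (simp add: l_def sum_distrib_left mult.assoc)
  qed
  finally show ?thesis .
qed

lemma eventually_prod_indices:
  fixes g :: "real \<Rightarrow> real"
  assumes "\<omega> \<in> space M" "inj (\<lambda>i. X i \<omega>)" "bounded B" "\<And>x. x \<notin> B \<Longrightarrow> g x = 1"
  shows "eventually (\<lambda>n. (\<Prod>i<n. g (X i \<omega>)) = (\<Prod>i\<in>{i. X i \<omega> \<in> B}. g (X i \<omega>))) sequentially"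
proof -
  have fin: "finite {i. X i \<omega> \<in> B}" by (rule finite_indices[OF assms(1-3)])
  then obtain N where N: "{i. X i \<omega> \<in> B} \<subseteq> {..<N}" using finite_nat_iff_bounded by blast
  show ?thesis using eventually_ge_at_top[of N]
  proof eventually_elim
    case (elim n)
    then show ?case using N assms(4) by (intro prod.mono_neutral_right) auto
  qed
qed

text \<open>For \<open>1 \<le> g\<close> both the number \<open>n\<close> of factors and the level
  \<open>k\<close> of approximation act increasingly, so the two suprema commute and the inner one
  reduces to the simple case. The conclusion concerns partial products because independence of
  clusters delivers finite products only.\<close>

lemma SUP_nn_integral_prod_points:
  fixes g :: "real \<Rightarrow> real"
  assumes g [measurable]: "g \<in> borel_measurable borel" and ge: "\<And>x. 1 \<le> g x"
    and int: "integrable lborel (\<lambda>x. g x - 1)"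
  shows "(SUP n. \<integral>\<^sup>+\<omega>. ennreal (\<Prod>i<n. g (X i \<omega>)) \<partial>M) = ennreal (exp (\<nu> * (\<integral>x. g x - 1 \<partial>lborel)))"
proof -
  have "(\<lambda>x. g x - 1) \<in> borel_measurable borel" "\<And>x. 0 \<le> g x - 1" using ge by auto
  from borel_measurable_implies_simple_function_sequence_real[OF this]
  obtain f where f: "incseq f" "\<And>k. simple_function borel (f k)" "\<And>x. bdd_above (range (\<lambda>k. f k x))"
      "\<And>k x. 0 \<le> f k x" and f_sup: "(\<lambda>x. g x - 1) = (SUP k. f k)" by metis
  have f_lim: "(\<lambda>k. f k x) \<longlonglongrightarrow> g x - 1" for x
    using LIMSEQ_incseq_SUP[OF f(3), of x] f(1) fun_cong[OF f_sup, of x]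
    by (simp add: incseq_def le_fun_def image_comp)
  define B where "B k = {- real k..real k}" for k
  \<comment> \<open>Cutting off at \<open>B k\<close> makes the approximant equal to 1 outside a
    bounded set, as the simple case requires, while it still increases to \<open>g\<close>.\<close>
  define gk where "gk k x = 1 + f k x * indicator (B k) x" for k x
  have B_inc: "B k \<subseteq> B l" if "k \<le> l" for k l using that by (auto simp: B_def)
  have gk_inc: "gk k x \<le> gk l x" if "k \<le> l" for k l x
    unfolding gk_def using B_inc[OF that] f(1,4) that
    by (auto simp: indicator_def incseq_def le_fun_def)
  have gk_ge: "1 \<le> gk k x" for k x using f(4) by (simp add: gk_def indicator_def)
  have gk_simple: "simple_function borel (gk k)" for k
    unfolding gk_def[abs_def] using f(2)
    by (intro simple_function_add simple_function_mult simple_function_const simple_function_indicator)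
      (auto simp: B_def)
  have gk_meas [measurable]: "gk k \<in> borel_measurable borel" for k
    by (rule borel_measurable_simple_function[OF gk_simple])
  have gk_lim: "(\<lambda>k. gk k x) \<longlonglongrightarrow> g x" for x
  proof -
    obtain N :: nat where "\<bar>x\<bar> \<le> real N" using real_arch_simple by blast
    then have "eventually (\<lambda>k. indicator (B k) x = (1::real)) sequentially"
      by (intro eventually_mono[OF eventually_ge_at_top[of N]]) (auto simp: B_def indicator_def)
    then have "(\<lambda>k. indicator (B k) x :: real) \<longlonglongrightarrow> 1" by (rule tendsto_eventually)
    from tendsto_add[OF tendsto_const tendsto_mult[OF f_lim this], of 1 x]
    show ?thesis by (simp add: gk_def)
  qed
  have gk_le: "gk k x \<le> g x" for k x
    by (rule LIMSEQ_le_const[OF gk_lim]) (use gk_inc in auto)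
  have int_gk: "(\<lambda>k. \<integral>x. gk k x - 1 \<partial>lborel) \<longlonglongrightarrow> (\<integral>x. g x - 1 \<partial>lborel)"
  proof (rule integral_dominated_convergence[OF _ _ int])
    show "AE x in lborel. (\<lambda>k. gk k x - 1) \<longlonglongrightarrow> g x - 1"
      by (intro always_eventually allI tendsto_diff gk_lim tendsto_const)
    show "AE x in lborel. norm (gk k x - 1) \<le> g x - 1" for k
      using gk_le gk_ge by (intro always_eventually allI) (auto simp: abs_of_nonneg)
  qed auto
  have int_gk_mono: "(\<integral>x. gk k x - 1 \<partial>lborel) \<le> (\<integral>x. gk l x - 1 \<partial>lborel)" if "k \<le> l" for k l
  proof (intro integral_mono)
    show "integrable lborel (\<lambda>x. gk k x - 1)" for k
    proof (rule Bochner_Integration.integrable_bound[OF int])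
      have "norm (gk k x - 1) \<le> norm (g x - 1)" for x using gk_le[of k x] gk_ge[of k x] by simp
      then show "AE x in lborel. norm (gk k x - 1) \<le> norm (g x - 1)" by simp
    qed auto
    then show "integrable lborel (\<lambda>x. gk l x - 1)" .
  qed (use gk_inc[OF that] in auto)
  define P where "P h n \<omega> = ennreal (\<Prod>i<n. h (X i \<omega>))" for h :: "real \<Rightarrow> real" and n \<omega>
  have P_meas [measurable]: "P (gk k) n \<in> borel_measurable M" for k n unfolding P_def[abs_def] by measurable
  have P_incn: "P h m \<omega> \<le> P h n \<omega>" if "m \<le> n" "\<And>x. 1 \<le> h x" for h m n \<omega>
  proof -
    have "(\<Prod>i<m. h (X i \<omega>)) \<le> (\<Prod>i<n. h (X i \<omega>))"
    proof (rule prod_mono2)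
      show "0 \<le> h (X i \<omega>)" for i using that(2)[of "X i \<omega>"] by simp
    qed (use that in auto)
    then show ?thesis unfolding P_def by (rule ennreal_leI)
  qed
  have P_inck: "P (gk k) n \<omega> \<le> P (gk l) n \<omega>" if "k \<le> l" for k l n \<omega>
    unfolding P_def by (intro ennreal_leI prod_mono conjI gk_inc[OF that])
      (use gk_ge in \<open>auto intro: order_trans[OF zero_le_one]\<close>)
  have P_supk: "(SUP k. P (gk k) n \<omega>) = P g n \<omega>" for n \<omega>
  proof (rule LIMSEQ_unique[OF LIMSEQ_SUP])
    show "incseq (\<lambda>k. P (gk k) n \<omega>)" using P_inck by (auto simp: incseq_def)
    show "(\<lambda>k. P (gk k) n \<omega>) \<longlonglongrightarrow> P g n \<omega>"
      unfolding P_def by (intro tendsto_ennrealI tendsto_prod gk_lim)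
  qed
  have P_supn: "(\<integral>\<^sup>+\<omega>. (SUP n. P (gk k) n \<omega>) \<partial>M) = ennreal (exp (\<nu> * (\<integral>x. gk k x - 1 \<partial>lborel)))" for k
  proof -
    have "AE \<omega> in M. (SUP n. P (gk k) n \<omega>) = ennreal (\<Prod>i\<in>{i. X i \<omega> \<in> B k}. gk k (X i \<omega>))"
      using distinct AE_space
    proof eventually_elim
      case (elim \<omega>)
      show ?case
      proof (rule LIMSEQ_unique[OF LIMSEQ_SUP])
        show "incseq (\<lambda>n. P (gk k) n \<omega>)" using P_incn gk_ge by (auto simp: incseq_def)
        have "eventually (\<lambda>n. (\<Prod>i<n. gk k (X i \<omega>)) = (\<Prod>i\<in>{i. X i \<omega> \<in> B k}. gk k (X i \<omega>))) sequentially"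
          by (rule eventually_prod_indices[OF elim(2,1)]) (auto simp: B_def gk_def)
        then show "(\<lambda>n. P (gk k) n \<omega>) \<longlonglongrightarrow> ennreal (\<Prod>i\<in>{i. X i \<omega> \<in> B k}. gk k (X i \<omega>))"
          unfolding P_def by (intro tendsto_ennrealI tendsto_eventually)
      qed
    qed
    then have "(\<integral>\<^sup>+\<omega>. (SUP n. P (gk k) n \<omega>) \<partial>M)
        = (\<integral>\<^sup>+\<omega>. ennreal (\<Prod>i\<in>{i. X i \<omega> \<in> B k}. gk k (X i \<omega>)) \<partial>M)"
      by (rule nn_integral_cong_AE)
    also have "\<dots> = ennreal (exp (\<nu> * (\<integral>x. gk k x - 1 \<partial>lborel)))"
      by (rule nn_integral_prod_points_simple[OF gk_simple])
        (use gk_ge in \<open>auto simp: B_def gk_def intro: order_trans[OF zero_le_one]\<close>)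
    finally show ?thesis .
  qed
  have "(SUP n. \<integral>\<^sup>+\<omega>. P g n \<omega> \<partial>M) = (SUP n. \<integral>\<^sup>+\<omega>. (SUP k. P (gk k) n \<omega>) \<partial>M)"
    unfolding P_supk ..
  also have "\<dots> = (SUP n. SUP k. \<integral>\<^sup>+\<omega>. P (gk k) n \<omega> \<partial>M)"
    using P_inck by (intro SUP_cong refl nn_integral_monotone_convergence_SUP) (auto simp: incseq_def le_fun_def)
  also have "\<dots> = (SUP k. SUP n. \<integral>\<^sup>+\<omega>. P (gk k) n \<omega> \<partial>M)" by (rule SUP_commute)
  also have "\<dots> = (SUP k. \<integral>\<^sup>+\<omega>. (SUP n. P (gk k) n \<omega>) \<partial>M)"
    using P_incn gk_ge
    by (intro SUP_cong refl nn_integral_monotone_convergence_SUP[symmetric]) (auto simp: incseq_def le_fun_def)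
  also have "\<dots> = (SUP k. ennreal (exp (\<nu> * (\<integral>x. gk k x - 1 \<partial>lborel))))"
    unfolding P_supn ..
  also have "\<dots> = ennreal (exp (\<nu> * (\<integral>x. g x - 1 \<partial>lborel)))"
  proof (rule LIMSEQ_unique[OF LIMSEQ_SUP])
    show "incseq (\<lambda>k. ennreal (exp (\<nu> * (\<integral>x. gk k x - 1 \<partial>lborel))))"
      using int_gk_mono rate_pos by (auto simp: incseq_def intro!: ennreal_leI mult_left_mono)
    show "(\<lambda>k. ennreal (exp (\<nu> * (\<integral>x. gk k x - 1 \<partial>lborel)))) \<longlonglongrightarrow> ennreal (exp (\<nu> * (\<integral>x. g x - 1 \<partial>lborel)))"
      by (intro tendsto_ennrealI tendsto_exp tendsto_mult tendsto_const int_gk)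
  qed
  finally show ?thesis unfolding P_def .
qed

text \<open>The mirror image for factors at most 1: approximants decrease to \<open>g\<close> and
  partial products decrease in \<open>n\<close>. Monotone convergence from above needs an integrable
  start, which the bound 1 supplies.\<close>

lemma INF_nn_integral_prod_points:
  fixes g :: "real \<Rightarrow> real"
  assumes g [measurable]: "g \<in> borel_measurable borel" and ge: "\<And>x. 0 \<le> g x" and le: "\<And>x. g x \<le> 1"
    and int: "integrable lborel (\<lambda>x. 1 - g x)"
  shows "(INF n. \<integral>\<^sup>+\<omega>. ennreal (\<Prod>i<n. g (X i \<omega>)) \<partial>M) = ennreal (exp (- (\<nu> * (\<integral>x. 1 - g x \<partial>lborel))))"
proof -
  have "(\<lambda>x. 1 - g x) \<in> borel_measurable borel" "\<And>x. 0 \<le> 1 - g x" using le by auto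
  from borel_measurable_implies_simple_function_sequence_real[OF this]
  obtain f where f: "incseq f" "\<And>k. simple_function borel (f k)" "\<And>x. bdd_above (range (\<lambda>k. f k x))"
      "\<And>k x. 0 \<le> f k x" and f_sup: "(\<lambda>x. 1 - g x) = (SUP k. f k)" by metis
  have f_lim: "(\<lambda>k. f k x) \<longlonglongrightarrow> 1 - g x" for x
    using LIMSEQ_incseq_SUP[OF f(3), of x] f(1) fun_cong[OF f_sup, of x]
    by (simp add: incseq_def le_fun_def image_comp)
  have f_le: "f k x \<le> 1 - g x" for k x
    by (rule LIMSEQ_le_const[OF f_lim]) (use f(1) in \<open>auto simp: incseq_def le_fun_def\<close>)
  define B where "B k = {- real k..real k}" for k
  define gk where "gk k x = 1 - f k x * indicator (B k) x" for k x
  have B_inc: "B k \<subseteq> B l" if "k \<le> l" for k l using that by (auto simp: B_def)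
  have gk_dec: "gk l x \<le> gk k x" if "k \<le> l" for k l x
    unfolding gk_def using B_inc[OF that] f(1,4) that
    by (auto simp: indicator_def incseq_def le_fun_def)
  have gk_le1: "gk k x \<le> 1" for k x using f(4) by (simp add: gk_def indicator_def)
  have gk_ge: "g x \<le> gk k x" for k x using f_le[of k x] le[of x] by (auto simp: gk_def indicator_def)
  have gk_nonneg: "0 \<le> gk k x" for k x using gk_ge[of x k] ge[of x] by linarith
  have gk_simple: "simple_function borel (gk k)" for k
    unfolding gk_def[abs_def] using f(2)
    by (intro simple_function_diff simple_function_mult simple_function_const simple_function_indicator)
      (auto simp: B_def)
  have gk_meas [measurable]: "gk k \<in> borel_measurable borel" for k
    by (rule borel_measurable_simple_function[OF gk_simple])
  have gk_lim: "(\<lambda>k. gk k x) \<longlonglongrightarrow> g x" for x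
  proof -
    obtain N :: nat where "\<bar>x\<bar> \<le> real N" using real_arch_simple by blast
    then have "eventually (\<lambda>k. indicator (B k) x = (1::real)) sequentially"
      by (intro eventually_mono[OF eventually_ge_at_top[of N]]) (auto simp: B_def indicator_def)
    then have "(\<lambda>k. indicator (B k) x :: real) \<longlonglongrightarrow> 1" by (rule tendsto_eventually)
    from tendsto_diff[OF tendsto_const tendsto_mult[OF f_lim this], of 1 x]
    show ?thesis by (simp add: gk_def)
  qed
  have int_gk_le: "AE x in lborel. norm (gk k x - 1) \<le> 1 - g x" for k
  proof (intro always_eventually allI)
    fix x show "norm (gk k x - 1) \<le> 1 - g x" using gk_ge[of x k] gk_le1[of k x] by (simp add: abs_if)
  qed
  have int_gk: "(\<lambda>k. \<integral>x. gk k x - 1 \<partial>lborel) \<longlonglongrightarrow> (\<integral>x. g x - 1 \<partial>lborel)"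
  proof (rule integral_dominated_convergence[OF _ _ int])
    show "AE x in lborel. (\<lambda>k. gk k x - 1) \<longlonglongrightarrow> g x - 1"
      by (intro always_eventually allI tendsto_diff gk_lim tendsto_const)
  qed (use int_gk_le in auto)
  have int_gk_mono: "(\<integral>x. gk l x - 1 \<partial>lborel) \<le> (\<integral>x. gk k x - 1 \<partial>lborel)" if "k \<le> l" for k l
  proof (intro integral_mono)
    show "integrable lborel (\<lambda>x. gk k x - 1)" for k
      by (rule Bochner_Integration.integrable_bound[OF int])
        (use int_gk_le[of k] le in \<open>auto elim!: eventually_mono\<close>)
    then show "integrable lborel (\<lambda>x. gk k x - 1)" .
  qed (use gk_dec[OF that] in auto)
  define P where "P h n \<omega> = ennreal (\<Prod>i<n. h (X i \<omega>))" for h :: "real \<Rightarrow> real" and n \<omega>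
  have P_meas [measurable]: "P (gk k) n \<in> borel_measurable M" for k n unfolding P_def[abs_def] by measurable
  have P_fin: "(\<integral>\<^sup>+\<omega>. P (gk k) n \<omega> \<partial>M) < \<infinity>" for k n
  proof -
    have "(\<integral>\<^sup>+\<omega>. P (gk k) n \<omega> \<partial>M) \<le> (\<integral>\<^sup>+\<omega>. 1 \<partial>M)"
      unfolding P_def using gk_nonneg gk_le1 by (intro nn_integral_mono) (auto simp: ennreal_le_1 intro!: prod_le_1)
    then show ?thesis by (simp add: emeasure_space_1 order_le_less_trans)
  qed
  have P_decn: "P h n \<omega> \<le> P h m \<omega>" if "m \<le> n" "\<And>x. 0 \<le> h x" "\<And>x. h x \<le> 1" for h m n \<omega>
  proof -
    have "(\<Prod>i<n. h (X i \<omega>)) = (\<Prod>i<m. h (X i \<omega>)) * (\<Prod>i\<in>{m..<n}. h (X i \<omega>))"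
      using that(1) by (simp add: prod.atLeastLessThan_concat lessThan_atLeast0)
    also have "\<dots> \<le> (\<Prod>i<m. h (X i \<omega>)) * 1"
      using that by (intro mult_left_mono prod_le_1 prod_nonneg) auto
    finally show ?thesis unfolding P_def by (intro ennreal_leI) simp
  qed
  have P_deck: "P (gk l) n \<omega> \<le> P (gk k) n \<omega>" if "k \<le> l" for k l n \<omega>
    unfolding P_def by (intro ennreal_leI prod_mono conjI gk_dec[OF that] gk_nonneg)
  have P_infk: "(INF k. P (gk k) n \<omega>) = P g n \<omega>" for n \<omega>
  proof (rule LIMSEQ_unique[OF LIMSEQ_INF])
    show "decseq (\<lambda>k. P (gk k) n \<omega>)" using P_deck by (auto simp: decseq_def)
    show "(\<lambda>k. P (gk k) n \<omega>) \<longlonglongrightarrow> P g n \<omega>"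
      unfolding P_def by (intro tendsto_ennrealI tendsto_prod gk_lim)
  qed
  have P_infn: "(\<integral>\<^sup>+\<omega>. (INF n. P (gk k) n \<omega>) \<partial>M) = ennreal (exp (\<nu> * (\<integral>x. gk k x - 1 \<partial>lborel)))" for k
  proof -
    have "AE \<omega> in M. (INF n. P (gk k) n \<omega>) = ennreal (\<Prod>i\<in>{i. X i \<omega> \<in> B k}. gk k (X i \<omega>))"
      using distinct AE_space
    proof eventually_elim
      case (elim \<omega>)
      show ?case
      proof (rule LIMSEQ_unique[OF LIMSEQ_INF])
        show "decseq (\<lambda>n. P (gk k) n \<omega>)" using P_decn gk_nonneg gk_le1 by (auto simp: decseq_def)
        have "eventually (\<lambda>n. (\<Prod>i<n. gk k (X i \<omega>)) = (\<Prod>i\<in>{i. X i \<omega> \<in> B k}. gk k (X i \<omega>))) sequentially"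
          by (rule eventually_prod_indices[OF elim(2,1)]) (auto simp: B_def gk_def)
        then show "(\<lambda>n. P (gk k) n \<omega>) \<longlonglongrightarrow> ennreal (\<Prod>i\<in>{i. X i \<omega> \<in> B k}. gk k (X i \<omega>))"
          unfolding P_def by (intro tendsto_ennrealI tendsto_eventually)
      qed
    qed
    then have "(\<integral>\<^sup>+\<omega>. (INF n. P (gk k) n \<omega>) \<partial>M)
        = (\<integral>\<^sup>+\<omega>. ennreal (\<Prod>i\<in>{i. X i \<omega> \<in> B k}. gk k (X i \<omega>)) \<partial>M)"
      by (rule nn_integral_cong_AE)
    also have "\<dots> = ennreal (exp (\<nu> * (\<integral>x. gk k x - 1 \<partial>lborel)))"
      by (rule nn_integral_prod_points_simple[OF gk_simple gk_nonneg]) (auto simp: B_def gk_def)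
    finally show ?thesis .
  qed
  have "(INF n. \<integral>\<^sup>+\<omega>. P g n \<omega> \<partial>M) = (INF n. \<integral>\<^sup>+\<omega>. (INF k. P (gk k) n \<omega>) \<partial>M)"
    unfolding P_infk ..
  also have "\<dots> = (INF n. INF k. \<integral>\<^sup>+\<omega>. P (gk k) n \<omega> \<partial>M)"
  proof (intro INF_cong refl nn_integral_monotone_convergence_INF_decseq)
    show "decseq (\<lambda>k. P (gk k) n)" for n by (intro decseq_SucI le_funI P_deck) simp
  qed (use P_fin[of 0] in auto)
  also have "\<dots> = (INF k. INF n. \<integral>\<^sup>+\<omega>. P (gk k) n \<omega> \<partial>M)" by (rule INF_commute)
  also have "\<dots> = (INF k. \<integral>\<^sup>+\<omega>. (INF n. P (gk k) n \<omega>) \<partial>M)"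
  proof (intro INF_cong refl nn_integral_monotone_convergence_INF_decseq[symmetric])
    show "decseq (P (gk k))" for k by (intro decseq_SucI le_funI P_decn gk_nonneg gk_le1) simp
  qed (use P_fin[of _ 0] in auto)
  also have "\<dots> = (INF k. ennreal (exp (\<nu> * (\<integral>x. gk k x - 1 \<partial>lborel))))"
    unfolding P_infn ..
  also have "\<dots> = ennreal (exp (\<nu> * (\<integral>x. g x - 1 \<partial>lborel)))"
  proof (rule LIMSEQ_unique[OF LIMSEQ_INF])
    show "decseq (\<lambda>k. ennreal (exp (\<nu> * (\<integral>x. gk k x - 1 \<partial>lborel))))"
      using int_gk_mono rate_pos by (auto simp: decseq_def intro!: ennreal_leI mult_left_mono)
    show "(\<lambda>k. ennreal (exp (\<nu> * (\<integral>x. gk k x - 1 \<partial>lborel)))) \<longlonglongrightarrow> ennreal (exp (\<nu> * (\<integral>x. g x - 1 \<partial>lborel)))"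
      by (intro tendsto_ennrealI tendsto_exp tendsto_mult tendsto_const int_gk)
  qed
  also have "(\<integral>x. g x - 1 \<partial>lborel) = - (\<integral>x. 1 - g x \<partial>lborel)"
    by (subst integral_minus[symmetric]) simp
  finally show ?thesis unfolding P_def by simp
qed

text \<open>A cell of length \<open>h\<close> and its translate by \<open>- c\<close> are disjoint
  when \<open>h < \<bar>c\<bar>\<close>, so both are occupied with probability at most
  \<open>(\<nu> * h)\<^sup>2\<close>. About \<open>2 * m / h\<close> cells cover a bounded window,
  so the total is of order \<open>h\<close> and tends to 0.\<close>

lemma AE_diff_points_neq:
  assumes "c \<noteq> 0"
  shows "AE \<omega> in M. X i \<omega> - X j \<omega> \<noteq> c"
proof -
  have null: "prob {\<omega> \<in> space M. X i \<omega> \<in> {- real m<..real m} \<and> X i \<omega> - X j \<omega> = c} = 0" (is "prob ?E = 0") for m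
  proof -
    have E [measurable]: "?E \<in> events" by measurable
    have bound: "prob ?E \<le> 2 * real m * \<nu>\<^sup>2 / real (Suc n)" if n: "1 / real (Suc n) < \<bar>c\<bar>" for n
    proof -
      define h where "h = 1 / real (Suc n)"
      have h: "0 < h" "h < \<bar>c\<bar>" "real (Suc n) * h = 1" using n by (auto simp: h_def)
      define A where "A k = {of_int k * h<..(of_int k + 1) * h}" for k :: int
      define A' where "A' k = {of_int k * h - c<..(of_int k + 1) * h - c}" for k :: int
      define N where "N B \<omega> = card (range (\<lambda>i. X i \<omega>) \<inter> B)" for B \<omega>
      \<comment> \<open>The cells that tile \<open>{- m<..m}\<close>; there are
        \<open>2 * m * Suc n\<close> of them because \<open>h = 1 / Suc n\<close>.\<close>
      define K where "K = {- int (m * Suc n)..<int (m * Suc n)}"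
      define F where "F k = {\<omega> \<in> space M. 1 \<le> N (A k) \<omega> \<and> 1 \<le> N (A' k) \<omega>}" for k
      have AB: "A k \<in> sets borel" "bounded (A k)" "A' k \<in> sets borel" "bounded (A' k)" for k
        by (auto simp: A_def A'_def)
      have N_meas [measurable]: "N (A k) \<in> M \<rightarrow>\<^sub>M count_space UNIV" "N (A' k) \<in> M \<rightarrow>\<^sub>M count_space UNIV" for k
        unfolding N_def[abs_def] by (rule measurable_card_points[OF AB(1,2)], rule measurable_card_points[OF AB(3,4)])
      have N1: "prob {\<omega> \<in> space M. 1 \<le> N B \<omega>} \<le> \<nu> * h"
        if B: "B \<in> sets borel" "bounded B" "measure lborel B = h" for B
      proof -
        have [measurable]: "N B \<in> M \<rightarrow>\<^sub>M count_space UNIV"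
          unfolding N_def[abs_def] by (rule measurable_card_points[OF B(1,2)])
        have "prob {\<omega> \<in> space M. 1 \<le> N B \<omega>} = 1 - prob {\<omega> \<in> space M. N B \<omega> = 0}"
          by (subst prob_neg[symmetric]) (auto simp: not_le intro!: arg_cong[where f=prob])
        also have "\<dots> = 1 - exp (- (\<nu> * h))"
          using prob_card_points[OF B(1,2), of 0] B(3) by (simp add: N_def)
        also have "\<dots> \<le> \<nu> * h" using exp_ge_add_one_self[of "- (\<nu> * h)"] by simp
        finally show ?thesis .
      qed
      have F_meas: "F k \<in> events" for k unfolding F_def by measurable
      have F_prob: "prob (F k) \<le> (\<nu> * h)\<^sup>2" for k
      proof -
        define Bs where "Bs = (\<lambda>l::nat. if l = 0 then A k else A' k)"
        have disj: "A k \<inter> A' k = {}" using h by (auto simp: A_def A'_def algebra_simps)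
        have "indep_vars (\<lambda>_. count_space UNIV) (\<lambda>l \<omega>. N (Bs l) \<omega>) {0, 1}"
          unfolding N_def by (intro indep_card_points) (use disj AB in \<open>auto simp: Bs_def disjoint_family_on_def\<close>)
        from indep_varsD_finite[OF this, of "\<lambda>_. {1..}"]
        have "prob (\<Inter>l\<in>{0, 1}. N (Bs l) -` {1..} \<inter> space M) = (\<Prod>l\<in>{0, 1}. prob (N (Bs l) -` {1..} \<inter> space M))"
          by simp
        also have "(\<Inter>l\<in>{0, 1}. N (Bs l) -` {1..} \<inter> space M) = F k"
          by (auto simp: F_def Bs_def)
        also have "(\<Prod>l\<in>{0, 1}. prob (N (Bs l) -` {1..} \<inter> space M))
            = prob {\<omega> \<in> space M. 1 \<le> N (A k) \<omega>} * prob {\<omega> \<in> space M. 1 \<le> N (A' k) \<omega>}"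
          by (auto simp: Bs_def vimage_def Int_def conj_commute)
        also have "\<dots> \<le> (\<nu> * h) * (\<nu> * h)"
          using h(1) rate_pos AB by (intro mult_mono N1) (auto simp: A_def A'_def algebra_simps)
        finally show ?thesis by (simp add: power2_eq_square)
      qed
      have "?E \<subseteq> (\<Union>k\<in>K. F k)"
      proof
        fix \<omega> assume \<omega>: "\<omega> \<in> ?E"
        \<comment> \<open>Cells are open on the left, hence the ceiling minus one and not the
          floor.\<close>
        define k where "k = \<lceil>X i \<omega> / h\<rceil> - 1"
        have k: "of_int k * h < X i \<omega>" "X i \<omega> \<le> (of_int k + 1) * h"
          using h(1) unfolding k_def by (simp_all add: pos_less_divide_eq[symmetric] pos_divide_le_eq[symmetric], linarith)
        have "X i \<omega> \<in> A k" using k by (simp add: A_def)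
        then have "range (\<lambda>i. X i \<omega>) \<inter> A k \<noteq> {}" by blast
        moreover have "X j \<omega> \<in> A' k" using k \<omega> by (auto simp: A'_def)
        then have "range (\<lambda>i. X i \<omega>) \<inter> A' k \<noteq> {}" by blast
        ultimately have "\<omega> \<in> F k"
          using \<omega> finite_points[of \<omega> "A k"] finite_points[of \<omega> "A' k"] AB
          by (auto simp: F_def N_def Suc_le_eq card_gt_0_iff)
        moreover have "k \<in> K"
        proof -
          have eq: "X i \<omega> / h = X i \<omega> * real (Suc n)" by (simp add: h_def)
          have "X i \<omega> * real (Suc n) \<le> real m * real (Suc n)"
            using \<omega> by (intro mult_right_mono) auto
          then have "X i \<omega> / h \<le> real_of_int (int (m * Suc n))"
            by (simp only: eq of_int_of_nat_eq of_nat_mult of_int_mult)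
          moreover have "- real m * real (Suc n) < X i \<omega> * real (Suc n)"
            using \<omega> by (intro mult_strict_right_mono) auto
          then have "real_of_int (- int (m * Suc n)) < X i \<omega> / h"
            by (simp only: eq of_int_of_nat_eq of_nat_mult of_int_mult of_int_minus mult_minus_left)
          ultimately have "\<lceil>X i \<omega> / h\<rceil> \<le> int (m * Suc n)" "- int (m * Suc n) < \<lceil>X i \<omega> / h\<rceil>"
            by (simp_all only: ceiling_le_iff less_ceiling_iff)
          then show ?thesis unfolding K_def k_def atLeastLessThan_iff by linarith
        qed
        ultimately show "\<omega> \<in> (\<Union>k\<in>K. F k)" by blast
      qed
      then have "prob ?E \<le> prob (\<Union>k\<in>K. F k)"
        using F_meas by (intro finite_measure_mono) (auto simp: K_def)
      also have "\<dots> \<le> (\<Sum>k\<in>K. prob (F k))"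
        using F_meas by (intro finite_measure_subadditive_finite) (auto simp: K_def)
      also have "\<dots> \<le> (\<Sum>k\<in>K. (\<nu> * h)\<^sup>2)" by (intro sum_mono F_prob)
      also have "\<dots> = 2 * real m * \<nu>\<^sup>2 / real (Suc n)"
      proof -
        have "real (card K) = 2 * real m * real (Suc n)" unfolding K_def by (simp add: nat_add_distrib nat_mult_distrib algebra_simps)
        then have "(\<Sum>k\<in>K. (\<nu> * h)\<^sup>2) = 2 * real m * \<nu>\<^sup>2 * (real (Suc n) * h) * h"
          by (simp only: sum_constant power2_eq_square mult_ac)
        also have "\<dots> = 2 * real m * \<nu>\<^sup>2 / real (Suc n)" unfolding h(3) by (simp add: h_def)
        finally show ?thesis .
      qed
      finally show ?thesis .
    qed
    have "(\<lambda>n. 2 * real m * \<nu>\<^sup>2 / real (Suc n)) \<longlonglongrightarrow> 0"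
      using LIMSEQ_inverse_real_of_nat[THEN tendsto_mult_right_zero, of "2 * real m * \<nu>\<^sup>2"]
      by (simp add: divide_inverse)
    moreover have "eventually (\<lambda>n. prob ?E \<le> 2 * real m * \<nu>\<^sup>2 / real (Suc n)) sequentially"
    proof -
      have "eventually (\<lambda>n. inverse (real (Suc n)) < \<bar>c\<bar>) sequentially"
        by (rule order_tendstoD(2)[OF LIMSEQ_inverse_real_of_nat]) (use assms in simp)
      then show ?thesis by eventually_elim (rule bound, simp add: inverse_eq_divide)
    qed
    ultimately have "prob ?E \<le> 0" by (rule tendsto_lowerbound) simp
    then show ?thesis by (simp add: measure_le_0_iff)
  qed
  have "AE \<omega> in M. \<not> (X i \<omega> \<in> {- real m<..real m} \<and> X i \<omega> - X j \<omega> = c)" for m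
  proof (rule AE_I)
    show "emeasure M {\<omega> \<in> space M. X i \<omega> \<in> {- real m<..real m} \<and> X i \<omega> - X j \<omega> = c} = 0"
      using null[of m] by (simp only: emeasure_eq_measure ennreal_0)
  qed auto
  then have "AE \<omega> in M. \<forall>m. \<not> (X i \<omega> \<in> {- real m<..real m} \<and> X i \<omega> - X j \<omega> = c)"
    by (simp add: AE_all_countable)
  then show ?thesis
  proof eventually_elim
    case (elim \<omega>)
    obtain m :: nat where "\<bar>X i \<omega>\<bar> < real m" using reals_Archimedean2 by blast
    then have "X i \<omega> \<in> {- real m<..real m}" by auto
    with elim show ?case by blast
  qed
qed

end

section \<open>Counts of the cluster process\<close>

text \<open>Counts the points in \<open>(0, t]\<close> of the translate of \<open>z\<close> by
  \<open>x\<close>. Moving the window instead of the cluster keeps the second argument a centered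
  cluster, whose law does not depend on the immigrant.\<close>

definition shifted_count :: "real \<Rightarrow> real \<Rightarrow> real set \<Rightarrow> real" where
  "shifted_count t x z = real (card (z \<inter> {- x<..t - x}))"

lemma shifted_count_nonneg [simp]: "0 \<le> shifted_count t x z"
  by (simp add: shifted_count_def)

lemma measurable_shifted_count:
  "(\<lambda>(x, z). shifted_count t x z) \<in> borel_measurable (borel \<Otimes>\<^sub>M config_space)"
  using measurable_card_shift[of 0 t] by (simp add: shifted_count_def)

lemma measurable_shifted_count' [measurable (raw)]:
  assumes "f \<in> borel_measurable N" "g \<in> N \<rightarrow>\<^sub>M config_space"
  shows "(\<lambda>\<omega>. shifted_count t (f \<omega>) (g \<omega>)) \<in> borel_measurable N"
  using measurable_compose[OF measurable_Pair[OF assms] measurable_shifted_count] by simp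

lemma shifted_count_le_card: "finite z \<Longrightarrow> shifted_count t x z \<le> real (card z)"
  unfolding shifted_count_def by (simp add: card_mono)

lemma card_translate_Int:
  fixes x a b :: real
  shows "real (card ((\<lambda>y. y + x) ` z \<inter> {a<..b})) = real (card (z \<inter> {a - x<..b - x}))"
proof -
  have "y + x \<in> {a<..b} \<longleftrightarrow> y \<in> {a - x<..b - x}" for y by auto
  then have "(\<lambda>y. y + x) ` z \<inter> {a<..b} = (\<lambda>y. y + x) ` (z \<inter> {a - x<..b - x})" by blast
  then show ?thesis by (simp add: card_image inj_on_def)
qed

text \<open>
  Integrated over the position \<open>x\<close> of the immigrant, a cluster with points \<open>z\<close> is seen entirely in
  \<open>(0, t]\<close> except for a set of \<open>x\<close> of measure at most \<open>2 * r\<close>, and seen at all only for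
  \<open>x\<close> in an interval of length \<open>t + 2 * r\<close>.
\<close>

lemma nn_integral_shifted_count_bounds:
  fixes h :: "real \<Rightarrow> real" and t r :: real
  assumes z: "finite z" and r: "\<And>y. y \<in> z \<Longrightarrow> \<bar>y\<bar> \<le> r" "0 \<le> r"
    and h0: "h 0 = 0" and mono: "\<And>a b. 0 \<le> a \<Longrightarrow> a \<le> b \<Longrightarrow> h a \<le> h b" and t: "0 < t"
  shows "(\<integral>\<^sup>+x. ennreal (h (shifted_count t x z)) \<partial>lborel) \<le> ennreal (h (card z) * (t + 2 * r))"
    and "ennreal (h (card z) * (t - 2 * r)) \<le> (\<integral>\<^sup>+x. ennreal (h (shifted_count t x z)) \<partial>lborel)"
proof -
  have h_nonneg: "0 \<le> h (card z)" using mono[of 0 "card z"] h0 by simp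
  have "(\<integral>\<^sup>+x. ennreal (h (shifted_count t x z)) \<partial>lborel)
      \<le> (\<integral>\<^sup>+x. ennreal (h (card z)) * indicator {- r..t + r} x \<partial>lborel)"
  proof (rule nn_integral_mono)
    fix x
    show "ennreal (h (shifted_count t x z)) \<le> ennreal (h (card z)) * indicator {- r..t + r} x"
    proof (cases "x \<in> {- r..t + r}")
      case True
      then show ?thesis using shifted_count_le_card[OF z] by (simp add: ennreal_leI mono)
    next
      case False
      have "z \<inter> {- x<..t - x} = {}"
      proof (rule ccontr)
        assume "z \<inter> {- x<..t - x} \<noteq> {}"
        then obtain y where "y \<in> z" "- x < y" "y \<le> t - x" by auto
        then show False using r(1)[of y] False by auto
      qed
      then show ?thesis using h0 by (simp add: shifted_count_def)
    qed
  qed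
  also have "\<dots> = ennreal (h (card z) * (t + 2 * r))"
  proof -
    have "emeasure lborel {- r..t + r} = ennreal (t + 2 * r)"
      using t r by (subst emeasure_lborel_Icc) (simp_all del: ennreal_plus)
    then show ?thesis
      using h_nonneg by (simp add: nn_integral_cmult_indicator ennreal_mult' del: ennreal_plus)
  qed
  finally show "(\<integral>\<^sup>+x. ennreal (h (shifted_count t x z)) \<partial>lborel) \<le> ennreal (h (card z) * (t + 2 * r))" .
  show "ennreal (h (card z) * (t - 2 * r)) \<le> (\<integral>\<^sup>+x. ennreal (h (shifted_count t x z)) \<partial>lborel)"
  proof (cases "2 * r \<le> t")
    case True
    have "ennreal (h (card z) * (t - 2 * r)) = (\<integral>\<^sup>+x. ennreal (h (card z)) * indicator {r<..t - r} x \<partial>lborel)"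
      using True h_nonneg by (simp add: nn_integral_cmult_indicator ennreal_mult[symmetric])
    also have "\<dots> \<le> (\<integral>\<^sup>+x. ennreal (h (shifted_count t x z)) \<partial>lborel)"
    proof (rule nn_integral_mono)
      fix x
      show "ennreal (h (card z)) * indicator {r<..t - r} x \<le> ennreal (h (shifted_count t x z))"
      proof (cases "x \<in> {r<..t - r}")
        case True
        have "z \<inter> {- x<..t - x} = z"
        proof safe
          fix y assume "y \<in> z"
          with r(1)[of y] True show "y \<in> {- x<..t - x}" by auto
        qed
        then have "shifted_count t x z = real (card z)" by (simp only: shifted_count_def)
        then show ?thesis using True by simp
      qed simp
    qed
    finally show ?thesis .
  next
    case False
    then have "h (card z) * (t - 2 * r) \<le> 0" using h_nonneg by (intro mult_nonneg_nonpos) auto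
    then show ?thesis by (simp add: ennreal_neg)
  qed
qed

section \<open>Centered clusters and their independence of the immigrants\<close>

context poisson_cluster_process
begin

sublocale points: enumerated_poisson_process M \<nu> X
  by unfold_locales (fact intensity_pos immigrant_measurable immigrants_distinct immigrants_poisson)+

abbreviation Z :: "nat \<Rightarrow> 'a \<Rightarrow> real set" where "Z \<equiv> centered_cluster X C"

lemma measurable_Z [measurable]: "Z i \<in> M \<rightarrow>\<^sub>M config_space"
  using centered_indep by (simp add: indep_vars_def)

lemma measurable_C0 [measurable]: "C0 \<in> M \<rightarrow>\<^sub>M config_space"
  using C0_finite by (simp add: finite_point_process_def point_process_def)

lemma finite_C0: "\<omega> \<in> space M \<Longrightarrow> finite (C0 \<omega>)"
  using C0_finite by (simp add: finite_point_process_def)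

lemma finite_C: "\<omega> \<in> space M \<Longrightarrow> finite (C i \<omega>)"
  using cluster_finite[of i] by (simp add: finite_point_process_def)

lemma finite_Z: "\<omega> \<in> space M \<Longrightarrow> finite (Z i \<omega>)"
  unfolding centered_cluster_def by (simp add: finite_C)

lemma C_eq_translate: "C i \<omega> = (\<lambda>y. y + X i \<omega>) ` Z i \<omega>"
  unfolding centered_cluster_def by (simp add: image_image)

lemma card_C_Int: "real (card (C i \<omega> \<inter> {0<..t})) = shifted_count t (X i \<omega>) (Z i \<omega>)"
  by (subst C_eq_translate) (simp add: card_translate_Int shifted_count_def)

lemma nn_integral_Z_eq_C0:
  assumes "f \<in> borel_measurable config_space"
  shows "(\<integral>\<^sup>+\<omega>. f (Z i \<omega>) \<partial>M) = (\<integral>\<^sup>+\<omega>. f (C0 \<omega>) \<partial>M)"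
proof -
  have "(\<integral>\<^sup>+\<omega>. f (Z i \<omega>) \<partial>M) = (\<integral>\<^sup>+z. f z \<partial>distr M config_space (Z i))"
    using assms by (subst nn_integral_distr) auto
  also have "\<dots> = (\<integral>\<^sup>+\<omega>. f (C0 \<omega>) \<partial>M)"
    using assms by (simp only: centered_distr) (subst nn_integral_distr; simp)
  finally show ?thesis .
qed

text \<open>\<open>C0\<close> only shares the law of the centered clusters, so the pointwise
  membership of 0 in \<open>Z 0\<close> is rewritten as the measurable event that the count in
  \<open>{0}\<close> is 1 and then transferred.\<close>

lemma AE_zero_in_C0: "AE \<omega> in M. 0 \<in> C0 \<omega>"
proof -
  have [measurable]: "(\<lambda>z. card (z \<inter> {0})) \<in> config_space \<rightarrow>\<^sub>M count_space UNIV"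
    by (rule measurable_card_Int_config) auto
  have pred: "{z \<in> space config_space. card (z \<inter> {0}) = 1} \<in> sets config_space" by measurable
  have "0 \<in> Z 0 \<omega>" if "\<omega> \<in> space M" for \<omega>
    using immigrant_in_cluster[OF that, of 0] by (auto simp: centered_cluster_def)
  then have "AE \<omega> in M. card (Z 0 \<omega> \<inter> {0}) = 1" by (intro AE_I2) simp
  then have "AE \<omega> in M. card (C0 \<omega> \<inter> {0}) = 1"
    unfolding AE_distr_iff[OF measurable_Z pred, symmetric] centered_distr AE_distr_iff[OF measurable_C0 pred] .
  then show ?thesis by eventually_elim (rule ccontr, simp)
qed

abbreviation immigrants_space :: "(nat \<Rightarrow> real) measure" where
  "immigrants_space \<equiv> \<Pi>\<^sub>M i\<in>UNIV. borel"

abbreviation clusters_space :: "(nat \<Rightarrow> real set) measure" where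
  "clusters_space \<equiv> \<Pi>\<^sub>M i\<in>UNIV. config_space"

lemma measurable_immigrants [measurable]: "(\<lambda>\<omega> i. X i \<omega>) \<in> M \<rightarrow>\<^sub>M immigrants_space"
  by (rule measurable_PiM_single') auto

lemma measurable_clusters [measurable]: "(\<lambda>\<omega> i. Z i \<omega>) \<in> M \<rightarrow>\<^sub>M clusters_space"
  by (rule measurable_PiM_single') (use measurable_space[OF measurable_Z] in auto)

text \<open>The independence hypothesis about preimages under the two sequences is the product
  formula on measurable rectangles, and these determine the joint law.\<close>

lemma distr_immigrants_clusters:
  "distr M immigrants_space (\<lambda>\<omega> i. X i \<omega>) \<Otimes>\<^sub>M distr M clusters_space (\<lambda>\<omega> i. Z i \<omega>)
    = distr M (immigrants_space \<Otimes>\<^sub>M clusters_space) (\<lambda>\<omega>. (\<lambda>i. X i \<omega>, \<lambda>i. Z i \<omega>))"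
    (is "?P \<Otimes>\<^sub>M ?Q = ?R")
proof (rule pair_measure_eqI)
  interpret P: prob_space ?P by (rule prob_space_distr) measurable
  interpret Q: prob_space ?Q by (rule prob_space_distr) measurable
  show "sigma_finite_measure ?P" "sigma_finite_measure ?Q" by unfold_locales
  show "sets (?P \<Otimes>\<^sub>M ?Q) = sets ?R" by simp
  fix A B assume "A \<in> sets ?P" "B \<in> sets ?Q"
  then have [measurable]: "A \<in> sets immigrants_space" "B \<in> sets clusters_space" by auto
  let ?A = "(\<lambda>\<omega> i. X i \<omega>) -` A \<inter> space M" and ?B = "(\<lambda>\<omega> i. Z i \<omega>) -` B \<inter> space M"
  have "prob (?A \<inter> ?B) = prob ?A * prob ?B"
    by (rule indep_setD[OF centered_indep_immigrants]) auto
  moreover have "(\<lambda>\<omega>. (\<lambda>i. X i \<omega>, \<lambda>i. Z i \<omega>)) -` (A \<times> B) \<inter> space M = ?A \<inter> ?B" by auto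
  ultimately show "emeasure ?P A * emeasure ?Q B = emeasure ?R (A \<times> B)"
    by (simp add: emeasure_distr emeasure_eq_measure ennreal_mult)
qed

lemma measurable_independent_copies:
  "(\<lambda>p. (\<lambda>i. X i (fst p), \<lambda>i. Z i (snd p))) \<in> M \<Otimes>\<^sub>M M \<rightarrow>\<^sub>M immigrants_space \<Otimes>\<^sub>M clusters_space"
  by (intro measurable_Pair measurable_compose[OF measurable_fst measurable_immigrants]
      measurable_compose[OF measurable_snd measurable_clusters])

text \<open>Both orders of integration occur: with the immigrants frozen, exponential functionals
  factorize over independent clusters; with the clusters frozen, a coincidence of two clusters is an
  event about immigrants only.\<close>

lemma nn_integral_immigrants_clusters:
  assumes F [measurable]: "F \<in> borel_measurable (immigrants_space \<Otimes>\<^sub>M clusters_space)"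
  shows "(\<integral>\<^sup>+\<omega>. F (\<lambda>i. X i \<omega>, \<lambda>i. Z i \<omega>) \<partial>M) = (\<integral>\<^sup>+\<omega>'. \<integral>\<^sup>+\<omega>. F (\<lambda>i. X i \<omega>', \<lambda>i. Z i \<omega>) \<partial>M \<partial>M)"
    and "(\<integral>\<^sup>+\<omega>. F (\<lambda>i. X i \<omega>, \<lambda>i. Z i \<omega>) \<partial>M) = (\<integral>\<^sup>+\<omega>. \<integral>\<^sup>+\<omega>'. F (\<lambda>i. X i \<omega>', \<lambda>i. Z i \<omega>) \<partial>M \<partial>M)"
proof -
  let ?X = "\<lambda>\<omega> i. X i \<omega>" and ?Z = "\<lambda>\<omega> i. Z i \<omega>"
  let ?P = "distr M immigrants_space ?X" and ?Q = "distr M clusters_space ?Z"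
  interpret P: prob_space ?P by (rule prob_space_distr) measurable
  interpret Q: prob_space ?Q by (rule prob_space_distr) measurable
  interpret PQ: pair_sigma_finite ?P ?Q ..
  interpret MM: pair_sigma_finite M M ..
  have "(\<integral>\<^sup>+\<omega>. F (?X \<omega>, ?Z \<omega>) \<partial>M) = (\<integral>\<^sup>+p. F p \<partial>distr M (immigrants_space \<Otimes>\<^sub>M clusters_space) (\<lambda>\<omega>. (?X \<omega>, ?Z \<omega>)))"
    by (subst nn_integral_distr) auto
  also have "\<dots> = (\<integral>\<^sup>+p. F p \<partial>(?P \<Otimes>\<^sub>M ?Q))"
    by (simp add: distr_immigrants_clusters)
  also have "\<dots> = (\<integral>\<^sup>+x. \<integral>\<^sup>+z. F (x, z) \<partial>?Q \<partial>?P)"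
    by (subst Q.nn_integral_fst[symmetric]) auto
  also have "\<dots> = (\<integral>\<^sup>+\<omega>'. \<integral>\<^sup>+z. F (?X \<omega>', z) \<partial>?Q \<partial>M)"
    by (subst nn_integral_distr) auto
  also have "\<dots> = (\<integral>\<^sup>+\<omega>'. \<integral>\<^sup>+\<omega>. F (?X \<omega>', ?Z \<omega>) \<partial>M \<partial>M)"
    by (intro nn_integral_cong, subst nn_integral_distr) auto
  finally show 1: "(\<integral>\<^sup>+\<omega>. F (?X \<omega>, ?Z \<omega>) \<partial>M) = (\<integral>\<^sup>+\<omega>'. \<integral>\<^sup>+\<omega>. F (?X \<omega>', ?Z \<omega>) \<partial>M \<partial>M)" .
  have "(\<lambda>p. F (?X (fst p), ?Z (snd p))) \<in> borel_measurable (M \<Otimes>\<^sub>M M)"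
    using measurable_compose[OF measurable_independent_copies F] .
  then have "case_prod (\<lambda>\<omega>' \<omega>. F (?X \<omega>', ?Z \<omega>)) \<in> borel_measurable (M \<Otimes>\<^sub>M M)"
    by (simp add: case_prod_unfold)
  from MM.Fubini'[OF this] 1
  show "(\<integral>\<^sup>+\<omega>. F (?X \<omega>, ?Z \<omega>) \<partial>M) = (\<integral>\<^sup>+\<omega>. \<integral>\<^sup>+\<omega>'. F (?X \<omega>', ?Z \<omega>) \<partial>M \<partial>M)" by simp
qed

text \<open>
  Given the centered clusters, two clusters meet only if the difference of their immigrants lies in
  a fixed finite set.
\<close>

lemma AE_clusters_disjoint:
  assumes "i \<noteq> j"
  shows "AE \<omega> in M. C i \<omega> \<inter> C j \<omega> \<inter> {0<..t} = {}"
proof -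
  let ?N = "immigrants_space \<Otimes>\<^sub>M clusters_space"
  define T where "T k p = (\<lambda>y. y + fst p k) ` snd p k" for k and p :: "(nat \<Rightarrow> real) \<times> (nat \<Rightarrow> real set)"
  have fin: "finite (T k p \<inter> {a<..b})" if "p \<in> space ?N" for k p a b
  proof -
    have "snd p k \<in> configurations" using that by (auto simp: space_pair_measure space_PiM PiE_def Pi_def)
    then have "finite (snd p k \<inter> {a - fst p k<..b - fst p k})" by (rule finite_Int_configuration) auto
    moreover have "T k p \<inter> {a<..b} \<subseteq> (\<lambda>y. y + fst p k) ` (snd p k \<inter> {a - fst p k<..b - fst p k})"
      by (auto simp: T_def)
    ultimately show ?thesis by (rule finite_surj)
  qed
  have cnt [measurable]: "(\<lambda>p. real (card (T k p \<inter> {a<..b}))) \<in> borel_measurable ?N" for k a b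
  proof -
    have "(\<lambda>p. (fst p k, snd p k)) \<in> ?N \<rightarrow>\<^sub>M borel \<Otimes>\<^sub>M config_space" by measurable
    from measurable_compose[OF this measurable_card_shift[of a b]]
    show ?thesis by (simp add: T_def card_translate_Int)
  qed
  \<comment> \<open>A two-member family indexed by truth values, so that the measurability result
    for countable unions covers the union of two clusters.\<close>
  define A where "A c = (if c then T i else T j)" for c
  have hit: "Measurable.pred ?N (\<lambda>p. A c p \<inter> {a<..b} = {})" for c a b
  proof -
    have "Measurable.pred ?N (\<lambda>p. real (card (A c p \<inter> {a<..b})) = 0)"
    proof -
      have "Measurable.pred ?N (\<lambda>p. real (card (T k p \<inter> {a<..b})) = 0)" for k by measurable
      then show ?thesis by (cases c) (simp_all add: A_def)
    qed
    moreover have "real (card (A c p \<inter> {a<..b})) = 0 \<longleftrightarrow> A c p \<inter> {a<..b} = {}" if "p \<in> space ?N" for p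
      using fin[OF that] by (simp add: A_def)
    ultimately show ?thesis by (subst measurable_cong) auto
  qed
  have [measurable]: "(\<lambda>p. real (card ((\<Union>c. A c p) \<inter> {0<..t}))) \<in> borel_measurable ?N"
    by (rule borel_measurable_card_UN[OF hit])
  \<comment> \<open>Overlap is detected by failure of additivity: the counts of the union and of the
    two clusters are measurable, so no count of an intersection enters.\<close>
  define F where "F p = (if real (card ((\<Union>c. A c p) \<inter> {0<..t}))
      = real (card (T i p \<inter> {0<..t})) + real (card (T j p \<inter> {0<..t})) then 0 else 1 :: ennreal)" for p
  have F_meas: "F \<in> borel_measurable ?N" unfolding F_def[abs_def] by measurable
  have F0: "F p = 0 \<longleftrightarrow> T i p \<inter> T j p \<inter> {0<..t} = {}" if "p \<in> space ?N" for p
  proof -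
    have U: "(\<Union>c. A c p) \<inter> {0<..t} = (T i p \<inter> {0<..t}) \<union> (T j p \<inter> {0<..t})"
      by (auto simp: A_def UNIV_bool)
    have "card ((T i p \<inter> {0<..t}) \<union> (T j p \<inter> {0<..t})) + card ((T i p \<inter> {0<..t}) \<inter> (T j p \<inter> {0<..t}))
        = card (T i p \<inter> {0<..t}) + card (T j p \<inter> {0<..t})"
      using card_Un_Int[OF fin[OF that] fin[OF that], of i 0 t j 0 t] by simp
    moreover have "card ((T i p \<inter> {0<..t}) \<inter> (T j p \<inter> {0<..t})) = 0 \<longleftrightarrow> (T i p \<inter> {0<..t}) \<inter> (T j p \<inter> {0<..t}) = {}"
      using fin[OF that] by simp
    moreover have "(T i p \<inter> {0<..t}) \<inter> (T j p \<inter> {0<..t}) = T i p \<inter> T j p \<inter> {0<..t}" by blast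
    ultimately show ?thesis unfolding F_def U of_nat_add[symmetric] of_nat_eq_iff by auto
  qed
  have in_space: "(\<lambda>i. X i \<omega>', \<lambda>i. Z i \<omega>) \<in> space ?N" if "\<omega> \<in> space M" for \<omega> \<omega>'
    using that measurable_space[OF measurable_Z] by (auto simp: space_pair_measure space_PiM)
  have "(\<integral>\<^sup>+\<omega>. F (\<lambda>i. X i \<omega>, \<lambda>i. Z i \<omega>) \<partial>M) = (\<integral>\<^sup>+\<omega>. \<integral>\<^sup>+\<omega>'. F (\<lambda>i. X i \<omega>', \<lambda>i. Z i \<omega>) \<partial>M \<partial>M)"
    by (rule nn_integral_immigrants_clusters(2)[OF F_meas])
  also have "\<dots> = (\<integral>\<^sup>+\<omega>. 0 \<partial>M)"
  proof (rule nn_integral_cong)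
    fix \<omega> assume \<omega>: "\<omega> \<in> space M"
    \<comment> \<open>The two clusters can meet only if the difference of their immigrants is in
      \<open>K\<close>. The value 0 is handled by distinctness of the immigrants, since the null
      sets above concern nonzero differences.\<close>
    define K where "K = (\<lambda>(y, w). w - y) ` (Z i \<omega> \<times> Z j \<omega>)"
    have "finite K" unfolding K_def using finite_Z[OF \<omega>] by auto
    moreover have "AE \<omega>' in M. c \<noteq> 0 \<longrightarrow> X i \<omega>' - X j \<omega>' \<noteq> c" for c
      using points.AE_diff_points_neq[of c i j] by (cases "c = 0") auto
    ultimately have "AE \<omega>' in M. \<forall>c\<in>K. c \<noteq> 0 \<longrightarrow> X i \<omega>' - X j \<omega>' \<noteq> c" by (intro AE_finite_allI)
    then have "AE \<omega>' in M. F (\<lambda>i. X i \<omega>', \<lambda>i. Z i \<omega>) = 0"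
      using immigrants_distinct
    proof eventually_elim
      case (elim \<omega>')
      have neq: "X i \<omega>' \<noteq> X j \<omega>'" using elim(2) assms by (auto dest: injD)
      have "y + X i \<omega>' \<noteq> w + X j \<omega>'" if "y \<in> Z i \<omega>" "w \<in> Z j \<omega>" for y w
      proof
        assume eq: "y + X i \<omega>' = w + X j \<omega>'"
        have "w - y \<in> K" using that by (force simp: K_def)
        moreover have "w - y \<noteq> 0" using eq neq by auto
        moreover have "X i \<omega>' - X j \<omega>' = w - y" using eq by linarith
        ultimately show False using elim(1) by blast
      qed
      then show ?case unfolding F0[OF in_space[OF \<omega>]] T_def by auto
    qed
    then show "(\<integral>\<^sup>+\<omega>'. F (\<lambda>i. X i \<omega>', \<lambda>i. Z i \<omega>) \<partial>M) = 0"
      by (subst nn_integral_cong_AE[of _ "\<lambda>_. 0"]) auto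
  qed
  finally have "(\<integral>\<^sup>+\<omega>. F (\<lambda>i. X i \<omega>, \<lambda>i. Z i \<omega>) \<partial>M) = 0" by simp
  moreover have "(\<lambda>\<omega>. F (\<lambda>i. X i \<omega>, \<lambda>i. Z i \<omega>)) \<in> borel_measurable M"
    by (rule measurable_compose[OF _ F_meas]) (intro measurable_Pair measurable_immigrants measurable_clusters)
  ultimately have "AE \<omega> in M. F (\<lambda>i. X i \<omega>, \<lambda>i. Z i \<omega>) = 0" by (subst (asm) nn_integral_0_iff_AE)
  then show ?thesis
    using AE_space
  proof eventually_elim
    case (elim \<omega>)
    then show ?case using F0[OF in_space[OF elim(2), of \<omega>]] by (simp add: T_def C_eq_translate[symmetric])
  qed
qed

lemma borel_measurable_card_cluster_process:
  "(\<lambda>\<omega>. real (card (cluster_process C \<omega> \<inter> {a<..b}))) \<in> borel_measurable M"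
  unfolding cluster_process_def
proof (rule borel_measurable_card_UN)
  fix i and a b :: real
  have "C i \<in> M \<rightarrow>\<^sub>M config_space"
    using cluster_finite[of i] by (simp add: finite_point_process_def point_process_def)
  then have [measurable]: "(\<lambda>\<omega>. card (C i \<omega> \<inter> {a<..b})) \<in> M \<rightarrow>\<^sub>M count_space UNIV"
    by (rule measurable_compose) (rule measurable_card_Int_config; simp)
  have "Measurable.pred M (\<lambda>\<omega>. card (C i \<omega> \<inter> {a<..b}) = 0)" by measurable
  then show "Measurable.pred M (\<lambda>\<omega>. C i \<omega> \<inter> {a<..b} = {})"
    by (rule iffD1[OF measurable_cong, rotated]) (simp add: finite_C)
qed

end

text \<open>With the absolute value the function of the count is increasing for either sign of
  \<theta>, so positive and negative parameters share one geometric estimate.\<close>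

lemma abs_exp_minus_one_mono:
  fixes \<theta> a b :: real
  assumes "0 \<le> a" "a \<le> b"
  shows "\<bar>exp (\<theta> * a) - 1\<bar> \<le> \<bar>exp (\<theta> * b) - 1\<bar>"
proof (cases "0 \<le> \<theta>")
  case True
  then have "0 \<le> \<theta> * a" "\<theta> * a \<le> \<theta> * b" using assms by (auto intro: mult_left_mono)
  then have "1 \<le> exp (\<theta> * a)" "exp (\<theta> * a) \<le> exp (\<theta> * b)" by auto
  then show ?thesis by linarith
next
  case False
  then have "\<theta> * a \<le> 0" "\<theta> * b \<le> \<theta> * a" using assms by (auto intro: mult_left_mono_neg mult_nonpos_nonneg)
  then have "exp (\<theta> * a) \<le> 1" "exp (\<theta> * b) \<le> exp (\<theta> * a)" by auto
  then show ?thesis by linarith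
qed

section \<open>Size and radius of a typical cluster\<close>

context poisson_cluster_process
begin

lemma measurable_card_C0_Int:
  assumes "B \<in> sets borel" "bounded B"
  shows "(\<lambda>\<omega>. card (C0 \<omega> \<inter> B)) \<in> M \<rightarrow>\<^sub>M count_space UNIV"
  by (rule measurable_compose[OF measurable_C0 measurable_card_Int_config[OF assms]])

text \<open>The \<sigma>-algebra is generated by counts in bounded sets; the total size is a limit
  of counts in growing windows, eventually constant because the cluster is finite.\<close>

lemma measurable_cluster_size [measurable]: "(\<lambda>\<omega>. real (cluster_size C0 \<omega>)) \<in> borel_measurable M"
proof (rule borel_measurable_LIMSEQ_metric)
  show "(\<lambda>\<omega>. real (card (C0 \<omega> \<inter> {- real n..real n}))) \<in> borel_measurable M" for n
    by (rule measurable_compose[OF measurable_card_C0_Int]) auto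
  fix \<omega> assume "\<omega> \<in> space M"
  then have "finite ((\<lambda>y. \<bar>y\<bar>) ` C0 \<omega>)" using finite_C0 by blast
  then obtain b where b: "\<And>y. y \<in> C0 \<omega> \<Longrightarrow> \<bar>y\<bar> \<le> b"
    using bdd_above_finite unfolding bdd_above_def by (metis image_eqI)
  have "eventually (\<lambda>n. b \<le> real n) sequentially"
    using filterlim_real_sequentially by (simp add: filterlim_at_top)
  then have "eventually (\<lambda>n. real (card (C0 \<omega> \<inter> {- real n..real n})) = real (cluster_size C0 \<omega>)) sequentially"
  proof eventually_elim
    case (elim n)
    then have "C0 \<omega> \<inter> {- real n..real n} = C0 \<omega>" using b by (fastforce simp: abs_le_iff)
    then show ?case by (simp only: cluster_size_def)
  qed
  then show "(\<lambda>n. real (card (C0 \<omega> \<inter> {- real n..real n}))) \<longlonglongrightarrow> real (cluster_size C0 \<omega>)"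
    by (rule tendsto_eventually)
qed

lemma abs_le_cluster_radius: "\<omega> \<in> space M \<Longrightarrow> y \<in> C0 \<omega> \<Longrightarrow> \<bar>y\<bar> \<le> cluster_radius C0 \<omega>"
  unfolding cluster_radius_def using finite_C0 by (intro cSUP_upper bdd_above_finite) auto

text \<open>A nonempty cluster has radius at most \<open>a\<close> iff no bounded window sees a
  point of it outside \<open>{- a..a}\<close>. The empty configuration is treated apart: its radius
  is the unspecified value \<open>Sup {}\<close>, and \<open>C0\<close> is known to contain 0 only
  almost surely.\<close>

lemma measurable_cluster_radius [measurable]: "cluster_radius C0 \<in> borel_measurable M"
proof -
  have "{\<omega> \<in> space M. cluster_radius C0 \<omega> \<le> a} \<in> events" for a
  proof -
    define Out where "Out n = {- real n..real n} - {- a..a}" for n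
    have [measurable]: "(\<lambda>\<omega>. card (C0 \<omega> \<inter> Out n)) \<in> M \<rightarrow>\<^sub>M count_space UNIV" for n
      by (rule measurable_card_C0_Int) (auto simp: Out_def intro: bounded_subset[of "{- real n..real n}"])
    have [measurable]: "(\<lambda>\<omega>. card (C0 \<omega> \<inter> {- real n..real n})) \<in> M \<rightarrow>\<^sub>M count_space UNIV" for n
      by (rule measurable_card_C0_Int) auto
    have out: "(\<forall>y\<in>C0 \<omega>. \<bar>y\<bar> \<le> a) \<longleftrightarrow> (\<forall>n. card (C0 \<omega> \<inter> Out n) = 0)" if "\<omega> \<in> space M" for \<omega>
    proof -
      have card0: "(\<forall>n. card (C0 \<omega> \<inter> Out n) = 0) \<longleftrightarrow> (\<forall>n. C0 \<omega> \<inter> Out n = {})"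
        using finite_C0[OF that] by simp
      have "y \<in> {- a..a}" if "y \<in> C0 \<omega>" "\<forall>n. C0 \<omega> \<inter> Out n = {}" for y
      proof -
        obtain n :: nat where "\<bar>y\<bar> \<le> real n" using real_arch_simple by blast
        then have "y \<in> {- real n..real n}" by auto
        with that show ?thesis unfolding Out_def by blast
      qed
      then have "(\<forall>n. C0 \<omega> \<inter> Out n = {}) \<Longrightarrow> \<forall>y\<in>C0 \<omega>. \<bar>y\<bar> \<le> a" by (fastforce simp: abs_le_iff)
      moreover have "C0 \<omega> \<inter> Out n = {}" if "\<forall>y\<in>C0 \<omega>. \<bar>y\<bar> \<le> a" for n
      proof -
        have "y \<in> {- a..a}" if "y \<in> C0 \<omega>" for y
          using \<open>\<forall>y\<in>C0 \<omega>. \<bar>y\<bar> \<le> a\<close>[rule_format, OF that] by auto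
        then show ?thesis by (auto simp: Out_def)
      qed
      ultimately show ?thesis using card0 by blast
    qed
    have empty: "C0 \<omega> = {} \<longleftrightarrow> (\<forall>n. card (C0 \<omega> \<inter> {- real n..real n}) = 0)" if "\<omega> \<in> space M" for \<omega>
    proof -
      have "(\<forall>n. card (C0 \<omega> \<inter> {- real n..real n}) = 0) \<longleftrightarrow> (\<forall>n. C0 \<omega> \<inter> {- real n..real n} = {})"
        using finite_C0[OF that] by simp
      moreover have "\<exists>n. y \<in> {- real n..real n}" for y
      proof -
        obtain n :: nat where "\<bar>y\<bar> \<le> real n" using real_arch_simple by blast
        then have "y \<in> {- real n..real n}" by auto
        then show ?thesis ..
      qed
      ultimately show ?thesis by blast
    qed
    have "cluster_radius C0 \<omega> \<le> a \<longleftrightarrow>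
        (if \<forall>n. card (C0 \<omega> \<inter> {- real n..real n}) = 0 then Sup {} \<le> a else \<forall>n. card (C0 \<omega> \<inter> Out n) = 0)"
      if "\<omega> \<in> space M" for \<omega>
    proof (cases "C0 \<omega> = {}")
      case True
      then show ?thesis by (simp add: cluster_radius_def)
    next
      case False
      have "cluster_radius C0 \<omega> \<le> a \<longleftrightarrow> (\<forall>y\<in>C0 \<omega>. \<bar>y\<bar> \<le> a)"
        unfolding cluster_radius_def using False finite_C0[OF that] by (intro cSUP_le_iff bdd_above_finite) auto
      then show ?thesis unfolding empty[OF that, symmetric] out[OF that, symmetric] using False by simp
    qed
    then have "{\<omega> \<in> space M. cluster_radius C0 \<omega> \<le> a} = {\<omega> \<in> space M.
        (if \<forall>n. card (C0 \<omega> \<inter> {- real n..real n}) = 0 then Sup {} \<le> a else \<forall>n. card (C0 \<omega> \<inter> Out n) = 0)}"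
      by blast
    also have "\<dots> \<in> events" by measurable
    finally show ?thesis .
  qed
  then show ?thesis by (simp add: borel_measurable_iff_le)
qed

lemma AE_cluster_radius_nonneg: "AE \<omega> in M. 0 \<le> cluster_radius C0 \<omega>"
  using AE_zero_in_C0 AE_space by eventually_elim (use abs_le_cluster_radius[of _ 0] in auto)

lemma AE_cluster_size_pos: "AE \<omega> in M. 1 \<le> cluster_size C0 \<omega>"
  using AE_zero_in_C0 AE_space
  by eventually_elim (auto simp: cluster_size_def Suc_le_eq card_gt_0_iff finite_C0)

section \<open>Exponential moments of the number of points\<close>

definition shifted_mgf :: "real \<Rightarrow> real \<Rightarrow> real \<Rightarrow> real" where
  "shifted_mgf \<theta> t x = (\<integral>\<omega>. exp (\<theta> * shifted_count t x (C0 \<omega>)) \<partial>M)"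

definition partial_count :: "real \<Rightarrow> nat \<Rightarrow> 'a \<Rightarrow> real" where
  "partial_count t n \<omega> = (\<Sum>i<n. shifted_count t (X i \<omega>) (Z i \<omega>))"

lemma measurable_shifted_mgf [measurable]: "shifted_mgf \<theta> t \<in> borel_measurable borel"
  unfolding shifted_mgf_def[abs_def] by measurable

lemma measurable_partial_count [measurable]: "partial_count t n \<in> borel_measurable M"
  unfolding partial_count_def[abs_def] by measurable

lemma incseq_partial_count: "m \<le> n \<Longrightarrow> partial_count t m \<omega> \<le> partial_count t n \<omega>"
  unfolding partial_count_def by (rule sum_mono2) auto

lemma integrable_exp_shifted_count:
  assumes "integrable M (\<lambda>\<omega>. exp (\<theta> * real (cluster_size C0 \<omega>)))"
  shows "integrable M (\<lambda>\<omega>. exp (\<theta> * shifted_count t x (C0 \<omega>)))"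
proof (rule Bochner_Integration.integrable_bound)
  \<comment> \<open>The first summand dominates for \<theta> \<ge> 0, the constant 1 for \<theta> <
    0.\<close>
  show "integrable M (\<lambda>\<omega>. exp (\<theta> * real (cluster_size C0 \<omega>)) + 1)" using assms by simp
  show "AE \<omega> in M. norm (exp (\<theta> * shifted_count t x (C0 \<omega>))) \<le> norm (exp (\<theta> * real (cluster_size C0 \<omega>)) + 1)"
    using AE_space
  proof eventually_elim
    case (elim \<omega>)
    have le: "shifted_count t x (C0 \<omega>) \<le> real (cluster_size C0 \<omega>)"
      unfolding cluster_size_def by (rule shifted_count_le_card[OF finite_C0[OF elim]])
    have "exp (\<theta> * shifted_count t x (C0 \<omega>)) \<le> exp (\<theta> * real (cluster_size C0 \<omega>)) + 1"
    proof (cases "0 \<le> \<theta>")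
      case True
      then have "exp (\<theta> * shifted_count t x (C0 \<omega>)) \<le> exp (\<theta> * real (cluster_size C0 \<omega>))"
        using le by (simp add: mult_left_mono)
      then show ?thesis by linarith
    next
      case False
      then have "exp (\<theta> * shifted_count t x (C0 \<omega>)) \<le> 1" by (simp add: mult_nonpos_nonneg)
      then show ?thesis using exp_gt_zero[of "\<theta> * real (cluster_size C0 \<omega>)"] by linarith
    qed
    then show ?case by (simp add: abs_of_pos add_pos_pos)
  qed
qed simp

text \<open>With the immigrants frozen, the factors belong to independent clusters with the law of
  \<open>C0\<close>, and each integrates to \<open>shifted_mgf\<close> at the position of its
  immigrant.\<close>

lemma nn_integral_exp_partial_count:
  assumes int: "integrable M (\<lambda>\<omega>. exp (\<theta> * real (cluster_size C0 \<omega>)))"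
  shows "(\<integral>\<^sup>+\<omega>. ennreal (exp (\<theta> * partial_count t n \<omega>)) \<partial>M)
      = (\<integral>\<^sup>+\<omega>. ennreal (\<Prod>i<n. shifted_mgf \<theta> t (X i \<omega>)) \<partial>M)"
proof -
  define F where "F p = (\<Prod>i<n. ennreal (exp (\<theta> * shifted_count t (fst p i) (snd p i))))"
    for p :: "(nat \<Rightarrow> real) \<times> (nat \<Rightarrow> real set)"
  have F_meas: "F \<in> borel_measurable (immigrants_space \<Otimes>\<^sub>M clusters_space)"
    unfolding F_def[abs_def] by measurable
  have "(\<integral>\<^sup>+\<omega>. ennreal (exp (\<theta> * partial_count t n \<omega>)) \<partial>M) = (\<integral>\<^sup>+\<omega>. F (\<lambda>i. X i \<omega>, \<lambda>i. Z i \<omega>) \<partial>M)"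
    by (intro nn_integral_cong) (simp add: F_def partial_count_def sum_distrib_left exp_sum prod_ennreal)
  also have "\<dots> = (\<integral>\<^sup>+\<omega>'. \<integral>\<^sup>+\<omega>. F (\<lambda>i. X i \<omega>', \<lambda>i. Z i \<omega>) \<partial>M \<partial>M)"
    by (rule nn_integral_immigrants_clusters(1)[OF F_meas])
  also have "\<dots> = (\<integral>\<^sup>+\<omega>'. ennreal (\<Prod>i<n. shifted_mgf \<theta> t (X i \<omega>')) \<partial>M)"
  proof (intro nn_integral_cong)
    fix \<omega>'
    have meas: "(\<lambda>z. ennreal (exp (\<theta> * shifted_count t x z))) \<in> borel_measurable config_space" for x
      by measurable
    have "(\<integral>\<^sup>+\<omega>. F (\<lambda>i. X i \<omega>', \<lambda>i. Z i \<omega>) \<partial>M)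
        = (\<Prod>i<n. \<integral>\<^sup>+\<omega>. ennreal (exp (\<theta> * shifted_count t (X i \<omega>') (Z i \<omega>))) \<partial>M)"
      unfolding F_def fst_conv snd_conv
    proof (rule indep_vars_nn_integral)
      show "indep_vars (\<lambda>_. borel) (\<lambda>i \<omega>. ennreal (exp (\<theta> * shifted_count t (X i \<omega>') (Z i \<omega>)))) {..<n}"
        by (rule indep_vars_compose2[OF indep_vars_subset[OF centered_indep],
              where Y="\<lambda>i z. ennreal (exp (\<theta> * shifted_count t (X i \<omega>') z))"]) (auto intro: meas)
    qed auto
    also have "\<dots> = (\<Prod>i<n. ennreal (shifted_mgf \<theta> t (X i \<omega>')))"
    proof (intro prod.cong refl)
      fix i
      have "(\<integral>\<^sup>+\<omega>. ennreal (exp (\<theta> * shifted_count t (X i \<omega>') (Z i \<omega>))) \<partial>M)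
          = (\<integral>\<^sup>+\<omega>. ennreal (exp (\<theta> * shifted_count t (X i \<omega>') (C0 \<omega>))) \<partial>M)"
        by (rule nn_integral_Z_eq_C0[OF meas])
      also have "\<dots> = ennreal (shifted_mgf \<theta> t (X i \<omega>'))"
        unfolding shifted_mgf_def by (intro nn_integral_eq_integral integrable_exp_shifted_count int) auto
      finally show "(\<integral>\<^sup>+\<omega>. ennreal (exp (\<theta> * shifted_count t (X i \<omega>') (Z i \<omega>))) \<partial>M)
          = ennreal (shifted_mgf \<theta> t (X i \<omega>'))" .
    qed
    also have "\<dots> = ennreal (\<Prod>i<n. shifted_mgf \<theta> t (X i \<omega>'))"
      by (rule prod_ennreal) (simp add: shifted_mgf_def)
    finally show "(\<integral>\<^sup>+\<omega>. F (\<lambda>i. X i \<omega>', \<lambda>i. Z i \<omega>) \<partial>M) = ennreal (\<Prod>i<n. shifted_mgf \<theta> t (X i \<omega>'))" .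
  qed
  finally show ?thesis .
qed

text \<open>The integrand \<open>exp (\<theta> * k) - 1\<close> does not change sign as the count
  \<open>k\<close> varies, so the absolute value passes through the integral.\<close>

lemma abs_shifted_mgf_minus_one:
  assumes int: "integrable M (\<lambda>\<omega>. exp (\<theta> * real (cluster_size C0 \<omega>)))"
  shows "\<bar>shifted_mgf \<theta> t x - 1\<bar> = (\<integral>\<omega>. \<bar>exp (\<theta> * shifted_count t x (C0 \<omega>)) - 1\<bar> \<partial>M)"
    and "0 \<le> \<theta> \<Longrightarrow> 1 \<le> shifted_mgf \<theta> t x" and "\<theta> \<le> 0 \<Longrightarrow> shifted_mgf \<theta> t x \<le> 1"
proof -
  note int' = integrable_exp_shifted_count[OF int, of t x]
  define I where "I = (\<integral>\<omega>. \<bar>exp (\<theta> * shifted_count t x (C0 \<omega>)) - 1\<bar> \<partial>M)"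
  have nonneg: "0 \<le> I" unfolding I_def by simp
  have diff: "shifted_mgf \<theta> t x - 1 = (\<integral>\<omega>. exp (\<theta> * shifted_count t x (C0 \<omega>)) - 1 \<partial>M)"
    unfolding shifted_mgf_def using int' by (simp add: prob_space)
  have pos: "shifted_mgf \<theta> t x - 1 = I" if "0 \<le> \<theta>"
    unfolding diff I_def using that by (intro Bochner_Integration.integral_cong) auto
  have neg: "shifted_mgf \<theta> t x - 1 = - I" if "\<theta> \<le> 0"
    unfolding diff I_def integral_minus[symmetric] using that
    by (intro Bochner_Integration.integral_cong) (auto simp: mult_nonpos_nonneg abs_of_nonpos)
  show "0 \<le> \<theta> \<Longrightarrow> 1 \<le> shifted_mgf \<theta> t x" using pos nonneg by linarith
  show "\<theta> \<le> 0 \<Longrightarrow> shifted_mgf \<theta> t x \<le> 1" using neg nonneg by linarith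
  show "\<bar>shifted_mgf \<theta> t x - 1\<bar> = (\<integral>\<omega>. \<bar>exp (\<theta> * shifted_count t x (C0 \<omega>)) - 1\<bar> \<partial>M)"
    unfolding I_def[symmetric] using pos neg nonneg by (cases "0 \<le> \<theta>") auto
qed

text \<open>The clusters that are only partly seen in \<open>(0, t]\<close> contribute at most \<open>\<kappa>\<close>, uniformly in \<open>t\<close>.\<close>

lemma shifted_mgf_asymptotics:
  assumes int: "integrable M (\<lambda>\<omega>. exp (\<theta> * real (cluster_size C0 \<omega>)))"
    and radius: "(\<integral>\<^sup>+\<omega>. ennreal (cluster_radius C0 \<omega> * exp (\<theta> * real (cluster_size C0 \<omega>))) \<partial>M) < \<infinity>"
    and radius0: "(\<integral>\<^sup>+\<omega>. ennreal (cluster_radius C0 \<omega>) \<partial>M) < \<infinity>"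
  shows "\<exists>\<kappa>. \<forall>t>0. integrable lborel (\<lambda>x. shifted_mgf \<theta> t x - 1) \<and>
    \<bar>(\<integral>x. shifted_mgf \<theta> t x - 1 \<partial>lborel) - t * ((\<integral>\<omega>. exp (\<theta> * real (cluster_size C0 \<omega>)) \<partial>M) - 1)\<bar> \<le> \<kappa>"
proof -
  \<comment> \<open>Absolute values make Tonelli available for both signs of \<theta>; the sign is
    put back in the final case distinction.\<close>
  define h where "h w = \<bar>exp (\<theta> * w) - 1\<bar>" for w :: real
  define S where "S \<omega> = real (cluster_size C0 \<omega>)" for \<omega>
  define L where "L \<omega> = cluster_radius C0 \<omega>" for \<omega>
  define a where "a = (\<integral>\<omega>. h (S \<omega>) \<partial>M)"
  have [measurable]: "S \<in> borel_measurable M" "L \<in> borel_measurable M" "h \<in> borel_measurable borel"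
    unfolding S_def[abs_def] L_def[abs_def] h_def[abs_def] by measurable
  have h_nonneg: "0 \<le> h w" for w by (simp add: h_def)
  have int_h: "integrable M (\<lambda>\<omega>. h (S \<omega>))" using int unfolding h_def S_def by (intro integrable_abs) simp
  have a_nonneg: "0 \<le> a" unfolding a_def using h_nonneg by (intro Bochner_Integration.integral_nonneg) auto
  have ae_L: "AE \<omega> in M. 0 \<le> L \<omega>" using AE_cluster_radius_nonneg by (simp add: L_def)
  have "(\<integral>\<^sup>+\<omega>. ennreal (h (S \<omega>) * (2 * L \<omega>)) \<partial>M)
      \<le> (\<integral>\<^sup>+\<omega>. 2 * (ennreal (L \<omega> * exp (\<theta> * S \<omega>)) + ennreal (L \<omega>)) \<partial>M)"
  proof (rule nn_integral_mono_AE)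
    show "AE \<omega> in M. ennreal (h (S \<omega>) * (2 * L \<omega>)) \<le> 2 * (ennreal (L \<omega> * exp (\<theta> * S \<omega>)) + ennreal (L \<omega>))"
      using ae_L
    proof eventually_elim
      case (elim \<omega>)
      \<comment> \<open>This splits the boundary term into the two radius moments
        \<open>radius\<close> and \<open>radius0\<close>.\<close>
      have "h (S \<omega>) \<le> exp (\<theta> * S \<omega>) + 1" unfolding h_def using exp_gt_zero[of "\<theta> * S \<omega>"] by linarith
      then have "h (S \<omega>) * (2 * L \<omega>) \<le> (exp (\<theta> * S \<omega>) + 1) * (2 * L \<omega>)"
        using elim by (intro mult_right_mono) auto
      also have "\<dots> = 2 * (L \<omega> * exp (\<theta> * S \<omega>) + L \<omega>)" by (simp add: algebra_simps)
      finally have "ennreal (h (S \<omega>) * (2 * L \<omega>)) \<le> ennreal (2 * (L \<omega> * exp (\<theta> * S \<omega>) + L \<omega>))"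
        by (rule ennreal_leI)
      also have "\<dots> = 2 * (ennreal (L \<omega> * exp (\<theta> * S \<omega>)) + ennreal (L \<omega>))"
        using elim by (simp add: ennreal_mult')
      finally show ?case .
    qed
  qed
  also have "\<dots> = 2 * ((\<integral>\<^sup>+\<omega>. ennreal (L \<omega> * exp (\<theta> * S \<omega>)) \<partial>M) + (\<integral>\<^sup>+\<omega>. ennreal (L \<omega>) \<partial>M))"
    by (simp add: nn_integral_cmult nn_integral_add)
  also have "\<dots> < \<infinity>"
    using radius radius0 by (simp add: S_def L_def ennreal_mult_less_top)
  finally have fin: "(\<integral>\<^sup>+\<omega>. ennreal (h (S \<omega>) * (2 * L \<omega>)) \<partial>M) < \<infinity>" .
  \<comment> \<open>The factor \<open>2 * L\<close> is the measure of the immigrant positions gained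
    or lost at the two ends of the window; it does not involve \<open>t\<close>.\<close>
  define \<kappa> where "\<kappa> = enn2real (\<integral>\<^sup>+\<omega>. ennreal (h (S \<omega>) * (2 * L \<omega>)) \<partial>M)"
  have \<kappa>: "(\<integral>\<^sup>+\<omega>. ennreal (h (S \<omega>) * (2 * L \<omega>)) \<partial>M) = ennreal \<kappa>" "0 \<le> \<kappa>"
    using fin by (auto simp: \<kappa>_def)
  have nn_a: "(\<integral>\<^sup>+\<omega>. ennreal (h (S \<omega>)) \<partial>M) = ennreal a"
    unfolding a_def using h_nonneg by (intro nn_integral_eq_integral int_h) auto
  have main: "integrable lborel (\<lambda>x. shifted_mgf \<theta> t x - 1) \<and>
    \<bar>(\<integral>x. shifted_mgf \<theta> t x - 1 \<partial>lborel) - t * ((\<integral>\<omega>. exp (\<theta> * real (cluster_size C0 \<omega>)) \<partial>M) - 1)\<bar> \<le> \<kappa>"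
    if t: "0 < t" for t
  proof -
    have "(\<lambda>p. ennreal (h (shifted_count t (fst p) (C0 (snd p))))) \<in> borel_measurable (lborel \<Otimes>\<^sub>M M)"
      by measurable
    then have meas: "case_prod (\<lambda>x \<omega>. ennreal (h (shifted_count t x (C0 \<omega>)))) \<in> borel_measurable (lborel \<Otimes>\<^sub>M M)"
      by (simp add: case_prod_unfold)
    interpret LM: pair_sigma_finite lborel M ..
    define A where "A = (\<integral>\<^sup>+x. ennreal \<bar>shifted_mgf \<theta> t x - 1\<bar> \<partial>lborel)"
    have "A = (\<integral>\<^sup>+x. \<integral>\<^sup>+\<omega>. ennreal (h (shifted_count t x (C0 \<omega>))) \<partial>M \<partial>lborel)"
      unfolding A_def
    proof (intro nn_integral_cong)
      fix x
      have "integrable M (\<lambda>\<omega>. h (shifted_count t x (C0 \<omega>)))"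
        unfolding h_def using integrable_exp_shifted_count[OF int] by (intro integrable_abs) simp
      then show "ennreal \<bar>shifted_mgf \<theta> t x - 1\<bar> = (\<integral>\<^sup>+\<omega>. ennreal (h (shifted_count t x (C0 \<omega>))) \<partial>M)"
        unfolding abs_shifted_mgf_minus_one(1)[OF int] using h_nonneg
        by (subst nn_integral_eq_integral) (auto simp: h_def)
    qed
    also have "\<dots> = (\<integral>\<^sup>+\<omega>. \<integral>\<^sup>+x. ennreal (h (shifted_count t x (C0 \<omega>))) \<partial>lborel \<partial>M)"
      by (rule LM.Fubini'[OF meas, symmetric])
    finally have A: "A = (\<integral>\<^sup>+\<omega>. \<integral>\<^sup>+x. ennreal (h (shifted_count t x (C0 \<omega>))) \<partial>lborel \<partial>M)" .
    have bounds: "AE \<omega> in M. (\<integral>\<^sup>+x. ennreal (h (shifted_count t x (C0 \<omega>))) \<partial>lborel) \<le> ennreal (h (S \<omega>) * (t + 2 * L \<omega>))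
        \<and> ennreal (h (S \<omega>) * (t - 2 * L \<omega>)) \<le> (\<integral>\<^sup>+x. ennreal (h (shifted_count t x (C0 \<omega>))) \<partial>lborel)"
      using ae_L AE_space
    proof eventually_elim
      case (elim \<omega>)
      have "\<bar>y\<bar> \<le> L \<omega>" if "y \<in> C0 \<omega>" for y unfolding L_def by (rule abs_le_cluster_radius[OF elim(2) that])
      moreover have "h 0 = 0" by (simp add: h_def)
      moreover have "h u \<le> h v" if "0 \<le> u" "u \<le> v" for u v unfolding h_def by (rule abs_exp_minus_one_mono[OF that])
      ultimately show ?case
        using nn_integral_shifted_count_bounds[OF finite_C0[OF elim(2)] _ elim(1), of h t] t
        unfolding S_def cluster_size_def by auto
    qed
    have "A \<le> (\<integral>\<^sup>+\<omega>. ennreal t * ennreal (h (S \<omega>)) + ennreal (h (S \<omega>) * (2 * L \<omega>)) \<partial>M)"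
      unfolding A
    proof (rule nn_integral_mono_AE)
      show "AE \<omega> in M. (\<integral>\<^sup>+x. ennreal (h (shifted_count t x (C0 \<omega>))) \<partial>lborel)
          \<le> ennreal t * ennreal (h (S \<omega>)) + ennreal (h (S \<omega>) * (2 * L \<omega>))"
        using bounds ae_L
      proof eventually_elim
        case (elim \<omega>)
        have "ennreal (h (S \<omega>) * (t + 2 * L \<omega>)) = ennreal (t * h (S \<omega>) + h (S \<omega>) * (2 * L \<omega>))"
          by (simp add: algebra_simps)
        also have "\<dots> = ennreal t * ennreal (h (S \<omega>)) + ennreal (h (S \<omega>) * (2 * L \<omega>))"
          using t h_nonneg elim(2) by (subst ennreal_plus) (auto simp: ennreal_mult)
        finally show ?case using elim(1) by simp
      qed
    qed
    also have "\<dots> = ennreal t * ennreal a + ennreal \<kappa>"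
      by (simp add: nn_integral_add nn_integral_cmult nn_a \<kappa>(1))
    also have "\<dots> = ennreal (t * a + \<kappa>)" using t a_nonneg \<kappa>(2) by (simp add: ennreal_mult)
    finally have A_le: "A \<le> ennreal (t * a + \<kappa>)" .
    then have A_fin: "A < \<infinity>" by (simp add: order_le_less_trans)
    \<comment> \<open>For the lower estimate the boundary term is added on the larger side, because
      \<open>ennreal\<close> truncates at 0 the negative values that arise when
      \<open>t < 2 * L\<close>.\<close>
    have "ennreal (t * a) = (\<integral>\<^sup>+\<omega>. ennreal (t * h (S \<omega>)) \<partial>M)"
      using t by (simp add: ennreal_mult' nn_integral_cmult nn_a)
    also have "\<dots> \<le> (\<integral>\<^sup>+\<omega>. (\<integral>\<^sup>+x. ennreal (h (shifted_count t x (C0 \<omega>))) \<partial>lborel) + ennreal (h (S \<omega>) * (2 * L \<omega>)) \<partial>M)"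
    proof (rule nn_integral_mono_AE)
      show "AE \<omega> in M. ennreal (t * h (S \<omega>))
          \<le> (\<integral>\<^sup>+x. ennreal (h (shifted_count t x (C0 \<omega>))) \<partial>lborel) + ennreal (h (S \<omega>) * (2 * L \<omega>))"
        using bounds ae_L
      proof eventually_elim
        case (elim \<omega>)
        have "ennreal (t * h (S \<omega>)) = ennreal (h (S \<omega>) * (t - 2 * L \<omega>) + h (S \<omega>) * (2 * L \<omega>))"
          by (simp add: algebra_simps)
        also have "\<dots> \<le> ennreal (h (S \<omega>) * (t - 2 * L \<omega>)) + ennreal (h (S \<omega>) * (2 * L \<omega>))"
        proof -
          have "0 \<le> h (S \<omega>) * (2 * L \<omega>)" using h_nonneg elim(2) by simp
          moreover have "ennreal (u + v) \<le> ennreal u + ennreal v" if "0 \<le> v" for u v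
          proof (cases "0 \<le> u")
            case False
            then have "ennreal (u + v) \<le> ennreal v" by (intro ennreal_leI) simp
            with False show ?thesis by (simp add: ennreal_neg)
          qed (use that in \<open>simp add: ennreal_plus\<close>)
          ultimately show ?thesis by blast
        qed
        also have "\<dots> \<le> (\<integral>\<^sup>+x. ennreal (h (shifted_count t x (C0 \<omega>))) \<partial>lborel) + ennreal (h (S \<omega>) * (2 * L \<omega>))"
          using elim(1) by (intro add_right_mono) auto
        finally show ?case .
      qed
    qed
    also have "\<dots> = A + ennreal \<kappa>"
      unfolding A \<kappa>(1)[symmetric]
      by (rule nn_integral_add) measurable
    finally have A_ge: "ennreal (t * a) \<le> A + ennreal \<kappa>" .
    have int_g: "integrable lborel (\<lambda>x. shifted_mgf \<theta> t x - 1)"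
      using A_fin unfolding A_def by (intro integrableI_bounded) auto
    define I where "I = (\<integral>x. \<bar>shifted_mgf \<theta> t x - 1\<bar> \<partial>lborel)"
    have AI: "A = ennreal I" unfolding A_def I_def by (intro nn_integral_eq_integral integrable_abs int_g) auto
    have I_nonneg: "0 \<le> I" unfolding I_def by simp
    have "I \<le> t * a + \<kappa>"
      using A_le t a_nonneg \<kappa>(2) unfolding AI by (subst (asm) ennreal_le_iff) auto
    moreover have "t * a \<le> I + \<kappa>"
      using A_ge I_nonneg \<kappa>(2) unfolding AI by (simp add: ennreal_plus[symmetric] del: ennreal_plus)
    ultimately have close: "\<bar>I - t * a\<bar> \<le> \<kappa>" by linarith
    have mean: "(\<integral>\<omega>. exp (\<theta> * S \<omega>) \<partial>M) - 1 = (\<integral>\<omega>. exp (\<theta> * S \<omega>) - 1 \<partial>M)"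
      using int by (simp add: S_def prob_space)
    show ?thesis
    proof (cases "0 \<le> \<theta>")
      case True
      have "(\<integral>x. shifted_mgf \<theta> t x - 1 \<partial>lborel) = I"
        unfolding I_def using abs_shifted_mgf_minus_one(2)[OF int True] by (intro Bochner_Integration.integral_cong) auto
      moreover have "(\<integral>\<omega>. exp (\<theta> * S \<omega>) - 1 \<partial>M) = a"
        unfolding a_def h_def using True by (intro Bochner_Integration.integral_cong) (auto simp: S_def)
      ultimately show ?thesis using int_g close mean by (simp add: S_def)
    next
      case False
      then have neg: "\<theta> \<le> 0" by simp
      have "(\<integral>x. shifted_mgf \<theta> t x - 1 \<partial>lborel) = (\<integral>x. - \<bar>shifted_mgf \<theta> t x - 1\<bar> \<partial>lborel)"
        using abs_shifted_mgf_minus_one(3)[OF int neg] by (intro Bochner_Integration.integral_cong) auto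
      then have "(\<integral>x. shifted_mgf \<theta> t x - 1 \<partial>lborel) = - I" by (simp add: I_def)
      moreover have "(\<integral>\<omega>. exp (\<theta> * S \<omega>) - 1 \<partial>M) = (\<integral>\<omega>. - h (S \<omega>) \<partial>M)"
        unfolding h_def using neg by (intro Bochner_Integration.integral_cong) (auto simp: S_def mult_nonpos_nonneg)
      then have "(\<integral>\<omega>. exp (\<theta> * S \<omega>) - 1 \<partial>M) = - a" by (simp add: a_def)
      ultimately show ?thesis using int_g close mean by (simp add: S_def abs_minus_commute)
    qed
  qed
  then show ?thesis by blast
qed

text \<open>Every cluster that meets the window adds at least 1 to the partial counts, so
  boundedness leaves only finitely many of them. Beyond the last one the partial counts are
  stationary, and disjointness turns their value into the cardinality of the union.\<close>

lemma eventually_partial_count_eq: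
  assumes \<omega>: "\<omega> \<in> space M"
    and disj: "\<And>i j. i \<noteq> j \<Longrightarrow> C i \<omega> \<inter> C j \<omega> \<inter> {0<..t} = {}"
    and bound: "\<And>n. partial_count t n \<omega> \<le> b"
  shows "eventually (\<lambda>n. partial_count t n \<omega> = real (card (cluster_process C \<omega> \<inter> {0<..t}))) sequentially"
proof -
  define Hit where "Hit = {i. C i \<omega> \<inter> {0<..t} \<noteq> {}}"
  have count: "shifted_count t (X i \<omega>) (Z i \<omega>) = real (card (C i \<omega> \<inter> {0<..t}))" for i
    by (rule card_C_Int[symmetric])
  have "finite Hit"
  proof (rule ccontr)
    assume "infinite Hit"
    obtain k :: nat where k: "b < real k" using reals_Archimedean2 by blast
    obtain F where F: "F \<subseteq> Hit" "finite F" "card F = k"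
      using infinite_arbitrarily_large[OF \<open>infinite Hit\<close>] by metis
    obtain n where n: "F \<subseteq> {..<n}" using F(2) finite_nat_iff_bounded by blast
    have "real k = (\<Sum>i\<in>F. 1)" using F by simp
    also have "\<dots> \<le> (\<Sum>i\<in>F. shifted_count t (X i \<omega>) (Z i \<omega>))"
    proof (rule sum_mono)
      fix i assume "i \<in> F"
      then have "card (C i \<omega> \<inter> {0<..t}) \<noteq> 0" using F(1) finite_C[OF \<omega>, of i] by (auto simp: Hit_def)
      then have "1 \<le> card (C i \<omega> \<inter> {0<..t})" by simp
      then show "1 \<le> shifted_count t (X i \<omega>) (Z i \<omega>)" unfolding count by simp
    qed
    also have "\<dots> \<le> partial_count t n \<omega>"
      unfolding partial_count_def using n by (intro sum_mono2) auto
    finally show False using bound[of n] k by simp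
  qed
  then obtain N where N: "Hit \<subseteq> {..<N}" using finite_nat_iff_bounded by blast
  show ?thesis using eventually_ge_at_top[of N]
  proof eventually_elim
    case (elim n)
    have "C i \<omega> \<inter> {0<..t} = {}" if "i \<notin> {..<n}" for i
      using that N elim by (fastforce simp: Hit_def)
    then have "cluster_process C \<omega> \<inter> {0<..t} = (\<Union>i\<in>{..<n}. C i \<omega> \<inter> {0<..t})"
      unfolding cluster_process_def by blast
    moreover have "card (\<Union>i\<in>{..<n}. C i \<omega> \<inter> {0<..t}) = (\<Sum>i<n. card (C i \<omega> \<inter> {0<..t}))"
      using disj finite_C[OF \<omega>] by (intro card_UN_disjoint) auto
    ultimately show ?case by (simp add: partial_count_def count)
  qed
qed

lemma SUP_nn_integral_exp_partial_count:
  assumes "0 \<le> \<theta>"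
    and int: "integrable M (\<lambda>\<omega>. exp (\<theta> * real (cluster_size C0 \<omega>)))"
    and int_mgf: "integrable lborel (\<lambda>x. shifted_mgf \<theta> t x - 1)"
  shows "(\<integral>\<^sup>+\<omega>. (SUP n. ennreal (exp (\<theta> * partial_count t n \<omega>))) \<partial>M)
      = ennreal (exp (\<nu> * (\<integral>x. shifted_mgf \<theta> t x - 1 \<partial>lborel)))"
proof -
  have "incseq (\<lambda>n \<omega>. ennreal (exp (\<theta> * partial_count t n \<omega>)))"
    by (intro incseq_SucI le_funI ennreal_leI) (simp add: incseq_partial_count assms(1) mult_left_mono)
  then have "(\<integral>\<^sup>+\<omega>. (SUP n. ennreal (exp (\<theta> * partial_count t n \<omega>))) \<partial>M)
      = (SUP n. \<integral>\<^sup>+\<omega>. ennreal (exp (\<theta> * partial_count t n \<omega>)) \<partial>M)"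
    by (intro nn_integral_monotone_convergence_SUP) auto
  also have "\<dots> = (SUP n. \<integral>\<^sup>+\<omega>. ennreal (\<Prod>i<n. shifted_mgf \<theta> t (X i \<omega>)) \<partial>M)"
    by (simp only: nn_integral_exp_partial_count[OF int])
  also have "\<dots> = ennreal (exp (\<nu> * (\<integral>x. shifted_mgf \<theta> t x - 1 \<partial>lborel)))"
    by (rule points.SUP_nn_integral_prod_points[OF measurable_shifted_mgf abs_shifted_mgf_minus_one(2)[OF int assms(1)] int_mgf])
  finally show ?thesis .
qed

lemma INF_nn_integral_exp_partial_count:
  assumes "\<theta> \<le> 0"
    and int: "integrable M (\<lambda>\<omega>. exp (\<theta> * real (cluster_size C0 \<omega>)))"
    and int_mgf: "integrable lborel (\<lambda>x. shifted_mgf \<theta> t x - 1)"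
  shows "(\<integral>\<^sup>+\<omega>. (INF n. ennreal (exp (\<theta> * partial_count t n \<omega>))) \<partial>M)
      = ennreal (exp (\<nu> * (\<integral>x. shifted_mgf \<theta> t x - 1 \<partial>lborel)))"
proof -
  have dec: "decseq (\<lambda>n \<omega>. ennreal (exp (\<theta> * partial_count t n \<omega>)))"
    by (intro decseq_SucI le_funI ennreal_leI) (simp add: incseq_partial_count assms(1) mult_left_mono_neg)
  have "(\<integral>\<^sup>+\<omega>. (INF n. ennreal (exp (\<theta> * partial_count t n \<omega>))) \<partial>M)
      = (INF n. \<integral>\<^sup>+\<omega>. ennreal (exp (\<theta> * partial_count t n \<omega>)) \<partial>M)"
  proof (rule nn_integral_monotone_convergence_INF_decseq[OF dec])
    show "(\<integral>\<^sup>+\<omega>. ennreal (exp (\<theta> * partial_count t 0 \<omega>)) \<partial>M) < \<infinity>"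
      by (simp add: partial_count_def emeasure_space_1)
  qed measurable
  also have "\<dots> = (INF n. \<integral>\<^sup>+\<omega>. ennreal (\<Prod>i<n. shifted_mgf \<theta> t (X i \<omega>)) \<partial>M)"
    by (simp only: nn_integral_exp_partial_count[OF int])
  also have "\<dots> = ennreal (exp (- (\<nu> * (\<integral>x. 1 - shifted_mgf \<theta> t x \<partial>lborel))))"
  proof (rule points.INF_nn_integral_prod_points[OF measurable_shifted_mgf _ abs_shifted_mgf_minus_one(3)[OF int assms(1)]])
    show "integrable lborel (\<lambda>x. 1 - shifted_mgf \<theta> t x)"
      using integrable_minus[OF int_mgf] by simp
  qed (simp add: shifted_mgf_def)
  also have "(\<integral>x. 1 - shifted_mgf \<theta> t x \<partial>lborel) = - (\<integral>x. shifted_mgf \<theta> t x - 1 \<partial>lborel)"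
    by (subst integral_minus[symmetric]) simp
  finally show ?thesis by simp
qed

text \<open>At a positive parameter the supremum of the exponentials has finite mean, so the partial
  counts are almost surely bounded. At a nonpositive one the exponentials never exceed 1 and say
  nothing about boundedness.\<close>

lemma AE_eventually_partial_count:
  assumes "0 < \<theta>"
    and int: "integrable M (\<lambda>\<omega>. exp (\<theta> * real (cluster_size C0 \<omega>)))"
    and int_mgf: "integrable lborel (\<lambda>x. shifted_mgf \<theta> t x - 1)"
  shows "AE \<omega> in M. eventually (\<lambda>n. partial_count t n \<omega> = real (card (cluster_process C \<omega> \<inter> {0<..t}))) sequentially"
proof -
  have "(\<integral>\<^sup>+\<omega>. (SUP n. ennreal (exp (\<theta> * partial_count t n \<omega>))) \<partial>M) \<noteq> \<infinity>"
    using SUP_nn_integral_exp_partial_count[OF less_imp_le[OF assms(1)] int int_mgf] by simp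
  then have "AE \<omega> in M. (SUP n. ennreal (exp (\<theta> * partial_count t n \<omega>))) \<noteq> \<infinity>"
    by (intro nn_integral_PInf_AE) auto
  moreover have "AE \<omega> in M. \<forall>i j. i \<noteq> j \<longrightarrow> C i \<omega> \<inter> C j \<omega> \<inter> {0<..t} = {}"
  proof -
    have "AE \<omega> in M. i \<noteq> j \<longrightarrow> C i \<omega> \<inter> C j \<omega> \<inter> {0<..t} = {}" for i j
      using AE_clusters_disjoint[of i j t] by (cases "i = j") auto
    then show ?thesis by (simp add: AE_all_countable)
  qed
  ultimately show ?thesis
    using AE_space
  proof eventually_elim
    case (elim \<omega>)
    define m where "m = enn2real (SUP n. ennreal (exp (\<theta> * partial_count t n \<omega>)))"
    have m: "(SUP n. ennreal (exp (\<theta> * partial_count t n \<omega>))) = ennreal m"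
      unfolding m_def by (rule ennreal_enn2real[symmetric]) (use elim(1) in \<open>simp only: less_top infinity_ennreal_def\<close>)
    have "partial_count t n \<omega> \<le> m / \<theta>" for n
    proof -
      have "ennreal (exp (\<theta> * partial_count t n \<omega>)) \<le> ennreal m"
        unfolding m[symmetric] by (rule SUP_upper) simp
      then have "exp (\<theta> * partial_count t n \<omega>) \<le> m"
        by (subst (asm) ennreal_le_iff) (simp_all add: m_def)
      \<comment> \<open>From \<open>1 + y \<le> exp y\<close>: a crude linear bound is enough for
        boundedness.\<close>
      then have "\<theta> * partial_count t n \<omega> \<le> m" using exp_ge_add_one_self[of "\<theta> * partial_count t n \<omega>"] by linarith
      then show ?thesis using assms(1) by (simp add: pos_le_divide_eq mult.commute)
    qed
    with elim(2) show ?case by (intro eventually_partial_count_eq[OF elim(3)]) auto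
  qed
qed

text \<open>Stabilization \<open>ev\<close> is a hypothesis of its own because it stems from a
  positive parameter, possibly different from \<theta>. Given it, the limit is a supremum or an
  infimum according to the sign of \<theta>.\<close>

lemma integral_exp_count:
  assumes int: "integrable M (\<lambda>\<omega>. exp (\<theta> * real (cluster_size C0 \<omega>)))"
    and int_mgf: "integrable lborel (\<lambda>x. shifted_mgf \<theta> t x - 1)"
    and ev: "AE \<omega> in M. eventually (\<lambda>n. partial_count t n \<omega> = real (card (cluster_process C \<omega> \<inter> {0<..t}))) sequentially"
  shows "(\<integral>\<omega>. exp (\<theta> * real (card (cluster_process C \<omega> \<inter> {0<..t}))) \<partial>M)
      = exp (\<nu> * (\<integral>x. shifted_mgf \<theta> t x - 1 \<partial>lborel))"
proof -
  let ?R = "\<lambda>\<omega>. real (card (cluster_process C \<omega> \<inter> {0<..t}))"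
  have [measurable]: "?R \<in> borel_measurable M" by (rule borel_measurable_card_cluster_process)
  have lim: "AE \<omega> in M. (\<lambda>n. ennreal (exp (\<theta> * partial_count t n \<omega>))) \<longlonglongrightarrow> ennreal (exp (\<theta> * ?R \<omega>))"
    using ev by eventually_elim (auto intro!: tendsto_eventually elim!: eventually_mono)
  have "(\<integral>\<^sup>+\<omega>. ennreal (exp (\<theta> * ?R \<omega>)) \<partial>M) = ennreal (exp (\<nu> * (\<integral>x. shifted_mgf \<theta> t x - 1 \<partial>lborel)))"
  proof (cases "0 \<le> \<theta>")
    case True
    have "AE \<omega> in M. ennreal (exp (\<theta> * ?R \<omega>)) = (SUP n. ennreal (exp (\<theta> * partial_count t n \<omega>)))"
      using lim
    proof eventually_elim
      case (elim \<omega>)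
      have "incseq (\<lambda>n. ennreal (exp (\<theta> * partial_count t n \<omega>)))"
        by (intro incseq_SucI ennreal_leI) (simp add: incseq_partial_count True mult_left_mono)
      then show ?case using LIMSEQ_unique[OF elim LIMSEQ_SUP] by simp
    qed
    then show ?thesis
      using SUP_nn_integral_exp_partial_count[OF True int int_mgf] by (simp cong: nn_integral_cong_AE)
  next
    case False
    then have neg: "\<theta> \<le> 0" by simp
    have "AE \<omega> in M. ennreal (exp (\<theta> * ?R \<omega>)) = (INF n. ennreal (exp (\<theta> * partial_count t n \<omega>)))"
      using lim
    proof eventually_elim
      case (elim \<omega>)
      have "decseq (\<lambda>n. ennreal (exp (\<theta> * partial_count t n \<omega>)))"
        by (intro decseq_SucI ennreal_leI) (simp add: incseq_partial_count neg mult_left_mono_neg)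
      then show ?case using LIMSEQ_unique[OF elim LIMSEQ_INF] by simp
    qed
    then show ?thesis
      using INF_nn_integral_exp_partial_count[OF neg int int_mgf] by (simp cong: nn_integral_cong_AE)
  qed
  then show ?thesis by (subst integral_eq_nn_integral) auto
qed

lemma mgf_count_bounds:
  assumes int: "integrable M (\<lambda>\<omega>. exp (\<theta> * real (cluster_size C0 \<omega>)))"
    and radius: "(\<integral>\<^sup>+\<omega>. ennreal (cluster_radius C0 \<omega> * exp (\<theta> * real (cluster_size C0 \<omega>))) \<partial>M) < \<infinity>"
    and radius0: "(\<integral>\<^sup>+\<omega>. ennreal (cluster_radius C0 \<omega>) \<partial>M) < \<infinity>"
    and "0 < \<theta>0"
    and int0: "integrable M (\<lambda>\<omega>. exp (\<theta>0 * real (cluster_size C0 \<omega>)))"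
    and radius1: "(\<integral>\<^sup>+\<omega>. ennreal (cluster_radius C0 \<omega> * exp (\<theta>0 * real (cluster_size C0 \<omega>))) \<partial>M) < \<infinity>"
    and \<Lambda>: "\<Lambda> = \<nu> * ((\<integral>\<omega>. exp (\<theta> * real (cluster_size C0 \<omega>)) \<partial>M) - 1)"
  shows "\<exists>K. \<forall>t>0. exp (t * \<Lambda> - K) \<le> (\<integral>\<omega>. exp (\<theta> * real (card (cluster_process C \<omega> \<inter> {0<..t}))) \<partial>M) \<and>
      (\<integral>\<omega>. exp (\<theta> * real (card (cluster_process C \<omega> \<inter> {0<..t}))) \<partial>M) \<le> exp (t * \<Lambda> + K)"
proof -
  define \<phi> where "\<phi> = (\<integral>\<omega>. exp (\<theta> * real (cluster_size C0 \<omega>)) \<partial>M) - 1"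
  obtain \<kappa> where \<kappa>: "\<And>t. 0 < t \<Longrightarrow> integrable lborel (\<lambda>x. shifted_mgf \<theta> t x - 1)"
    "\<And>t. 0 < t \<Longrightarrow> \<bar>(\<integral>x. shifted_mgf \<theta> t x - 1 \<partial>lborel) - t * \<phi>\<bar> \<le> \<kappa>"
    using shifted_mgf_asymptotics[OF int radius radius0] unfolding \<phi>_def by auto
  \<comment> \<open>The auxiliary parameter \<theta>0 > 0 makes the count almost surely finite; the
    bounds themselves concern \<theta>.\<close>
  have int_mgf0: "integrable lborel (\<lambda>x. shifted_mgf \<theta>0 t x - 1)" if "0 < t" for t
    using shifted_mgf_asymptotics[OF int0 radius1 radius0] that by auto
  have "exp (t * \<Lambda> - \<nu> * \<kappa>) \<le> (\<integral>\<omega>. exp (\<theta> * real (card (cluster_process C \<omega> \<inter> {0<..t}))) \<partial>M) \<and>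
      (\<integral>\<omega>. exp (\<theta> * real (card (cluster_process C \<omega> \<inter> {0<..t}))) \<partial>M) \<le> exp (t * \<Lambda> + \<nu> * \<kappa>)"
    if t: "0 < t" for t
  proof -
    define I where "I = (\<integral>x. shifted_mgf \<theta> t x - 1 \<partial>lborel)"
    have eq: "(\<integral>\<omega>. exp (\<theta> * real (card (cluster_process C \<omega> \<inter> {0<..t}))) \<partial>M) = exp (\<nu> * I)"
      unfolding I_def
      by (intro integral_exp_count int \<kappa>(1) AE_eventually_partial_count[OF \<open>0 < \<theta>0\<close> int0] int_mgf0 t)
    have "\<bar>\<nu> * (I - t * \<phi>)\<bar> \<le> \<nu> * \<kappa>"
      using \<kappa>(2)[OF t] intensity_pos unfolding I_def abs_mult by (intro mult_mono) auto
    moreover have "\<nu> * (I - t * \<phi>) = \<nu> * I - t * \<Lambda>" unfolding \<Lambda> \<phi>_def by (simp add: algebra_simps)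
    ultimately show ?thesis unfolding eq by (simp add: abs_le_iff)
  qed
  then show ?thesis by blast
qed

end

section \<open>Large deviations from bounds on moment generating functions\<close>

lemma ereal_log_le:
  assumes "0 \<le> p" "p \<le> exp y"
  shows "ereal_log p \<le> ereal y"
proof (cases "p = 0")
  case False
  with assms have "ln p \<le> ln (exp y)" by (subst ln_le_cancel_iff) auto
  with False show ?thesis by (simp add: ereal_log_def)
qed (simp add: ereal_log_def)

lemma ereal_log_ge:
  assumes "exp y \<le> p"
  shows "ereal y \<le> ereal_log p"
proof -
  have "0 < p" using assms exp_gt_zero[of y] by linarith
  then show ?thesis using assms by (simp add: ereal_log_def) (metis exp_le_cancel_iff exp_ln)
qed

lemma tendsto_ereal_add_over:
  fixes c K :: real
  shows "((\<lambda>t. ereal (c + K / t)) \<longlongrightarrow> ereal c) at_top"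
proof -
  have "((\<lambda>t. c + K / t) \<longlongrightarrow> c + 0) at_top"
    by (intro tendsto_add tendsto_const tendsto_divide_0[OF tendsto_const] filterlim_at_top_imp_at_infinity filterlim_ident)
  then show ?thesis by simp
qed

lemma Limsup_scaled_log_le:
  fixes p :: "real \<Rightarrow> real"
  assumes "\<And>t. 0 \<le> p t" "eventually (\<lambda>t. p t \<le> exp (t * c + K)) at_top"
  shows "Limsup at_top (\<lambda>t. ereal (1 / t) * ereal_log (p t)) \<le> ereal c"
proof -
  have "eventually (\<lambda>t. ereal (1 / t) * ereal_log (p t) \<le> ereal (c + K / t)) at_top"
    using assms(2) eventually_gt_at_top[of "0::real"]
  proof eventually_elim
    case (elim t)
    have "ereal (1 / t) * ereal_log (p t) \<le> ereal (1 / t) * ereal (t * c + K)"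
      using elim assms(1) by (intro ereal_mult_left_mono ereal_log_le) auto
    also have "\<dots> = ereal (c + K / t)" using elim by (simp add: field_simps)
    finally show ?case .
  qed
  then have "Limsup at_top (\<lambda>t. ereal (1 / t) * ereal_log (p t)) \<le> Limsup at_top (\<lambda>t. ereal (c + K / t))"
    by (rule Limsup_mono)
  also have "\<dots> = ereal c" by (rule lim_imp_Limsup[OF _ tendsto_ereal_add_over]) simp
  finally show ?thesis .
qed

lemma Liminf_scaled_log_ge:
  fixes p :: "real \<Rightarrow> real"
  assumes "eventually (\<lambda>t. exp (t * c + K) \<le> p t) at_top"
  shows "ereal c \<le> Liminf at_top (\<lambda>t. ereal (1 / t) * ereal_log (p t))"
proof -
  have "eventually (\<lambda>t. ereal (c + K / t) \<le> ereal (1 / t) * ereal_log (p t)) at_top"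
    using assms eventually_gt_at_top[of "0::real"]
  proof eventually_elim
    case (elim t)
    have "ereal (c + K / t) = ereal (1 / t) * ereal (t * c + K)" using elim by (simp add: field_simps)
    also have "\<dots> \<le> ereal (1 / t) * ereal_log (p t)"
      using elim by (intro ereal_mult_left_mono ereal_log_ge) auto
    finally show ?case .
  qed
  then have "Liminf at_top (\<lambda>t. ereal (c + K / t)) \<le> Liminf at_top (\<lambda>t. ereal (1 / t) * ereal_log (p t))"
    by (rule Liminf_mono)
  moreover have "Liminf at_top (\<lambda>t. ereal (c + K / t)) = ereal c"
    by (rule lim_imp_Liminf[OF _ tendsto_ereal_add_over]) simp
  ultimately show ?thesis by simp
qed

text \<open>All that is kept of the cluster process is that its moment generating function agrees
  with \<open>exp (t * \<Lambda> \<theta>)\<close> up to a factor bounded in \<open>t\<close>. The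
  bound \<open>K\<close> may depend on \<theta>, as every estimate below uses finitely many
  parameters.\<close>

locale mgf_asymptotics = prob_space M for M :: "'a measure" +
  fixes Y :: "real \<Rightarrow> 'a \<Rightarrow> real" and D :: "real set" and \<Lambda> :: "real \<Rightarrow> real"
  assumes Y_measurable [measurable]: "\<And>t. 0 < t \<Longrightarrow> Y t \<in> borel_measurable M"
    and open_D: "open D"
    and mgf_bounds: "\<And>\<theta>. \<theta> \<in> D \<Longrightarrow> \<exists>K. \<forall>t>0. exp (t * \<Lambda> \<theta> - K) \<le> (\<integral>\<omega>. exp (\<theta> * Y t \<omega>) \<partial>M) \<and>
        (\<integral>\<omega>. exp (\<theta> * Y t \<omega>) \<partial>M) \<le> exp (t * \<Lambda> \<theta> + K)"
begin

text \<open>A non-integrable function has Bochner integral 0, which the positive lower bound in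
  \<open>mgf_bounds\<close> rules out.\<close>

lemma integrable_mgf:
  assumes "\<theta> \<in> D" "0 < t"
  shows "integrable M (\<lambda>\<omega>. exp (\<theta> * Y t \<omega>))"
proof (rule ccontr)
  assume "\<not> ?thesis"
  then have "(\<integral>\<omega>. exp (\<theta> * Y t \<omega>) \<partial>M) = 0" by (rule not_integrable_integral_eq)
  moreover obtain K where "exp (t * \<Lambda> \<theta> - K) \<le> (\<integral>\<omega>. exp (\<theta> * Y t \<omega>) \<partial>M)"
    using mgf_bounds[OF assms(1)] assms(2) by blast
  ultimately show False by (metis exp_gt_zero not_less)
qed

text \<open>Keeping the factor \<theta> on both sides of the event treats the right tail (\<theta> >
  0) and the left tail (\<theta> < 0) at once.\<close>

lemma chernoff:
  assumes "\<theta> \<in> D" "c < \<theta> * b - \<Lambda> \<theta>"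
  shows "\<exists>K. \<forall>t>0. prob {\<omega> \<in> space M. \<theta> * b \<le> \<theta> * (Y t \<omega> / t)} \<le> exp (- t * c + K)"
proof -
  obtain K where K: "\<And>t. 0 < t \<Longrightarrow> (\<integral>\<omega>. exp (\<theta> * Y t \<omega>) \<partial>M) \<le> exp (t * \<Lambda> \<theta> + K)"
    using mgf_bounds[OF assms(1)] by blast
  have "prob {\<omega> \<in> space M. \<theta> * b \<le> \<theta> * (Y t \<omega> / t)} \<le> exp (- t * c + K)" if t: "0 < t" for t
  proof -
    have "{\<omega> \<in> space M. \<theta> * b \<le> \<theta> * (Y t \<omega> / t)} = {\<omega> \<in> space M. exp (t * (\<theta> * b)) \<le> exp (\<theta> * Y t \<omega>)}"
      using t by (auto simp: field_simps)
    then have "prob {\<omega> \<in> space M. \<theta> * b \<le> \<theta> * (Y t \<omega> / t)} \<le> (\<integral>\<omega>. exp (\<theta> * Y t \<omega>) \<partial>M) / exp (t * (\<theta> * b))"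
      using integral_Markov_inequality_measure[OF integrable_mgf[OF assms(1) t] sets.top, of "exp (t * (\<theta> * b))"]
      by simp
    also have "\<dots> \<le> exp (t * \<Lambda> \<theta> + K) / exp (t * (\<theta> * b))"
      by (intro divide_right_mono K t) simp
    also have "\<dots> = exp (t * \<Lambda> \<theta> + K - t * (\<theta> * b))" by (simp add: exp_diff)
    also have "\<dots> \<le> exp (- t * c + K)"
    proof -
      have "t * c \<le> t * (\<theta> * b - \<Lambda> \<theta>)" using t assms(2) by (intro mult_left_mono) auto
      then show ?thesis by (simp add: algebra_simps)
    qed
    finally show ?thesis .
  qed
  then show ?thesis by blast
qed

text \<open>On either side of \<open>m\<close> the closed set \<open>F\<close>, if it has points
  there, has one nearest to \<open>m\<close>, and a single Chernoff bound at that point controls the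
  whole side. In the application \<open>m\<close> is the mean, where the rate vanishes.\<close>

lemma upper_bound_closed:
  assumes F: "closed F" and "m \<notin> F"
    and m: "\<And>\<theta>. \<theta> \<in> D \<Longrightarrow> \<theta> * m \<le> \<Lambda> \<theta>"
    and "0 \<le> c" and c: "\<And>x. x \<in> F \<Longrightarrow> \<exists>\<theta>\<in>D. c < \<theta> * x - \<Lambda> \<theta>"
  shows "\<exists>K. \<forall>t>0. prob {\<omega> \<in> space M. Y t \<omega> / t \<in> F} \<le> exp (- t * c + K)"
proof -
  have half: "\<exists>K. \<forall>t>0. prob {\<omega> \<in> space M. Y t \<omega> / t \<in> G} \<le> exp (- t * c + K)"
    if "\<theta> \<in> D" "c < \<theta> * b - \<Lambda> \<theta>" and sub: "\<And>y. y \<in> G \<Longrightarrow> \<theta> * b \<le> \<theta> * y" for G \<theta> b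
  proof -
    from chernoff[OF that(1,2)] obtain K
      where K: "\<forall>t>0. prob {\<omega> \<in> space M. \<theta> * b \<le> \<theta> * (Y t \<omega> / t)} \<le> exp (- t * c + K)" ..
    have "prob {\<omega> \<in> space M. Y t \<omega> / t \<in> G} \<le> exp (- t * c + K)" if t: "0 < t" for t
    proof (rule order_trans[OF finite_measure_mono K[rule_format, OF t]])
      show "{\<omega> \<in> space M. Y t \<omega> / t \<in> G} \<subseteq> {\<omega> \<in> space M. \<theta> * b \<le> \<theta> * (Y t \<omega> / t)}"
        using sub by blast
      show "{\<omega> \<in> space M. \<theta> * b \<le> \<theta> * (Y t \<omega> / t)} \<in> events"
        using Y_measurable[OF t] by measurable
    qed
    then show ?thesis by blast
  qed
  have right: "\<exists>K. \<forall>t>0. prob {\<omega> \<in> space M. Y t \<omega> / t \<in> F \<inter> {m..}} \<le> exp (- t * c + K)"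
  proof (cases "F \<inter> {m..} = {}")
    case False
    let ?b = "Inf (F \<inter> {m..})"
    have bdd: "bdd_below (F \<inter> {m..})" by (auto intro: bdd_belowI[of _ m])
    have b: "?b \<in> F \<inter> {m..}"
      using closed_contains_Inf[OF False bdd] F by (simp add: closed_Int)
    then obtain \<theta> where \<theta>: "\<theta> \<in> D" "c < \<theta> * ?b - \<Lambda> \<theta>" using c by blast
    have "m < ?b" using b \<open>m \<notin> F\<close> by (metis IntD1 IntD2 atLeast_iff order_le_less)
    \<comment> \<open>By \<open>0 \<le> c < \<theta> * b - \<Lambda> \<theta> \<le> \<theta> * (b -
      m)\<close>. Hence \<theta> points away from \<open>m\<close>, and its half line contains the
      rest of \<open>F\<close> on this side.\<close>
    moreover have "0 < \<theta> * (?b - m)" using \<theta> m[OF \<theta>(1)] \<open>0 \<le> c\<close> by (simp add: algebra_simps)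
    ultimately have "0 < \<theta>" by (simp add: zero_less_mult_iff)
    show ?thesis
      by (rule half[OF \<theta>]) (use \<open>0 < \<theta>\<close> bdd in \<open>auto intro!: mult_left_mono cInf_lower\<close>)
  qed simp
  have left: "\<exists>K. \<forall>t>0. prob {\<omega> \<in> space M. Y t \<omega> / t \<in> F \<inter> {..m}} \<le> exp (- t * c + K)"
  proof (cases "F \<inter> {..m} = {}")
    case False
    let ?b = "Sup (F \<inter> {..m})"
    have bdd: "bdd_above (F \<inter> {..m})" by (auto intro: bdd_aboveI[of _ m])
    have b: "?b \<in> F \<inter> {..m}"
      using closed_contains_Sup[OF False bdd] F by (simp add: closed_Int)
    then obtain \<theta> where \<theta>: "\<theta> \<in> D" "c < \<theta> * ?b - \<Lambda> \<theta>" using c by blast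
    have "?b < m" using b \<open>m \<notin> F\<close> by (metis IntD1 IntD2 atMost_iff order_le_less)
    moreover have "0 < \<theta> * (?b - m)" using \<theta> m[OF \<theta>(1)] \<open>0 \<le> c\<close> by (simp add: algebra_simps)
    ultimately have "\<theta> < 0" by (simp add: zero_less_mult_iff)
    show ?thesis
      by (rule half[OF \<theta>]) (use \<open>\<theta> < 0\<close> bdd in \<open>auto intro!: mult_left_mono_neg cSup_upper\<close>)
  qed simp
  from right obtain K1 where
    K1: "\<forall>t>0. prob {\<omega> \<in> space M. Y t \<omega> / t \<in> F \<inter> {m..}} \<le> exp (- t * c + K1)" ..
  from left obtain K2 where
    K2: "\<forall>t>0. prob {\<omega> \<in> space M. Y t \<omega> / t \<in> F \<inter> {..m}} \<le> exp (- t * c + K2)" ..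
  have [measurable]: "F \<in> sets borel" using F by simp
  \<comment> \<open>The two sides share the rate \<open>c\<close>, so their prefactors
    \<open>exp K1\<close> and \<open>exp K2\<close> simply add.\<close>
  have "prob {\<omega> \<in> space M. Y t \<omega> / t \<in> F} \<le> exp (- t * c + ln (exp K1 + exp K2))" if t: "0 < t" for t
  proof -
    have "prob {\<omega> \<in> space M. Y t \<omega> / t \<in> F}
        \<le> prob ({\<omega> \<in> space M. Y t \<omega> / t \<in> F \<inter> {m..}} \<union> {\<omega> \<in> space M. Y t \<omega> / t \<in> F \<inter> {..m}})"
      using Y_measurable[OF t] by (intro finite_measure_mono) (auto, measurable)
    also have "\<dots> \<le> prob {\<omega> \<in> space M. Y t \<omega> / t \<in> F \<inter> {m..}} + prob {\<omega> \<in> space M. Y t \<omega> / t \<in> F \<inter> {..m}}"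
      by (intro measure_Un_le) (use Y_measurable[OF t] in measurable)
    also have "\<dots> \<le> exp (- t * c + K1) + exp (- t * c + K2)" by (intro add_mono K1[rule_format] K2[rule_format] t)
    also have "\<dots> = exp (- t * c + ln (exp K1 + exp K2))"
      by (simp only: exp_add exp_ln[OF add_pos_pos[OF exp_gt_zero exp_gt_zero]] distrib_left)
    finally show ?thesis .
  qed
  then show ?thesis by blast
qed

text \<open>
  The exponential change of measure is implicit: the weight \<open>exp (\<eta> * Y t)\<close> is concentrated on
  \<open>Y t / t \<approx> x\<close>, by Chernoff bounds with the parameters \<open>\<eta> \<plusminus> \<rho>\<close>.
\<close>

lemma lower_bound_tilted:
  assumes \<eta>: "\<eta> \<in> D" and deriv: "(\<Lambda> has_real_derivative x) (at \<eta>)" and "0 < \<delta>"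
  shows "\<exists>K. eventually (\<lambda>t. exp (t * (\<Lambda> \<eta> - \<eta> * x - \<bar>\<eta>\<bar> * \<delta>) + K)
      \<le> prob {\<omega> \<in> space M. \<bar>Y t \<omega> / t - x\<bar> < \<delta>}) at_top"
proof -
  have tail: "\<exists>\<kappa>>0. \<exists>K. \<forall>t>0.
      (\<integral>\<omega>. exp (\<eta> * Y t \<omega>) * indicator {\<omega> \<in> space M. \<delta> \<le> s * (Y t \<omega> / t - x)} \<omega> \<partial>M)
        \<le> exp (t * (\<Lambda> \<eta> - \<kappa>) + K)"
    if s: "\<bar>s\<bar> = 1" for s :: real
  proof -
    \<comment> \<open>The exponent left after a further tilt by \<open>\<rho> * s\<close>, where
      \<open>s\<close> is 1 for the right tail and -1 for the left. Its slope at 0 is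
      \<open>- \<delta>\<close>, so a small \<rho> brings it below \<open>\<Lambda> \<eta>\<close>,
      by the amount \<kappa> defined below.\<close>
    have "((\<lambda>\<rho>. \<Lambda> (\<eta> + \<rho> * s) - \<rho> * (s * x + \<delta>)) has_real_derivative (x * s - (s * x + \<delta>))) (at 0)"
      using deriv by (auto intro!: derivative_eq_intros DERIV_chain2[where f=\<Lambda>])
    then have "((\<lambda>\<rho>. \<Lambda> (\<eta> + \<rho> * s) - \<rho> * (s * x + \<delta>)) has_real_derivative - \<delta>) (at 0)" by simp
    from DERIV_neg_dec_right[OF this] \<open>0 < \<delta>\<close> obtain d where d: "0 < d"
      "\<And>h. 0 < h \<Longrightarrow> h < d \<Longrightarrow> \<Lambda> (\<eta> + h * s) - h * (s * x + \<delta>) < \<Lambda> \<eta>" by auto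
    obtain e where e: "0 < e" "ball \<eta> e \<subseteq> D" using open_D \<eta> openE by blast
    define \<rho> where "\<rho> = min d e / 2"
    have \<rho>: "0 < \<rho>" "\<rho> < d" "\<rho> < e" using d(1) e(1) by (auto simp: \<rho>_def min_def)
    have "\<bar>\<rho> * s\<bar> = \<rho>" using \<rho> s by (simp add: abs_mult)
    then have mem: "\<eta> + \<rho> * s \<in> D" using \<rho> e(2) by (intro subsetD[OF e(2)]) (auto simp: dist_real_def)
    define \<kappa> where "\<kappa> = \<Lambda> \<eta> - (\<Lambda> (\<eta> + \<rho> * s) - \<rho> * (s * x + \<delta>))"
    have "0 < \<kappa>" using d(2)[OF \<rho>(1,2)] by (simp add: \<kappa>_def)
    obtain K where K: "\<And>t. 0 < t \<Longrightarrow> (\<integral>\<omega>. exp ((\<eta> + \<rho> * s) * Y t \<omega>) \<partial>M) \<le> exp (t * \<Lambda> (\<eta> + \<rho> * s) + K)"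
      using mgf_bounds[OF mem] by blast
    have "(\<integral>\<omega>. exp (\<eta> * Y t \<omega>) * indicator {\<omega> \<in> space M. \<delta> \<le> s * (Y t \<omega> / t - x)} \<omega> \<partial>M)
        \<le> exp (t * (\<Lambda> \<eta> - \<kappa>) + K)" if t: "0 < t" for t
    proof -
      have "(\<integral>\<omega>. exp (\<eta> * Y t \<omega>) * indicator {\<omega> \<in> space M. \<delta> \<le> s * (Y t \<omega> / t - x)} \<omega> \<partial>M)
          \<le> (\<integral>\<omega>. exp (- \<rho> * t * (s * x + \<delta>)) * exp ((\<eta> + \<rho> * s) * Y t \<omega>) \<partial>M)"
      proof (rule integral_mono_AE')
        show "integrable M (\<lambda>\<omega>. exp (- \<rho> * t * (s * x + \<delta>)) * exp ((\<eta> + \<rho> * s) * Y t \<omega>))"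
          by (intro integrable_mult_right integrable_mgf mem t)
        show "AE \<omega> in M. exp (\<eta> * Y t \<omega>) * indicator {\<omega> \<in> space M. \<delta> \<le> s * (Y t \<omega> / t - x)} \<omega>
            \<le> exp (- \<rho> * t * (s * x + \<delta>)) * exp ((\<eta> + \<rho> * s) * Y t \<omega>)"
        proof (intro AE_I2)
          fix \<omega>
          show "exp (\<eta> * Y t \<omega>) * indicator {\<omega> \<in> space M. \<delta> \<le> s * (Y t \<omega> / t - x)} \<omega>
            \<le> exp (- \<rho> * t * (s * x + \<delta>)) * exp ((\<eta> + \<rho> * s) * Y t \<omega>)"
          proof (cases "\<delta> \<le> s * (Y t \<omega> / t - x)")
            case True
            then have "0 \<le> \<rho> * t * (s * (Y t \<omega> / t - x) - \<delta>)" using \<rho> t by simp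
            also have "\<dots> = \<rho> * s * Y t \<omega> - \<rho> * t * (s * x + \<delta>)" using t by (simp add: field_simps)
            finally show ?thesis
              by (auto simp: indicator_def exp_add[symmetric] algebra_simps)
          qed simp
        qed
      qed simp
      also have "\<dots> = exp (- \<rho> * t * (s * x + \<delta>)) * (\<integral>\<omega>. exp ((\<eta> + \<rho> * s) * Y t \<omega>) \<partial>M)" by simp
      also have "\<dots> \<le> exp (- \<rho> * t * (s * x + \<delta>)) * exp (t * \<Lambda> (\<eta> + \<rho> * s) + K)"
        by (intro mult_left_mono K t) simp
      also have "\<dots> = exp (t * (\<Lambda> \<eta> - \<kappa>) + K)"
        by (simp add: exp_add[symmetric] \<kappa>_def algebra_simps)
      finally show ?thesis .
    qed
    with \<open>0 < \<kappa>\<close> show ?thesis by blast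
  qed
  obtain \<kappa>1 K1 where 1: "0 < \<kappa>1" "\<And>t. 0 < t \<Longrightarrow>
      (\<integral>\<omega>. exp (\<eta> * Y t \<omega>) * indicator {\<omega> \<in> space M. \<delta> \<le> 1 * (Y t \<omega> / t - x)} \<omega> \<partial>M)
        \<le> exp (t * (\<Lambda> \<eta> - \<kappa>1) + K1)" using tail[of 1] by auto
  obtain \<kappa>2 K2 where 2: "0 < \<kappa>2" "\<And>t. 0 < t \<Longrightarrow>
      (\<integral>\<omega>. exp (\<eta> * Y t \<omega>) * indicator {\<omega> \<in> space M. \<delta> \<le> - 1 * (Y t \<omega> / t - x)} \<omega> \<partial>M)
        \<le> exp (t * (\<Lambda> \<eta> - \<kappa>2) + K2)" using tail[of "-1"] by auto
  obtain K where K: "\<And>t. 0 < t \<Longrightarrow> exp (t * \<Lambda> \<eta> - K) \<le> (\<integral>\<omega>. exp (\<eta> * Y t \<omega>) \<partial>M)"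
    using mgf_bounds[OF \<eta>] by blast
  \<comment> \<open>Each tail eventually takes at most a quarter of the lower bound for the total
    weight, so half of that bound remains near \<open>x\<close>; this is the origin of
    \<open>ln 2\<close> below.\<close>
  have small: "eventually (\<lambda>t. exp (t * (\<Lambda> \<eta> - \<kappa>) + K') \<le> exp (t * \<Lambda> \<eta> - K) / 4) at_top"
    if "0 < \<kappa>" for \<kappa> K' :: real
  proof -
    have "eventually (\<lambda>t. (K' + K + ln 4) / \<kappa> \<le> t) at_top" by (rule eventually_ge_at_top)
    then show ?thesis
    proof eventually_elim
      case (elim t)
      then have "K' + K + ln 4 \<le> t * \<kappa>" using that by (simp add: pos_divide_le_eq)
      then have "t * (\<Lambda> \<eta> - \<kappa>) + K' \<le> t * \<Lambda> \<eta> - K - ln 4" by (simp add: algebra_simps)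
      then have "exp (t * (\<Lambda> \<eta> - \<kappa>) + K') \<le> exp (t * \<Lambda> \<eta> - K - ln 4)" by simp
      then show ?case by (simp add: exp_diff)
    qed
  qed
  have "eventually (\<lambda>t. exp (t * (\<Lambda> \<eta> - \<eta> * x - \<bar>\<eta>\<bar> * \<delta>) + (- K - ln 2))
      \<le> prob {\<omega> \<in> space M. \<bar>Y t \<omega> / t - x\<bar> < \<delta>}) at_top"
    using small[OF 1(1), of K1] small[OF 2(1), of K2] eventually_gt_at_top[of "0::real"]
  proof eventually_elim
    case (elim t)
    note [measurable] = Y_measurable[OF elim(3)]
    define f where "f \<omega> = exp (\<eta> * Y t \<omega>)" for \<omega>
    define I where "I s = {\<omega> \<in> space M. \<delta> \<le> s * (Y t \<omega> / t - x)}" for s :: real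
    define J where "J = {\<omega> \<in> space M. \<bar>Y t \<omega> / t - x\<bar> < \<delta>}"
    have [measurable]: "I s \<in> events" "J \<in> events" for s unfolding I_def J_def by measurable
    have int: "integrable M f" unfolding f_def by (rule integrable_mgf[OF \<eta> elim(3)])
    have int_ind: "integrable M (\<lambda>\<omega>. f \<omega> * indicator A \<omega>)" if "A \<in> events" for A
      using that int by (rule integrable_real_mult_indicator)
    have "(\<integral>\<omega>. f \<omega> \<partial>M) \<le> (\<integral>\<omega>. f \<omega> * indicator (I 1) \<omega> + f \<omega> * indicator (I (- 1)) \<omega> + f \<omega> * indicator J \<omega> \<partial>M)"
    proof (intro integral_mono_AE int Bochner_Integration.integrable_add int_ind)
      show "AE \<omega> in M. f \<omega> \<le> f \<omega> * indicator (I 1) \<omega> + f \<omega> * indicator (I (- 1)) \<omega> + f \<omega> * indicator J \<omega>"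
        by (intro AE_I2) (auto simp: I_def J_def f_def indicator_def abs_less_iff)
    qed auto
    also have "\<dots> = (\<integral>\<omega>. f \<omega> * indicator (I 1) \<omega> \<partial>M) + (\<integral>\<omega>. f \<omega> * indicator (I (- 1)) \<omega> \<partial>M)
        + (\<integral>\<omega>. f \<omega> * indicator J \<omega> \<partial>M)"
      by (simp add: int_ind)
    also have "\<dots> \<le> exp (t * \<Lambda> \<eta> - K) / 4 + exp (t * \<Lambda> \<eta> - K) / 4 + (\<integral>\<omega>. f \<omega> * indicator J \<omega> \<partial>M)"
      using order_trans[OF 1(2)[OF elim(3)] elim(1)] order_trans[OF 2(2)[OF elim(3)] elim(2)]
      unfolding f_def I_def by (intro add_mono order_refl)
    finally have "exp (t * \<Lambda> \<eta> - K) / 2 \<le> (\<integral>\<omega>. f \<omega> * indicator J \<omega> \<partial>M)"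
      using K[OF elim(3)] by (simp add: f_def)
    \<comment> \<open>On \<open>J\<close> the weight is nearly constant; the error
      \<open>\<bar>\<eta>\<bar> * \<delta>\<close> covers either sign of \<eta>.\<close>
    also have "\<dots> \<le> (\<integral>\<omega>. exp (t * (\<eta> * x + \<bar>\<eta>\<bar> * \<delta>)) * indicator J \<omega> \<partial>M)"
    proof (intro integral_mono_AE int_ind)
      show "AE \<omega> in M. f \<omega> * indicator J \<omega> \<le> exp (t * (\<eta> * x + \<bar>\<eta>\<bar> * \<delta>)) * indicator J \<omega>"
      proof (intro AE_I2)
        fix \<omega>
        have "\<eta> * Y t \<omega> \<le> t * (\<eta> * x + \<bar>\<eta>\<bar> * \<delta>)" if "\<bar>Y t \<omega> / t - x\<bar> < \<delta>"
        proof -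
          have "\<eta> * (Y t \<omega> / t - x) \<le> \<bar>\<eta>\<bar> * \<bar>Y t \<omega> / t - x\<bar>"
            by (metis abs_ge_self abs_mult)
          also have "\<dots> \<le> \<bar>\<eta>\<bar> * \<delta>" using that by (intro mult_left_mono) auto
          finally have "\<eta> * (Y t \<omega> / t - x) \<le> \<bar>\<eta>\<bar> * \<delta>" .
          then have "t * (\<eta> * (Y t \<omega> / t - x)) \<le> t * (\<bar>\<eta>\<bar> * \<delta>)" using elim(3) by (intro mult_left_mono) auto
          moreover have "t * (\<eta> * (Y t \<omega> / t - x)) = \<eta> * Y t \<omega> - t * (\<eta> * x)"
            using elim(3) by (simp add: field_simps)
          ultimately show ?thesis by (simp add: distrib_left)
        qed
        then show "f \<omega> * indicator J \<omega> \<le> exp (t * (\<eta> * x + \<bar>\<eta>\<bar> * \<delta>)) * indicator J \<omega>"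
          by (auto simp: f_def J_def indicator_def)
      qed
    qed (auto intro!: integrable_mult_right integrable_real_indicator simp: emeasure_eq_measure)
    also have "\<dots> = exp (t * (\<eta> * x + \<bar>\<eta>\<bar> * \<delta>)) * prob J" by simp
    finally have "exp (t * \<Lambda> \<eta> - K) / 2 / exp (t * (\<eta> * x + \<bar>\<eta>\<bar> * \<delta>)) \<le> prob J"
      by (simp add: pos_divide_le_eq mult.commute)
    also have "exp (t * \<Lambda> \<eta> - K) / 2 / exp (t * (\<eta> * x + \<bar>\<eta>\<bar> * \<delta>))
        = exp (t * \<Lambda> \<eta> - K - ln 2 - t * (\<eta> * x + \<bar>\<eta>\<bar> * \<delta>))"
      by (simp add: exp_diff)
    also have "t * \<Lambda> \<eta> - K - ln 2 - t * (\<eta> * x + \<bar>\<eta>\<bar> * \<delta>)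
        = t * (\<Lambda> \<eta> - \<eta> * x - \<bar>\<eta>\<bar> * \<delta>) + (- K - ln 2)" by (simp add: algebra_simps)
    finally show ?case by (simp add: J_def)
  qed
  then show ?thesis by blast
qed

text \<open>The loss \<open>\<bar>\<eta>\<bar> * \<delta>\<close> disappears by letting \<delta>
  tend to 0 after \<open>t\<close> has gone to infinity.\<close>

lemma lower_bound_open:
  assumes \<eta>: "\<eta> \<in> D" and deriv: "(\<Lambda> has_real_derivative x) (at \<eta>)" and G: "open G" "x \<in> G"
    and [measurable]: "B \<in> sets borel" and "G \<subseteq> B"
  shows "ereal (\<Lambda> \<eta> - \<eta> * x)
      \<le> Liminf at_top (\<lambda>t. ereal (1 / t) * ereal_log (prob {\<omega> \<in> space M. Y t \<omega> / t \<in> B}))"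
    (is "_ \<le> ?L")
proof -
  obtain e where e: "0 < e" "ball x e \<subseteq> G" using G openE by blast
  have bound: "ereal (\<Lambda> \<eta> - \<eta> * x - \<bar>\<eta>\<bar> * \<delta>) \<le> ?L" if \<delta>: "0 < \<delta>" "\<delta> \<le> e" for \<delta>
  proof -
    obtain K where "eventually (\<lambda>t. exp (t * (\<Lambda> \<eta> - \<eta> * x - \<bar>\<eta>\<bar> * \<delta>) + K)
      \<le> prob {\<omega> \<in> space M. \<bar>Y t \<omega> / t - x\<bar> < \<delta>}) at_top"
      using lower_bound_tilted[OF \<eta> deriv \<delta>(1)] by blast
    then have "eventually (\<lambda>t. exp (t * (\<Lambda> \<eta> - \<eta> * x - \<bar>\<eta>\<bar> * \<delta>) + K)
      \<le> prob {\<omega> \<in> space M. Y t \<omega> / t \<in> B}) at_top"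
      using eventually_gt_at_top[of "0::real"]
    proof eventually_elim
      case (elim t)
      note [measurable] = Y_measurable[OF elim(2)]
      have "\<bar>y - x\<bar> < \<delta> \<Longrightarrow> y \<in> B" for y
        using \<delta> e(2) \<open>G \<subseteq> B\<close> by (auto simp: subset_iff dist_real_def abs_minus_commute)
      then have "prob {\<omega> \<in> space M. \<bar>Y t \<omega> / t - x\<bar> < \<delta>} \<le> prob {\<omega> \<in> space M. Y t \<omega> / t \<in> B}"
        by (intro finite_measure_mono) auto
      with elim(1) show ?case by linarith
    qed
    then show ?thesis by (rule Liminf_scaled_log_ge)
  qed
  have "((\<lambda>\<delta>. \<Lambda> \<eta> - \<eta> * x - \<bar>\<eta>\<bar> * \<delta>) \<longlongrightarrow> \<Lambda> \<eta> - \<eta> * x - \<bar>\<eta>\<bar> * 0) (at_right 0)"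
    by (intro tendsto_intros)
  then have "((\<lambda>\<delta>. ereal (\<Lambda> \<eta> - \<eta> * x - \<bar>\<eta>\<bar> * \<delta>)) \<longlongrightarrow> ereal (\<Lambda> \<eta> - \<eta> * x)) (at_right 0)" by simp
  moreover have "eventually (\<lambda>\<delta>. ereal (\<Lambda> \<eta> - \<eta> * x - \<bar>\<eta>\<bar> * \<delta>) \<le> ?L) (at_right 0)"
    using bound e(1) by (auto simp: eventually_at_right intro!: exI[of _ e])
  ultimately show ?thesis by (rule tendsto_upperbound) simp
qed

end

section \<open>The rate function and the large deviation principle\<close>

context poisson_cluster_process
begin

text \<open>The real-valued companion of \<open>size_mgf\<close>. The two agree on
  \<open>size_domain\<close>; outside it this Bochner integral takes the default value 0.\<close>

definition mgf :: "real \<Rightarrow> real" where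
  "mgf \<theta> = (\<integral>\<omega>. exp (\<theta> * real (cluster_size C0 \<omega>)) \<partial>M)"

lemma integrable_exp_size:
  assumes "\<theta> \<in> size_domain M C0"
  shows "integrable M (\<lambda>\<omega>. exp (\<theta> * real (cluster_size C0 \<omega>)))"
proof -
  have "enn2ereal (\<integral>\<^sup>+\<omega>. ennreal (exp (\<theta> * real (cluster_size C0 \<omega>))) \<partial>M) < enn2ereal top"
    using assms by (simp add: size_domain_def size_mgf_def)
  then have "(\<integral>\<^sup>+\<omega>. ennreal (exp (\<theta> * real (cluster_size C0 \<omega>))) \<partial>M) < top"
    by (simp only: less_ennreal.rep_eq)
  then show ?thesis by (intro integrableI_bounded) auto
qed

lemma size_mgf_eq: "\<theta> \<in> size_domain M C0 \<Longrightarrow> size_mgf M C0 \<theta> = ereal (mgf \<theta>)"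
  unfolding size_mgf_def mgf_def
  by (subst nn_integral_eq_integral[OF integrable_exp_size]) (auto simp: enn2ereal_ennreal)

lemma size_mgf_mono: "\<theta> \<le> \<eta> \<Longrightarrow> size_mgf M C0 \<theta> \<le> size_mgf M C0 \<eta>"
  unfolding size_mgf_def less_eq_ennreal.rep_eq[symmetric]
  by (intro nn_integral_mono ennreal_leI) (simp add: mult_right_mono)

lemma size_domain_downward: "\<eta> \<in> size_domain M C0 \<Longrightarrow> \<theta> \<le> \<eta> \<Longrightarrow> \<theta> \<in> size_domain M C0"
  unfolding size_domain_def using size_mgf_mono[of \<theta> \<eta>] by (auto intro: order_le_less_trans)

text \<open>As the cluster size is nonnegative, the domain is a lower set, so passing to its
  interior loses at most a right end point.\<close>

lemma interior_size_domain: "\<eta> \<in> size_domain M C0 \<Longrightarrow> \<theta> < \<eta> \<Longrightarrow> \<theta> \<in> interior (size_domain M C0)"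
  by (rule interiorI[of "{..<\<eta>}"]) (auto intro: size_domain_downward)

lemma cluster_Lambda_eq:
  "\<theta> \<in> size_domain M C0 \<Longrightarrow> cluster_Lambda M \<nu> C0 \<theta> = ereal (\<nu> * (mgf \<theta> - 1))"
  by (simp add: cluster_Lambda_def size_mgf_eq one_ereal_def)

lemma cluster_Lambda_top:
  "\<theta> \<notin> size_domain M C0 \<Longrightarrow> cluster_Lambda M \<nu> C0 \<theta> = \<infinity>"
  using intensity_pos by (simp add: cluster_Lambda_def size_domain_def)

lemma mgf_zero: "mgf 0 = 1"
  by (simp add: mgf_def prob_space)

lemma fenchel_legendre_ge:
  "\<theta> \<in> size_domain M C0 \<Longrightarrow>
    ereal (\<theta> * x - \<nu> * (mgf \<theta> - 1)) \<le> fenchel_legendre (cluster_Lambda M \<nu> C0) x"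
  unfolding fenchel_legendre_def by (rule SUP_upper2[of \<theta>]) (simp_all add: cluster_Lambda_eq)

text \<open>The supremum may be restricted to the interior: moving \<theta> slightly to the left
  changes the linear term little and can only decrease \<open>mgf\<close>, even when \<theta> is an
  end point of the domain.\<close>

lemma fenchel_legendre_less:
  assumes "ereal c < fenchel_legendre (cluster_Lambda M \<nu> C0) x"
  shows "\<exists>\<theta>\<in>interior (size_domain M C0). c < \<theta> * x - \<nu> * (mgf \<theta> - 1)"
proof -
  obtain \<theta> where \<theta>: "ereal c < ereal (\<theta> * x) - cluster_Lambda M \<nu> C0 \<theta>"
    using assms unfolding fenchel_legendre_def less_SUP_iff by auto
  then have mem: "\<theta> \<in> size_domain M C0" using cluster_Lambda_top by fastforce
  then have c: "c < \<theta> * x - \<nu> * (mgf \<theta> - 1)" using \<theta> by (simp add: cluster_Lambda_eq)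
  have "((\<lambda>\<eta>. \<eta> * x - \<nu> * (mgf \<theta> - 1)) \<longlongrightarrow> \<theta> * x - \<nu> * (mgf \<theta> - 1)) (at_left \<theta>)"
    by (intro tendsto_intros)
  from order_tendstoD(1)[OF this c] obtain b where b: "b < \<theta>"
    "\<And>\<eta>. b < \<eta> \<Longrightarrow> \<eta> < \<theta> \<Longrightarrow> c < \<eta> * x - \<nu> * (mgf \<theta> - 1)"
    by (auto simp: eventually_at_left_field)
  obtain \<eta> where \<eta>: "b < \<eta>" "\<eta> < \<theta>" using dense[OF b(1)] by blast
  have "mgf \<eta> \<le> mgf \<theta>"
    using size_mgf_mono[of \<eta> \<theta>] \<eta> mem size_domain_downward[OF mem, of \<eta>] by (simp add: size_mgf_eq)
  then have "\<nu> * (mgf \<eta> - 1) \<le> \<nu> * (mgf \<theta> - 1)" using intensity_pos by (intro mult_left_mono) auto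
  then have "c < \<eta> * x - \<nu> * (mgf \<eta> - 1)" using b(2)[OF \<eta>] by linarith
  then show ?thesis using interior_size_domain[OF mem \<eta>(2)] by blast
qed

lemma integrable_cluster_size: "integrable M (\<lambda>\<omega>. real (cluster_size C0 \<omega>))"
proof (rule integrableI_bounded)
  show "(\<integral>\<^sup>+\<omega>. ennreal (norm (real (cluster_size C0 \<omega>))) \<partial>M) < \<infinity>"
    using mean_cluster_size_finite by (simp add: cluster_size_def)
qed measurable

text \<open>The tangent of the convex function \<Lambda> at 0, obtained from
  \<open>1 + y \<le> exp y\<close>. Its slope, the mean number of points per unit length, is where
  the rate function vanishes.\<close>

lemma mgf_tangent:
  assumes "\<theta> \<in> size_domain M C0"
  shows "\<theta> * (\<nu> * (\<integral>\<omega>. real (cluster_size C0 \<omega>) \<partial>M)) \<le> \<nu> * (mgf \<theta> - 1)"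
proof -
  have "\<theta> * (\<integral>\<omega>. real (cluster_size C0 \<omega>) \<partial>M) + 1 = (\<integral>\<omega>. \<theta> * real (cluster_size C0 \<omega>) + 1 \<partial>M)"
    using integrable_cluster_size by (simp add: prob_space)
  also have "\<dots> \<le> mgf \<theta>"
    unfolding mgf_def using integrable_cluster_size integrable_exp_size[OF assms]
    by (intro integral_mono) (auto simp: add.commute exp_ge_add_one_self)
  finally have "\<nu> * (\<theta> * (\<integral>\<omega>. real (cluster_size C0 \<omega>) \<partial>M)) \<le> \<nu> * (mgf \<theta> - 1)"
    using intensity_pos by (intro mult_left_mono) auto
  then show ?thesis by (simp add: mult_ac)
qed

lemma fenchel_legendre_mean:
  "fenchel_legendre (cluster_Lambda M \<nu> C0) (\<nu> * (\<integral>\<omega>. real (cluster_size C0 \<omega>) \<partial>M)) \<le> 0"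
  unfolding fenchel_legendre_def
proof (rule SUP_least)
  fix \<theta>
  show "ereal (\<theta> * (\<nu> * (\<integral>\<omega>. real (cluster_size C0 \<omega>) \<partial>M))) - cluster_Lambda M \<nu> C0 \<theta> \<le> 0"
    using mgf_tangent[of \<theta>]
    by (cases "\<theta> \<in> size_domain M C0") (auto simp: cluster_Lambda_eq cluster_Lambda_top)
qed

lemma fenchel_legendre_nonneg:
  assumes "0 \<in> size_domain M C0"
  shows "0 \<le> fenchel_legendre (cluster_Lambda M \<nu> C0) x"
  using fenchel_legendre_ge[OF assms, of x] by (simp add: mgf_zero zero_ereal_def)

text \<open>As \<theta> tends to minus infinity, \<open>\<theta> * x\<close> is unbounded while
  \<Lambda> stays nonpositive. The minimum in the witness keeps it nonpositive also for
  \<open>B < 0\<close>.\<close>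

lemma fenchel_legendre_neg:
  assumes "0 \<in> size_domain M C0" "x < 0"
  shows "fenchel_legendre (cluster_Lambda M \<nu> C0) x = \<infinity>"
proof (rule ereal_top)
  fix B
  define \<theta> where "\<theta> = min 0 (B / x)"
  have mem: "\<theta> \<in> size_domain M C0" by (rule size_domain_downward[OF assms(1)]) (simp add: \<theta>_def)
  have "mgf \<theta> \<le> mgf 0" using size_mgf_mono[of \<theta> 0] mem assms by (simp add: size_mgf_eq \<theta>_def)
  then have "\<nu> * (mgf \<theta> - 1) \<le> 0" using intensity_pos by (simp add: mgf_zero mult_nonneg_nonpos)
  moreover have "B \<le> \<theta> * x"
  proof -
    have "\<theta> \<le> B / x" by (simp add: \<theta>_def)
    then have "B / x * x \<le> \<theta> * x" using assms(2) by (intro mult_right_mono_neg) auto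
    then show ?thesis using assms(2) by simp
  qed
  ultimately have "ereal B \<le> ereal (\<theta> * x - \<nu> * (mgf \<theta> - 1))" by simp
  also have "\<dots> \<le> fenchel_legendre (cluster_Lambda M \<nu> C0) x" by (rule fenchel_legendre_ge[OF mem])
  finally show "ereal B \<le> fenchel_legendre (cluster_Lambda M \<nu> C0) x" .
qed

lemma closed_fenchel_legendre_le: "closed {x. fenchel_legendre (cluster_Lambda M \<nu> C0) x \<le> a}"
proof -
  have "closed {x. ereal (\<theta> * x) - cluster_Lambda M \<nu> C0 \<theta> \<le> a}" for \<theta>
  proof (cases "\<theta> \<in> size_domain M C0")
    case True
    have "closed {x. ereal (\<theta> * x - \<nu> * (mgf \<theta> - 1)) \<le> a}"
      by (intro closed_Collect_le continuous_intros continuous_on_ereal)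
    then show ?thesis using True by (simp add: cluster_Lambda_eq)
  next
    case False
    then show ?thesis by (simp add: cluster_Lambda_top)
  qed
  then have "closed (\<Inter>\<theta>. {x. ereal (\<theta> * x) - cluster_Lambda M \<nu> C0 \<theta> \<le> a})" by blast
  moreover have "(\<Inter>\<theta>. {x. ereal (\<theta> * x) - cluster_Lambda M \<nu> C0 \<theta> \<le> a})
      = {x. fenchel_legendre (cluster_Lambda M \<nu> C0) x \<le> a}"
    by (auto simp: fenchel_legendre_def SUP_le_iff)
  ultimately show ?thesis by simp
qed

text \<open>The domain contains some \<open>e > 0\<close> together with \<open>- e\<close>; the two
  corresponding affine minorants of the rate function confine each level set to a bounded
  interval.\<close>

lemma good_rate_function_fenchel_legendre:
  assumes "0 \<in> interior (size_domain M C0)"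
  shows "good_rate_function (fenchel_legendre (cluster_Lambda M \<nu> C0))"
proof -
  have zero: "0 \<in> size_domain M C0" using assms interior_subset by blast
  obtain e where e: "0 < e" "cball 0 e \<subseteq> size_domain M C0"
    using assms by (auto simp: mem_interior_cball)
  have mem: "e \<in> size_domain M C0" "- e \<in> size_domain M C0"
    using e by (auto intro!: subsetD[OF e(2)])
  have "compact {x. fenchel_legendre (cluster_Lambda M \<nu> C0) x \<le> ereal a}" for a
  proof -
    have "{x. fenchel_legendre (cluster_Lambda M \<nu> C0) x \<le> ereal a}
        \<subseteq> {- ((a + \<nu> * (mgf (- e) - 1)) / e)..(a + \<nu> * (mgf e - 1)) / e}"
    proof
      fix x assume "x \<in> {x. fenchel_legendre (cluster_Lambda M \<nu> C0) x \<le> ereal a}"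
      then have x: "fenchel_legendre (cluster_Lambda M \<nu> C0) x \<le> ereal a" by simp
      have "ereal (e * x - \<nu> * (mgf e - 1)) \<le> ereal a" "ereal (- e * x - \<nu> * (mgf (- e) - 1)) \<le> ereal a"
        by (rule order_trans[OF fenchel_legendre_ge[OF mem(1)] x], rule order_trans[OF fenchel_legendre_ge[OF mem(2)] x])
      then have "e * x \<le> a + \<nu> * (mgf e - 1)" "e * - x \<le> a + \<nu> * (mgf (- e) - 1)" by simp_all
      then have "x \<le> (a + \<nu> * (mgf e - 1)) / e" "- x \<le> (a + \<nu> * (mgf (- e) - 1)) / e"
        using e(1) by (simp_all only: pos_le_divide_eq mult.commute)
      then show "x \<in> {- ((a + \<nu> * (mgf (- e) - 1)) / e)..(a + \<nu> * (mgf e - 1)) / e}" by auto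
    qed
    then have "bounded {x. fenchel_legendre (cluster_Lambda M \<nu> C0) x \<le> ereal a}"
      by (rule bounded_subset[rotated]) simp
    then show ?thesis using closed_fenchel_legendre_le by (simp add: compact_eq_bounded_closed)
  qed
  then show ?thesis
    using closed_fenchel_legendre_le fenchel_legendre_nonneg[OF zero]
    by (simp add: good_rate_function_def rate_function_def)
qed

section \<open>Range of the derivative of the moment generating function\<close>

lemma smooth_on_interior:
  assumes ES: "essentially_smooth (size_mgf M C0)"
  obtains \<phi>' where
    "\<And>\<theta>. \<theta> \<in> interior (size_domain M C0) \<Longrightarrow> (mgf has_real_derivative \<phi>' \<theta>) (at \<theta>)"
    "\<And>\<theta>. \<theta> \<in> interior (size_domain M C0) \<Longrightarrow> 0 \<le> \<phi>' \<theta>"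
    "\<forall>s b. (\<forall>n. s n \<in> interior (size_domain M C0)) \<longrightarrow> b \<in> frontier (interior (size_domain M C0)) \<longrightarrow>
      s \<longlonglongrightarrow> b \<longrightarrow> filterlim (\<lambda>n. \<phi>' (s n)) at_top sequentially"
proof -
  let ?D = "interior (size_domain M C0)"
  define f where "f \<theta> = real_of_ereal (size_mgf M C0 \<theta>)" for \<theta>
  have ES': "\<And>\<theta>. \<theta> \<in> ?D \<Longrightarrow> f differentiable (at \<theta>)"
    "\<And>s b. (\<And>n. s n \<in> ?D) \<Longrightarrow> b \<in> frontier ?D \<Longrightarrow> s \<longlonglongrightarrow> b \<Longrightarrow>
        filterlim (\<lambda>n. \<bar>deriv f (s n)\<bar>) at_top sequentially"
    using ES unfolding essentially_smooth_def Let_def f_def[abs_def] size_domain_def by blast+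
  have f_eq: "f \<theta> = mgf \<theta>" if "\<theta> \<in> ?D" for \<theta>
  proof -
    have "\<theta> \<in> size_domain M C0" using that interior_subset by blast
    then show ?thesis by (simp add: f_def size_mgf_eq)
  qed
  \<comment> \<open>Smoothness is assumed of the real part \<open>f\<close> of the extended-valued
    function; it agrees with \<open>mgf\<close> on an open set, so the derivative carries
    over.\<close>
  have deriv: "(mgf has_real_derivative deriv f \<theta>) (at \<theta>)" if "\<theta> \<in> ?D" for \<theta>
  proof -
    have "(f has_real_derivative deriv f \<theta>) (at \<theta>)"
      using ES'(1)[OF that] by (simp add: DERIV_deriv_iff_real_differentiable)
    then show ?thesis
      by (rule has_field_derivative_transform_within_open[OF _ open_interior that f_eq])
  qed
  \<comment> \<open>Monotonicity of \<open>mgf\<close> removes the absolute value from the steepness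
    condition: slopes tend to plus infinity at the frontier.\<close>
  have nonneg: "0 \<le> deriv f \<theta>" if mem: "\<theta> \<in> ?D" for \<theta>
  proof (rule ccontr)
    assume "\<not> ?thesis"
    then have "deriv f \<theta> < 0" by simp
    from DERIV_neg_dec_right[OF deriv[OF mem] this] obtain d where d: "0 < d"
      "\<And>h. 0 < h \<Longrightarrow> h < d \<Longrightarrow> mgf (\<theta> + h) < mgf \<theta>" by auto
    obtain e where e: "0 < e" "cball \<theta> e \<subseteq> size_domain M C0"
      using mem by (auto simp: mem_interior_cball)
    define h where "h = min (d / 2) e"
    have h: "0 < h" "h < d" "h \<le> e" using d(1) e(1) by (auto simp: h_def)
    have "\<theta> + h \<in> size_domain M C0" using h by (intro subsetD[OF e(2)]) (simp add: dist_real_def)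
    moreover have "\<theta> \<in> size_domain M C0" using mem interior_subset by blast
    ultimately have "mgf \<theta> \<le> mgf (\<theta> + h)"
      using size_mgf_mono[of \<theta> "\<theta> + h"] h by (simp add: size_mgf_eq)
    then show False using d(2)[OF h(1,2)] by simp
  qed
  show thesis
  proof (rule that[OF deriv nonneg])
    show "\<forall>s b. (\<forall>n. s n \<in> ?D) \<longrightarrow> b \<in> frontier ?D \<longrightarrow> s \<longlonglongrightarrow> b \<longrightarrow>
        filterlim (\<lambda>n. deriv f (s n)) at_top sequentially"
    proof (intro allI impI)
      fix s b
      assume s: "\<forall>n. s n \<in> ?D" "b \<in> frontier ?D" "s \<longlonglongrightarrow> b"
      then have "filterlim (\<lambda>n. \<bar>deriv f (s n)\<bar>) at_top sequentially" by (intro ES'(2)) auto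
      moreover have "\<bar>deriv f (s n)\<bar> = deriv f (s n)" for n using nonneg s(1) by simp
      ultimately show "filterlim (\<lambda>n. deriv f (s n)) at_top sequentially" by simp
    qed
  qed
qed

text \<open>A cluster contains its immigrant, so its size is almost surely at least 1. The resulting
  growth yields unbounded slopes when the domain has no right end point.\<close>

lemma mgf_ge_exp:
  assumes "\<theta> \<in> size_domain M C0" "0 \<le> \<theta>"
  shows "exp \<theta> \<le> mgf \<theta>"
proof -
  have "(\<integral>\<omega>. exp \<theta> \<partial>M) \<le> mgf \<theta>"
    unfolding mgf_def
  proof (rule integral_mono_AE)
    show "AE \<omega> in M. exp \<theta> \<le> exp (\<theta> * real (cluster_size C0 \<omega>))"
      using AE_cluster_size_pos
    proof eventually_elim
      case (elim \<omega>)
      then have "\<theta> * 1 \<le> \<theta> * real (cluster_size C0 \<omega>)" using assms(2) by (intro mult_left_mono) auto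
      then show ?case by simp
    qed
  qed (use integrable_exp_size[OF assms(1)] in auto)
  then show ?thesis by (simp add: prob_space)
qed

text \<open>Over an interval of length \<open>u\<close> to the left of 0 the nonnegative function
  \<open>mgf\<close> varies by at most \<open>mgf 0 = 1\<close>, so the mean value theorem yields a
  slope of at most \<open>1 / u\<close>.\<close>

lemma derivative_small:
  assumes D: "D = interior (size_domain M C0)" and zero: "0 \<in> D"
    and deriv: "\<And>\<theta>. \<theta> \<in> D \<Longrightarrow> (mgf has_real_derivative \<phi>' \<theta>) (at \<theta>)" and "0 < \<epsilon>"
  shows "\<exists>\<eta>\<in>D. \<eta> < 0 \<and> \<phi>' \<eta> < \<epsilon>"
proof -
  have zero': "0 \<in> size_domain M C0" using zero interior_subset unfolding D by blast
  have mem: "\<theta> \<in> D" if "\<theta> < 0" for \<theta> using interior_size_domain[OF zero' that] by (simp add: D)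
  obtain u :: real where u: "1 / \<epsilon> < u" "0 < u" using assms(4) by (meson less_trans gt_ex zero_less_divide_1_iff)
  have "\<exists>l z. - u < z \<and> z < 0 \<and> DERIV mgf z :> l \<and> mgf 0 - mgf (- u) = (0 - (- u)) * l"
  proof (rule MVT)
    show "continuous_on {- u..0} mgf"
    proof (intro continuous_at_imp_continuous_on ballI)
      fix x assume "x \<in> {- u..0}"
      then have "x \<in> D" using mem[of x] zero by (cases "x = 0") auto
      then show "isCont mgf x" using deriv DERIV_isCont by blast
    qed
    show "mgf differentiable (at x)" if "- u < x" "x < 0" for x
      using deriv[OF mem[OF that(2)]] by (auto simp: real_differentiable_def)
  qed (use u in simp)
  then obtain l z where z: "- u < z" "z < 0" "DERIV mgf z :> l" "mgf 0 - mgf (- u) = u * l" by auto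
  have "l = \<phi>' z" using DERIV_unique[OF z(3) deriv[OF mem[OF z(2)]]] .
  moreover have "0 \<le> mgf (- u)" by (simp add: mgf_def)
  then have "u * l \<le> 1" using z(4) by (simp add: mgf_zero)
  then have "l \<le> 1 / u" using u(2) by (simp add: pos_le_divide_eq mult.commute)
  moreover have "1 / u < \<epsilon>" using u assms(4) by (simp add: field_simps)
  ultimately show ?thesis using mem[OF z(2)] z(2) by (intro bexI[of _ z]) auto
qed

text \<open>Two mechanisms: exponential growth forces large slopes if the domain is unbounded above,
  and steepness at the right end point does so otherwise.\<close>

lemma derivative_large:
  assumes D: "D = interior (size_domain M C0)" and zero: "0 \<in> D"
    and deriv: "\<And>\<theta>. \<theta> \<in> D \<Longrightarrow> (mgf has_real_derivative \<phi>' \<theta>) (at \<theta>)"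
    and steep: "\<forall>s b. (\<forall>n. s n \<in> D) \<longrightarrow> b \<in> frontier D \<longrightarrow> s \<longlonglongrightarrow> b \<longrightarrow> filterlim (\<lambda>n. \<phi>' (s n)) at_top sequentially"
  shows "\<exists>\<eta>\<in>D. 0 < \<eta> \<and> a < \<phi>' \<eta>"
proof (cases "bdd_above D")
  case False
  have mem: "\<theta> \<in> D" for \<theta>
  proof -
    obtain d where "d \<in> D" "\<theta> < d" using False by (metis bdd_aboveI not_le)
    then show ?thesis using interior_size_domain[of d \<theta>] interior_subset unfolding D by blast
  qed
  \<comment> \<open>Chosen so that \<open>(1 + u / 2)\<^sup>2 \<le> exp u \<le> 1 + u * l\<close>
    gives \<open>l \<ge> 1 + u / 4 > a\<close>; the maximum with 1 keeps \<open>u\<close>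
    positive.\<close>
  define u where "u = 4 * max 1 a"
  have u: "0 < u" by (simp add: u_def)
  have "\<exists>l z. 0 < z \<and> z < u \<and> DERIV mgf z :> l \<and> mgf u - mgf 0 = (u - 0) * l"
  proof (rule MVT[OF u])
    show "continuous_on {0..u} mgf"
      using deriv mem DERIV_isCont by (intro continuous_at_imp_continuous_on ballI) blast
    show "mgf differentiable (at x)" for x using deriv[OF mem] by (auto simp: real_differentiable_def)
  qed
  then obtain l z where z: "0 < z" "z < u" "DERIV mgf z :> l" "mgf u - mgf 0 = u * l" by auto
  have "l = \<phi>' z" using DERIV_unique[OF z(3) deriv[OF mem]] .
  moreover have "a < l"
  proof -
    have "(1 + u / 2)\<^sup>2 \<le> (exp (u / 2))\<^sup>2"
      using u exp_ge_add_one_self[of "u / 2"] by (intro power_mono) auto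
    also have "\<dots> = exp u" by (simp add: exp_double[symmetric])
    also have "\<dots> \<le> mgf u"
      using mem[of u] interior_subset u unfolding D by (intro mgf_ge_exp) auto
    finally have "u * (1 + u / 4) \<le> u * l"
      using z(4) by (simp add: mgf_zero power2_eq_square algebra_simps)
    then have "1 + u / 4 \<le> l" using u by simp
    then show ?thesis by (simp add: u_def max_def split: if_splits)
  qed
  ultimately show ?thesis using z(1) mem by blast
next
  case True
  define b where "b = Sup D"
  have op: "open D" by (simp add: D)
  obtain e where e: "0 < e" "ball 0 e \<subseteq> D" using op zero openE by blast
  have "e / 2 \<in> D" using e by (intro subsetD[OF e(2)]) (simp add: dist_real_def)
  then have b_pos: "0 < b" using cSup_upper[OF _ True, of "e / 2"] e(1) by (simp add: b_def)
  have below: "\<theta> \<in> D" if "\<theta> < b" for \<theta>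
  proof -
    obtain d where "d \<in> D" "\<theta> < d" using \<open>\<theta> < b\<close> zero True less_cSup_iff[of D \<theta>] by (auto simp: b_def)
    then show ?thesis using interior_size_domain[of d \<theta>] interior_subset unfolding D by blast
  qed
  have "b \<notin> D"
  proof
    assume "b \<in> D"
    then obtain r where r: "0 < r" "ball b r \<subseteq> D" using op openE by blast
    then have "b + r / 2 \<in> D" by (intro subsetD[OF r(2)]) (simp add: dist_real_def)
    then show False using cSup_upper[OF _ True] r(1) by (fastforce simp: b_def)
  qed
  moreover have "b \<in> closure D" unfolding b_def using zero True by (intro closure_contains_Sup) auto
  ultimately have front: "b \<in> frontier D" using op by (simp add: frontier_def interior_open)
  \<comment> \<open>The denominators start at 2, which keeps every term strictly between 0 and
    \<open>b\<close>.\<close>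
  define s where "s n = b - b * inverse (real (Suc (Suc n)))" for n
  have s: "0 < s n" "s n < b" for n
  proof -
    have "0 < inverse (real (Suc (Suc n)))" "inverse (real (Suc (Suc n))) < 1"
      by (auto intro!: inverse_less_1_iff[THEN iffD2])
    then have "0 < b * inverse (real (Suc (Suc n)))" "b * inverse (real (Suc (Suc n))) < b * 1"
      using b_pos by (auto simp del: of_nat_Suc intro!: mult_strict_left_mono)
    then show "0 < s n" "s n < b" unfolding s_def by linarith+
  qed
  have "(\<lambda>n. b - b * inverse (real (Suc (Suc n)))) \<longlonglongrightarrow> b - b * 0"
    by (intro tendsto_intros LIMSEQ_Suc[OF LIMSEQ_inverse_real_of_nat])
  then have "s \<longlonglongrightarrow> b" unfolding s_def[abs_def] by simp
  with steep below s(2) front have "filterlim (\<lambda>n. \<phi>' (s n)) at_top sequentially" by blast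
  then
  have "eventually (\<lambda>n. a < \<phi>' (s n)) sequentially" by (simp add: filterlim_at_top_dense)
  then obtain n where "a < \<phi>' (s n)" by (auto simp: eventually_sequentially)
  then show ?thesis using s[of n] below[OF s(2)] by blast
qed

text \<open>Darboux: the minimiser of \<open>mgf \<theta> - y * \<theta>\<close> between a point of small slope and one of large slope.\<close>

lemma derivative_surjective:
  assumes D: "D = interior (size_domain M C0)" and zero: "0 \<in> D"
    and deriv: "\<And>\<theta>. \<theta> \<in> D \<Longrightarrow> (mgf has_real_derivative \<phi>' \<theta>) (at \<theta>)"
    and steep: "\<forall>s b. (\<forall>n. s n \<in> D) \<longrightarrow> b \<in> frontier D \<longrightarrow> s \<longlonglongrightarrow> b \<longrightarrow> filterlim (\<lambda>n. \<phi>' (s n)) at_top sequentially"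
    and y: "0 < y"
  shows "\<exists>\<eta>\<in>D. \<phi>' \<eta> = y"
proof -
  obtain l where l: "l \<in> D" "l < 0" "\<phi>' l < y" using derivative_small[OF D zero deriv y] by blast
  obtain u where u: "u \<in> D" "0 < u" "y < \<phi>' u" using derivative_large[OF D zero deriv steep, where a=y] by blast
  have mem: "\<theta> \<in> D" if "\<theta> \<in> {l..u}" for \<theta>
  proof (cases "\<theta> = u")
    case False
    then have "\<theta> < u" using that by simp
    then show ?thesis using interior_size_domain[of u \<theta>] u(1) interior_subset unfolding D by blast
  qed (use u in simp)
  define \<psi> where "\<psi> \<theta> = mgf \<theta> - y * \<theta>" for \<theta>
  have d\<psi>: "(\<psi> has_real_derivative \<phi>' \<theta> - y) (at \<theta>)" if "\<theta> \<in> {l..u}" for \<theta>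
    unfolding \<psi>_def[abs_def] using deriv[OF mem[OF that]] by (auto intro!: derivative_eq_intros)
  have lu: "l < u" using l(2) u(2) by simp
  have "continuous_on {l..u} \<psi>"
    using d\<psi> DERIV_isCont by (intro continuous_at_imp_continuous_on ballI) blast
  then obtain c where c: "c \<in> {l..u}" "\<And>\<theta>. \<theta> \<in> {l..u} \<Longrightarrow> \<psi> c \<le> \<psi> \<theta>"
    using continuous_attains_inf[of "{l..u}" \<psi>] lu by auto
  have "c \<noteq> l"
  proof
    assume "c = l"
    have "\<phi>' l - y < 0" using l(3) by simp
    from DERIV_neg_dec_right[OF d\<psi> this] lu obtain d where d: "0 < d"
      "\<And>h. 0 < h \<Longrightarrow> h < d \<Longrightarrow> \<psi> (l + h) < \<psi> l" by auto
    define h where "h = min (d / 2) (u - l)"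
    have "0 < h" "h < d" "l + h \<in> {l..u}" using d(1) lu by (auto simp: h_def)
    then show False using d(2)[of h] c(2)[of "l + h"] \<open>c = l\<close> by simp
  qed
  moreover have "c \<noteq> u"
  proof
    assume "c = u"
    have "0 < \<phi>' u - y" using u(3) by simp
    from DERIV_pos_inc_left[OF d\<psi> this] lu obtain d where d: "0 < d"
      "\<And>h. 0 < h \<Longrightarrow> h < d \<Longrightarrow> \<psi> (u - h) < \<psi> u" by auto
    define h where "h = min (d / 2) (u - l)"
    have "0 < h" "h < d" "u - h \<in> {l..u}" using d(1) lu by (auto simp: h_def)
    then show False using d(2)[of h] c(2)[of "u - h"] \<open>c = u\<close> by simp
  qed
  ultimately have lcu: "l < c" "c < u" using c(1) by auto
  have "\<phi>' c - y = 0"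
  proof (rule DERIV_local_min[OF d\<psi>[OF c(1)]])
    show "0 < min (c - l) (u - c)" using lcu by simp
    show "\<forall>\<theta>. \<bar>c - \<theta>\<bar> < min (c - l) (u - c) \<longrightarrow> \<psi> c \<le> \<psi> \<theta>"
      using c(2) by (auto simp: abs_if split: if_splits)
  qed
  then show ?thesis using mem[OF c(1)] by (intro bexI[of _ c]) auto
qed

end

theorem theorem3p2:
  fixes M :: "'a measure"
    and \<nu> :: real
    and X :: "nat \<Rightarrow> 'a \<Rightarrow> real"
    and C :: "nat \<Rightarrow> 'a \<Rightarrow> real set"
    and C0 :: "'a \<Rightarrow> real set"
  assumes "poisson_cluster_process M \<nu> X C C0"
    and "essentially_smooth (size_mgf M C0)"
    and "0 \<in> interior (size_domain M C0)"
    and "\<And>\<theta>. \<theta> \<in> interior (size_domain M C0) \<Longrightarrow>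
           (\<integral>\<^sup>+\<omega>. ennreal (cluster_radius C0 \<omega> * exp (\<theta> * real (cluster_size C0 \<omega>))) \<partial>M) < \<infinity>"
  shows "large_deviation_principle M
           (\<lambda>t \<omega>. real (card (cluster_process C \<omega> \<inter> {0<..t})) / t)
           (fenchel_legendre (cluster_Lambda M \<nu> C0)) (\<lambda>t. t)
         \<and> good_rate_function (fenchel_legendre (cluster_Lambda M \<nu> C0))"
proof -
  interpret poisson_cluster_process M \<nu> X C C0 by (rule assms(1))
  note ES = assms(2) and zero = assms(3) and radius = assms(4)
  define D where "D = interior (size_domain M C0)"
  define J where "J = fenchel_legendre (cluster_Lambda M \<nu> C0)"
  define Y where "Y t \<omega> = real (card (cluster_process C \<omega> \<inter> {0<..t}))" for t \<omega>
  define \<Lambda> where "\<Lambda> \<theta> = \<nu> * (mgf \<theta> - 1)" for \<theta>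
  have D_sub: "\<theta> \<in> size_domain M C0" if "\<theta> \<in> D" for \<theta> using that interior_subset unfolding D_def by blast
  have zero_D: "0 \<in> D" using zero by (simp add: D_def)
  have Y_meas [measurable]: "Y t \<in> borel_measurable M" for t
    unfolding Y_def[abs_def] by (rule borel_measurable_card_cluster_process)
  obtain \<theta>0 where \<theta>0: "0 < \<theta>0" "\<theta>0 \<in> D"
  proof -
    obtain e where e: "0 < e" "ball 0 e \<subseteq> D" using zero openE[of D 0] unfolding D_def by auto
    then have "e / 2 \<in> D" by (intro subsetD[OF e(2)]) (simp add: dist_real_def)
    then show thesis using that[of "e / 2"] e(1) by simp
  qed
  interpret mgf_asymptotics M Y D \<Lambda>
  proof
    show "open D" by (simp add: D_def)
    fix \<theta> assume \<theta>: "\<theta> \<in> D"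
    show "\<exists>K. \<forall>t>0. exp (t * \<Lambda> \<theta> - K) \<le> (\<integral>\<omega>. exp (\<theta> * Y t \<omega>) \<partial>M)
        \<and> (\<integral>\<omega>. exp (\<theta> * Y t \<omega>) \<partial>M) \<le> exp (t * \<Lambda> \<theta> + K)"
      unfolding Y_def
    proof (rule mgf_count_bounds[OF _ _ _ \<theta>0(1)])
      \<comment> \<open>The radius condition at the interior parameter 0 says that the mean radius
        is finite.\<close>
      show "(\<integral>\<^sup>+\<omega>. ennreal (cluster_radius C0 \<omega>) \<partial>M) < \<infinity>" using radius[OF zero] by simp
    qed (use \<theta> \<theta>0 radius integrable_exp_size D_sub in \<open>auto simp: \<Lambda>_def mgf_def D_def\<close>)
  qed simp
  obtain \<phi>' where deriv: "\<And>\<theta>. \<theta> \<in> D \<Longrightarrow> (mgf has_real_derivative \<phi>' \<theta>) (at \<theta>)"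
    and deriv_nonneg: "\<And>\<theta>. \<theta> \<in> D \<Longrightarrow> 0 \<le> \<phi>' \<theta>"
    and steep: "\<forall>s b. (\<forall>n. s n \<in> D) \<longrightarrow> b \<in> frontier D \<longrightarrow> s \<longlonglongrightarrow> b \<longrightarrow> filterlim (\<lambda>n. \<phi>' (s n)) at_top sequentially"
    using smooth_on_interior[OF ES] unfolding D_def by blast
  have deriv_\<Lambda>: "(\<Lambda> has_real_derivative \<nu> * \<phi>' \<theta>) (at \<theta>)" if "\<theta> \<in> D" for \<theta>
    unfolding \<Lambda>_def[abs_def] using deriv[OF that] by (auto intro!: derivative_eq_intros)
  have J_ge: "ereal (\<theta> * x - \<Lambda> \<theta>) \<le> J x" if "\<theta> \<in> D" for \<theta> x
    unfolding J_def \<Lambda>_def by (rule fenchel_legendre_ge[OF D_sub[OF that]])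
  have good: "good_rate_function J" unfolding J_def by (rule good_rate_function_fenchel_legendre[OF zero])
  have flip: "a \<le> - b" if "b \<le> - a" for a b :: ereal
    using that by (subst ereal_minus_le_minus[symmetric]) simp
  \<comment> \<open>The rate is at most 0 here, so a closed set on which the rate exceeds some
    \<open>c \<ge> 0\<close> avoids \<open>m\<close> and splits into two tails.\<close>
  define m where "m = \<nu> * (\<integral>\<omega>. real (cluster_size C0 \<omega>) \<partial>M)"
  have upper: "Limsup at_top (\<lambda>t. ereal (1 / t) * ereal_log (prob {\<omega> \<in> space M. Y t \<omega> / t \<in> B}))
      \<le> - (INF x\<in>closure B. J x)" (is "?U \<le> - ?I") if B: "B \<in> sets borel" for B
  proof -
    \<comment> \<open>Comparing with real numbers \<open>c\<close> below the infimum treats finite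
      and infinite infima alike.\<close>
    have key: "?U \<le> ereal (- c)" if c: "ereal c < ?I" for c
    proof (cases "0 \<le> c")
      case True
      have J_gt: "ereal c < J x" if "x \<in> closure B" for x
        using c INF_lower[OF that, of J] by (rule less_le_trans)
      have "m \<notin> closure B"
        using J_gt[of m] fenchel_legendre_mean True unfolding J_def m_def
        by (metis ereal_less_eq(5) not_less order_trans)
      moreover have "\<exists>\<theta>\<in>D. c < \<theta> * x - \<Lambda> \<theta>" if "x \<in> closure B" for x
        using fenchel_legendre_less[of c x] J_gt[OF that] by (simp add: J_def D_def \<Lambda>_def)
      moreover have "\<theta> * m \<le> \<Lambda> \<theta>" if "\<theta> \<in> D" for \<theta>
        unfolding m_def \<Lambda>_def by (rule mgf_tangent[OF D_sub[OF that]])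
      ultimately have "\<exists>K. \<forall>t>0. prob {\<omega> \<in> space M. Y t \<omega> / t \<in> closure B} \<le> exp (- t * c + K)"
        using True by (intro upper_bound_closed[OF closed_closure, of m]) auto
      then obtain K where K: "\<forall>t>0. prob {\<omega> \<in> space M. Y t \<omega> / t \<in> closure B} \<le> exp (- t * c + K)" ..
      show ?thesis
      proof (rule Limsup_scaled_log_le)
        show "eventually (\<lambda>t. prob {\<omega> \<in> space M. Y t \<omega> / t \<in> B} \<le> exp (t * - c + K)) at_top"
          using eventually_gt_at_top[of "0::real"]
        proof eventually_elim
          case (elim t)
          have "prob {\<omega> \<in> space M. Y t \<omega> / t \<in> B} \<le> prob {\<omega> \<in> space M. Y t \<omega> / t \<in> closure B}"
          proof (rule finite_measure_mono)
            show "{\<omega> \<in> space M. Y t \<omega> / t \<in> B} \<subseteq> {\<omega> \<in> space M. Y t \<omega> / t \<in> closure B}"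
              using closure_subset by blast
            have [measurable]: "closure B \<in> sets borel" by simp
            show "{\<omega> \<in> space M. Y t \<omega> / t \<in> closure B} \<in> events" by measurable
          qed
          also have "\<dots> \<le> exp (- t * c + K)" using K elim by blast
          finally show ?case by simp
        qed
      qed simp
    next
      \<comment> \<open>For negative \<open>c\<close> the claimed bound on the probability is at
        least 1.\<close>
      case False
      show ?thesis
      proof (rule Limsup_scaled_log_le[where K=0])
        show "eventually (\<lambda>t. prob {\<omega> \<in> space M. Y t \<omega> / t \<in> B} \<le> exp (t * - c + 0)) at_top"
          using eventually_gt_at_top[of "0::real"]
        proof eventually_elim
          case (elim t)
          have "0 \<le> t * - c" using elim False by (intro mult_nonneg_nonneg) auto
          then have "1 \<le> exp (t * - c + 0)" by simp
          then show ?case using prob_le_1 by (rule order_trans[rotated])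
        qed
      qed simp
    qed
    have "?I \<le> - ?U"
    proof (rule dense_le)
      fix z assume z: "z < ?I"
      show "z \<le> - ?U"
      proof (cases z)
        case (real c)
        then have "?U \<le> - z" using key[of c] z by simp
        then show ?thesis by (rule flip)
      qed (use z in auto)
    qed
    then show ?thesis by (rule flip)
  qed
  have lower: "- (INF x\<in>interior B. J x)
      \<le> Liminf at_top (\<lambda>t. ereal (1 / t) * ereal_log (prob {\<omega> \<in> space M. Y t \<omega> / t \<in> B}))"
      (is "- ?I \<le> ?L") if B: "B \<in> sets borel" for B
  proof -
    have tilt: "ereal (\<Lambda> \<eta> - \<eta> * x) \<le> ?L" if "\<eta> \<in> D" "\<nu> * \<phi>' \<eta> = x" "x \<in> interior B" for \<eta> x
      using lower_bound_open[OF that(1) _ open_interior that(3) B interior_subset] deriv_\<Lambda>[OF that(1)]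
      by (simp add: that(2))
    have "- ?L \<le> J x" if x: "x \<in> interior B" for x
    proof -
      consider "x < 0" | "x = 0" | "0 < x" by linarith
      then show ?thesis
      proof cases
        case 1
        then have "J x = \<infinity>" unfolding J_def using D_sub[OF zero_D] by (rule fenchel_legendre_neg[rotated])
        then show ?thesis by simp
      next
        case 2
        \<comment> \<open>Slopes of \<Lambda> come arbitrarily close to 0 from above at negative
          parameters, so a nearby \<open>x'\<close> replaces 0. Since
          \<open>\<eta> * x' \<le> 0\<close>, the tilted bound is at least
          \<open>\<Lambda> \<eta>\<close>, which is minus the \<eta>-term of the supremum defining
          \<open>J 0\<close>.\<close>
        obtain e where e: "0 < e" "ball 0 e \<subseteq> interior B"
          using x 2 openE[OF open_interior, of 0 B] by auto
        obtain \<eta> where \<eta>: "\<eta> \<in> D" "\<eta> < 0" "\<phi>' \<eta> < e / \<nu>"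
          using derivative_small[OF D_def zero_D deriv, where \<epsilon>="e / \<nu>"] e(1) intensity_pos by auto
        define x' where "x' = \<nu> * \<phi>' \<eta>"
        have x': "0 \<le> x'" "x' < e"
          using deriv_nonneg[OF \<eta>(1)] \<eta>(3) intensity_pos by (auto simp: x'_def pos_less_divide_eq mult.commute)
        have "x' \<in> interior B" using x' by (intro subsetD[OF e(2)]) (simp add: dist_real_def)
        then have L: "ereal (\<Lambda> \<eta> - \<eta> * x') \<le> ?L" using tilt[OF \<eta>(1)] by (simp add: x'_def)
        have "\<eta> * x' \<le> 0" using \<eta>(2) x'(1) by (intro mult_nonpos_nonneg) auto
        then have "ereal (\<Lambda> \<eta>) \<le> ereal (\<Lambda> \<eta> - \<eta> * x')" by simp
        also note L
        finally have "- ?L \<le> - ereal (\<Lambda> \<eta>)" by (simp only: ereal_minus_le_minus)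
        also have "\<dots> = ereal (- \<Lambda> \<eta>)" by simp
        also have "\<dots> \<le> J x" using J_ge[OF \<eta>(1), of 0] 2 by simp
        finally show ?thesis .
      next
        case 3
        \<comment> \<open>The target slope is divided by \<nu> because \<phi>' is the derivative of
          \<open>mgf\<close>, whereas \<Lambda> has derivative
          \<open>\<nu> * \<phi>'\<close>.\<close>
        obtain \<eta> where \<eta>: "\<eta> \<in> D" "\<phi>' \<eta> = x / \<nu>"
          using derivative_surjective[OF D_def zero_D deriv steep, where y="x / \<nu>"] 3 intensity_pos by auto
        then have "ereal (\<Lambda> \<eta> - \<eta> * x) \<le> ?L" using tilt[OF \<eta>(1) _ x] intensity_pos by simp
        then have "- ?L \<le> - ereal (\<Lambda> \<eta> - \<eta> * x)" by (simp only: ereal_minus_le_minus)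
        also have "\<dots> = ereal (\<eta> * x - \<Lambda> \<eta>)" by simp
        also have "\<dots> \<le> J x" by (rule J_ge[OF \<eta>(1)])
        finally show ?thesis .
      qed
    qed
    then have "- ?L \<le> ?I" by (rule INF_greatest)
    then show ?thesis by (simp only: ereal_uminus_le_reorder)
  qed
  have speed: "ldp_speed (\<lambda>t. t)"
    by (auto simp: ldp_speed_def mono_on_def filterlim_ident intro!: measurable_restrict_space1)
  have "large_deviation_principle M (\<lambda>t \<omega>. Y t \<omega> / t) J (\<lambda>t. t)"
    unfolding large_deviation_principle_def Let_def
  proof (intro conjI ballI allI impI)
    show "prob_space M" by unfold_locales
    show "rate_function J" using good by (simp add: good_rate_function_def)
    show "Liminf at_top (\<lambda>t. ereal (1 / t) * ereal_log (prob {\<omega> \<in> space M. Y t \<omega> / t \<in> B}))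
        \<le> Limsup at_top (\<lambda>t. ereal (1 / t) * ereal_log (prob {\<omega> \<in> space M. Y t \<omega> / t \<in> B}))" for B
      by (rule Liminf_le_Limsup) simp
  qed (use upper lower speed in auto)
  then show ?thesis using good unfolding J_def Y_def by blast
qed

end
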